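(* Let $f:\mathbb{R}^{n}\to\mathbb{R}$ be a nonnegative strictly convex function. For a nonzero real number $\alpha$ with $\alpha\neq 1$, let $g$ be the function defined by $g(x,z)=z^{\alpha}-f(x)$, $x=(x_1,\dots,x_n)$. Suppose that the level hypersurfaces $M_k=g^{-1}(k)$ ($k\in S_g$) of $g$ in the $(n+1)$-dimensional Euclidean space $\mathbb{E}^{n+1}$ are strictly convex. Then $g$ does not satisfy the following Condition $(S^* )$: for $k\in S_g$ with $k+h\in I_k$, $S_p^*(k,h)/|\nabla g(p)|$ with $p\in M_k$ is a nonnegative function $\eta_k(h)$ which depends only on $k$ and $h$ (not on $p$).
   Context: All objects are smooth and connected unless otherwise mentioned. A convex hypersurface of $\mathbb{R}^{n+1}$ is called strictly convex if it has positive normal curvatures with respect to the unit normal $N$ pointing to the convex side (in particular its Gauss-Kronecker curvature $K$ with respect to $N$ is positive). A convex function $f:\mathbb{R}^n\to\mathbb{R}$ is called strictly convex if its graph is strictly convex with respect to the upward unit normal. For a smooth function $g$ of $(x,z)\in\mathbb{R}^{n+1}$: $R_g$ is the set of regular values of $g$. It is assumed that there is an interval $S\subset R_g$ such that for every $k\in S$ the level hypersurface $M_k=g^{-1}(k)$ is a smooth strictly convex hypersurface in $\mathbb{E}^{n+1}$; $S_g$ denotes the maximal interval in $R_g$ with this property. For $k\in S_g$, $I_k\subset S_g$ is a maximal interval such that each $M_{k+h}$ with $k+h\in I_k$ lies in the convex side of $M_k$; it is of the form $(k,a)$ with $a>k$ or $(b,k)$ with $b<k$ according as the gradient $\nabla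 g$ points to the convex side of $M_k$ or not. For $k\in S_g$, $p\in M_k$ and sufficiently small $h$ with $k+h\in I_k$, let $\Psi$ be the tangent hyperplane of $M_k$ at $p$ and let $\Phi$ be the tangent hyperplane of $M_{k+h}$ at some point $v\in M_{k+h}$ which is parallel to $\Psi$. Then $S_p^*(k,h)$ is the $n$-dimensional surface area of the region of $M_k$ between the two hyperplanes $\Phi$ and $\Psi$. *)

theory Defs
  imports "HOL-Analysis.Analysis"
begin

section \<open>Smooth maps\<close>

primrec iter_partial ::
    "'a list \<Rightarrow> ('a::euclidean_space \<Rightarrow> 'b::real_normed_vector) \<Rightarrow> 'a \<Rightarrow> 'b" where
  "iter_partial [] F = F"
| "iter_partial (b # bs) F = (\<lambda>x. frechet_derivative (iter_partial bs F) (at x) b)"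

text \<open>Differentiability of all iterated partial derivatives on an open set is the same as
  \<open>C\<^sup>\<infinity>\<close>, since it makes all of them continuous.\<close>

definition smooth_on :: "'a::euclidean_space set \<Rightarrow> ('a \<Rightarrow> 'b::real_normed_vector) \<Rightarrow> bool" where
  "smooth_on W F \<longleftrightarrow>
     open W \<and> (\<forall>bs. set bs \<subseteq> Basis \<longrightarrow> (\<forall>x\<in>W. iter_partial bs F differentiable (at x)))"

definition grad :: "('a::euclidean_space \<Rightarrow> real) \<Rightarrow> 'a \<Rightarrow> 'a" where
  "grad F p = (\<Sum>b\<in>Basis. frechet_derivative F (at p) b *\<^sub>R b)"


section \<open>Hypersurfaces of Euclidean space\<close>

definition smooth_hypersurface :: "'a::euclidean_space set \<Rightarrow> bool" where
  "smooth_hypersurface M \<longleftrightarrow>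
     (\<forall>p\<in>M. \<exists>W F. p \<in> W \<and> smooth_on W F \<and> (\<forall>q\<in>W. grad F q \<noteq> 0) \<and>
        M \<inter> W = {q \<in> W. F q = (0::real)})"

definition curve_through :: "'a::euclidean_space set \<Rightarrow> 'a \<Rightarrow> (real \<Rightarrow> 'a) \<Rightarrow> bool" where
  "curve_through M p c \<longleftrightarrow>
     c 0 = p \<and> (\<exists>e>0. smooth_on {-e<..<e} c \<and> c ` {-e<..<e} \<subseteq> M)"

definition velocity :: "(real \<Rightarrow> 'a::euclidean_space) \<Rightarrow> real \<Rightarrow> 'a" where
  "velocity c t = vector_derivative c (at t)"

definition tangent_space :: "'a::euclidean_space set \<Rightarrow> 'a \<Rightarrow> 'a set" where
  "tangent_space M p = {velocity c 0 | c. curve_through M p c}"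

definition tangent_hyperplane :: "'a::euclidean_space set \<Rightarrow> 'a \<Rightarrow> 'a set" where
  "tangent_hyperplane M p = (\<lambda>w. p + w) ` tangent_space M p"

definition unit_normal :: "'a::euclidean_space set \<Rightarrow> 'a \<Rightarrow> 'a \<Rightarrow> bool" where
  "unit_normal M p N \<longleftrightarrow> norm N = 1 \<and> (\<forall>w\<in>tangent_space M p. N \<bullet> w = 0)"

text \<open>\<open>\<kappa>\<close> is the normal curvature of \<open>M\<close> at \<open>p\<close>, with respect to the unit normal \<open>N\<close>, in the
  unit tangent direction \<open>w\<close>: the normal component of the acceleration of a curve on \<open>M\<close> with
  velocity \<open>w\<close> at \<open>p\<close> (by Meusnier's theorem, the choice of the curve is irrelevant).\<close>

definition normal_curvature ::
    "'a::euclidean_space set \<Rightarrow> 'a \<Rightarrow> 'a \<Rightarrow> 'a \<Rightarrow> real \<Rightarrow> bool" where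
  "normal_curvature M p N w \<kappa> \<longleftrightarrow>
     norm w = 1 \<and>
     (\<exists>c. curve_through M p c \<and> velocity c 0 = w \<and> \<kappa> = velocity (velocity c) 0 \<bullet> N)"

definition positive_normal_curvatures :: "'a::euclidean_space set \<Rightarrow> 'a \<Rightarrow> 'a \<Rightarrow> bool" where
  "positive_normal_curvatures M p N \<longleftrightarrow> (\<forall>w \<kappa>. normal_curvature M p N w \<kappa> \<longrightarrow> 0 < \<kappa>)"

text \<open>A convex hypersurface is the full boundary of an open convex set, its convex side. The
  convex side is unique unless the hypersurface is a hyperplane.\<close>

definition convex_side :: "'a::euclidean_space set \<Rightarrow> 'a set \<Rightarrow> bool" where
  "convex_side M U \<longleftrightarrow> open U \<and> convex U \<and> U \<noteq> {} \<and> frontier U = M"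

definition strictly_convex_hypersurface :: "'a::euclidean_space set \<Rightarrow> bool" where
  "strictly_convex_hypersurface M \<longleftrightarrow>
     M \<noteq> {} \<and> connected M \<and> smooth_hypersurface M \<and>
     (\<exists>U. convex_side M U \<and>
        (\<forall>p\<in>M. \<exists>N. unit_normal M p N \<and> (\<forall>\<^sub>F t in at_right 0. p + t *\<^sub>R N \<in> U) \<and>
           positive_normal_curvatures M p N))"

definition lies_in_convex_side :: "'a::euclidean_space set \<Rightarrow> 'a set \<Rightarrow> bool" where
  "lies_in_convex_side M' M \<longleftrightarrow> (\<exists>U. convex_side M U \<and> M' \<subseteq> U)"

text \<open>The ambient space \<open>\<bbbE>\<^bsup>n+1\<^esup>\<close> is modelled by the product of \<open>\<bbbE>\<^bsup>n\<^esup>\<close> and the reals, whose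
  library norm is the Euclidean one.\<close>

definition strictly_convex_function :: "(real^'n \<Rightarrow> real) \<Rightarrow> bool" where
  "strictly_convex_function f \<longleftrightarrow>
     smooth_on UNIV f \<and> convex_on UNIV f \<and>
     (let G = range (\<lambda>x. (x, f x)) in
        \<forall>p\<in>G. \<exists>N. unit_normal G p N \<and> 0 < snd N \<and> positive_normal_curvatures G p N)"


section \<open>Surface area\<close>

definition gram_det :: "(real^'n \<Rightarrow> (real^'n) \<times> real) \<Rightarrow> real^'n \<Rightarrow> real" where
  "gram_det X u =
     det (\<chi> i j. frechet_derivative X (at u) (axis i 1) \<bullet> frechet_derivative X (at u) (axis j 1))"

definition parametrizes ::
    "(real^'n \<Rightarrow> (real^'n) \<times> real) \<Rightarrow> (real^'n) set \<Rightarrow> ((real^'n) \<times> real) set \<Rightarrow> bool" where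
  "parametrizes X U A \<longleftrightarrow>
     U \<in> sets lebesgue \<and> inj_on X U \<and> X ` U = A \<and>
     (\<exists>W. U \<subseteq> W \<and> smooth_on W X \<and> (\<forall>u\<in>W. inj (frechet_derivative X (at u))))"

text \<open>The \<open>n\<close>-dimensional area of a region of a hypersurface that is covered by a single regular
  parametrization (the value does not depend on the parametrization). Regions of graphs over
  open subsets of \<open>\<bbbE>\<^bsup>n\<^esup>\<close> are of this kind, in particular regions of the level sets of
  \<open>z powr \<alpha> - f x\<close> in the half-space \<open>z > 0\<close>, for \<open>\<alpha> \<noteq> 0\<close>.\<close>

definition surface_area :: "((real^'n) \<times> real) set \<Rightarrow> real" where
  "surface_area A =
     (THE s. \<exists>X U. parametrizes X U A \<and> s = integral U (\<lambda>u. sqrt (gram_det X u)))"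


section \<open>Level hypersurfaces\<close>

text \<open>Real powers of \<open>z\<close> are only meaningful for \<open>z > 0\<close>, so the functions have a domain \<open>D\<close>.\<close>

definition upper_half_space :: "((real^'n) \<times> real) set" where
  "upper_half_space = {p. 0 < snd p}"

definition level :: "'a set \<Rightarrow> ('a \<Rightarrow> real) \<Rightarrow> real \<Rightarrow> 'a set" where
  "level D g k = {p \<in> D. g p = k}"

definition regular_values :: "'a::euclidean_space set \<Rightarrow> ('a \<Rightarrow> real) \<Rightarrow> real set" where
  "regular_values D g = {k. \<forall>p\<in>level D g k. grad g p \<noteq> 0}"

definition interval_with :: "(real set \<Rightarrow> bool) \<Rightarrow> real set \<Rightarrow> bool" where
  "interval_with P I \<longleftrightarrow> is_interval I \<and> interior I \<noteq> {} \<and> P I"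

definition maximal_interval :: "(real set \<Rightarrow> bool) \<Rightarrow> real set \<Rightarrow> bool" where
  "maximal_interval P I \<longleftrightarrow>
     interval_with P I \<and> (\<forall>J. interval_with P J \<and> I \<subseteq> J \<longrightarrow> J = I)"

text \<open>The sets \<open>S\<^sub>g\<close> and \<open>I\<^sub>k\<close>.\<close>

definition is_S :: "'a::euclidean_space set \<Rightarrow> ('a \<Rightarrow> real) \<Rightarrow> real set \<Rightarrow> bool" where
  "is_S D g = maximal_interval (\<lambda>S. S \<subseteq> regular_values D g \<and>
     (\<forall>k\<in>S. strictly_convex_hypersurface (level D g k)))"

definition is_I ::
    "'a::euclidean_space set \<Rightarrow> ('a \<Rightarrow> real) \<Rightarrow> real set \<Rightarrow> real \<Rightarrow> real set \<Rightarrow> bool" where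
  "is_I D g S k = maximal_interval (\<lambda>I. I \<subseteq> S \<and>
     (\<forall>k'\<in>I. lies_in_convex_side (level D g k') (level D g k)))"

text \<open>The closed region between two parallel hyperplanes is the convex hull of their union.\<close>

definition region_between :: "'a::euclidean_space set \<Rightarrow> 'a set \<Rightarrow> 'a set \<Rightarrow> 'a set" where
  "region_between M \<Phi> \<Psi> = M \<inter> convex hull (\<Phi> \<union> \<Psi>)"

text \<open>The parallel tangent hyperplane at \<open>v\<close>, and with it the area \<open>S\<^sub>p\<^sup>*(k,h)\<close>, exists only for
  \<open>h\<close> sufficiently small, depending on \<open>p\<close>. The equation is therefore only required for such \<open>h\<close>.\<close>

definition condition_S_star ::
    "((real^'n) \<times> real) set \<Rightarrow> ((real^'n) \<times> real \<Rightarrow> real) \<Rightarrow> real set \<Rightarrow> bool" where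
  "condition_S_star D g S \<longleftrightarrow>
     (\<exists>\<eta>. (\<forall>k h. 0 \<le> \<eta> k h) \<and>
       (\<forall>k\<in>S. \<forall>I. is_I D g S k I \<longrightarrow>
         (\<forall>p\<in>level D g k. \<forall>\<^sub>F h in at 0. k + h \<in> I \<longrightarrow>
           (\<forall>v\<in>level D g (k + h).
             let \<Psi> = tangent_hyperplane (level D g k) p;
                 \<Phi> = tangent_hyperplane (level D g (k + h)) v
             in affine_parallel \<Psi> \<Phi> \<longrightarrow>
                surface_area (region_between (level D g k) \<Phi> \<Psi>) / norm (grad g p) = \<eta> k h))))"

end

theory Submission
  imports Defs "HOL-Computational_Algebra.Polynomial"
begin

text \<open>Letting \<open>h\<close> tend to \<open>0\<close>, the area of the cap at \<open>p\<close> is asymptotic to a constant times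
  \<open>(h / norm (grad g p)) powr (n / 2) / sqrt K\<close>, where \<open>K\<close> is the Gauss-Kronecker curvature. So the condition
  makes \<open>K * norm (grad g p) ^ (n + 2)\<close> constant on each level. With \<open>w = f x + k\<close> this says that
  \<open>A x * w powr (1 - 2 / \<alpha>) * (w + (1 / \<alpha> - 1) * B x)\<close> depends on \<open>k\<close> only, where \<open>A x > 0\<close> and \<open>B x\<close> is
  the square of the Newton decrement of \<open>f\<close>. Comparing two points as functions of \<open>k\<close> is contradictory
  unless \<open>\<alpha> = 2\<close>.

  For \<open>\<alpha> = 2\<close> the identity says that \<open>f - B / 2\<close> is constant, which forces \<open>f\<close> to be a quadratic
  polynomial. The levels are then sheets of hyperboloids, and Lorentz boosts move caps to
  caps. The areas of the cap at the vertex and of a boosted cap become integrals over the same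
  ellipsoid, and a pointwise comparison of the two integrands, symmetrized under \<open>y \<mapsto> - y\<close>, shows that
  they are not in the ratio of the gradients.\<close>


section \<open>Closure properties of smooth maps\<close>

text \<open>The limit as \<open>h\<close> tends to \<open>0\<close> sees only second-order data, and
  the hyperboloids (\<open>\<alpha> = 2\<close> with quadratic \<open>f\<close>) pass that test:
  there both \<open>A\<close> and \<open>w - B / 2\<close> are constant on a level. This is why the
  exponent two needs the areas at a fixed positive \<open>h\<close>. For the other exponents the
  freedom in \<open>k\<close> decides: \<open>w + (1 / \<alpha> - 1) * B\<close> is affine in
  \<open>k\<close>, and at two points with different values of \<open>f\<close> the products with
  \<open>w powr (1 - 2 / \<alpha>)\<close> cannot stay proportional unless that power is constant or
  the correction term vanishes. The correction term vanishes identically only for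
  \<open>\<alpha> = 1\<close>. The equation holds only for \<open>h\<close> below a bound that
  depends on the point. So every comparison involves just two points, either in the limit or at one
  common small \<open>h\<close>. Convexity of a level is given through an unspecified convex side.
  That this side lies above the graph, also for negative \<open>\<alpha>\<close>, has to be derived
  before any cap can be described. Determinants of Hessians appear as volumes of ellipsoids, because
  only their behaviour under scaling and rank one changes matters.\<close>

lemma frechet_derivative_cong_open:
  assumes "open W" "x \<in> W" "\<And>y. y \<in> W \<Longrightarrow> F y = G y" "G differentiable (at x)"
  shows "frechet_derivative F (at x) = frechet_derivative G (at x)" "F differentiable (at x)"
proof -
  have "frechet_derivative G (at x) = frechet_derivative F (at x)"
    by (rule frechet_derivative_transform_within_open[OF assms(4,1,2)]) (simp add: assms(3))
  then show "frechet_derivative F (at x) = frechet_derivative G (at x)" ..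
  show "F differentiable (at x)"
    using assms has_derivative_transform_within_open[of G _ x UNIV W F] unfolding differentiable_def by metis
qed

inductive generated :: "('a \<Rightarrow> real) set \<Rightarrow> ('a \<Rightarrow> real) \<Rightarrow> bool" for B where
  base: "F \<in> B \<Longrightarrow> generated B F"
| const: "generated B (\<lambda>x. c)"
| add: "generated B F \<Longrightarrow> generated B G \<Longrightarrow> generated B (\<lambda>x. F x + G x)"
| mult: "generated B F \<Longrightarrow> generated B G \<Longrightarrow> generated B (\<lambda>x. F x * G x)"

lemma generated_sum:
  assumes "finite I" "\<And>i. i \<in> I \<Longrightarrow> generated B (F i)"
  shows "generated B (\<lambda>x. \<Sum>i\<in>I. F i x)"
  using assms by (induction I rule: finite_induct) (auto intro: generated.intros)

text \<open>An algebra of functions that is closed under the partial derivatives of its generators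
  consists of smooth functions.\<close>

lemma generated_smooth:
  fixes F :: "'a::euclidean_space \<Rightarrow> real"
  assumes W: "open W"
    and dif: "\<And>F x. F \<in> B \<Longrightarrow> x \<in> W \<Longrightarrow> F differentiable (at x)"
    and der: "\<And>F b. F \<in> B \<Longrightarrow> b \<in> Basis \<Longrightarrow>
      \<exists>G. generated B G \<and> (\<forall>x\<in>W. frechet_derivative F (at x) b = G x)"
    and F: "generated B F"
  shows "smooth_on W F"
proof -
  \<comment> \<open>Agreement is claimed on \<open>W\<close> only, since the derivative of a
    generator is controlled nowhere else. Openness of \<open>W\<close> makes this enough for
    iterating.\<close>
  have step: "(\<forall>x\<in>W. F differentiable (at x)) \<and>
      (\<forall>b\<in>Basis. \<exists>G. generated B G \<and> (\<forall>x\<in>W. frechet_derivative F (at x) b = G x))"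
    if "generated B F" for F
    using that
  proof (induction rule: generated.induct)
    case (base F) then show ?case using dif der by blast
  next
    case (const c) then show ?case by (auto intro!: exI[of _ "\<lambda>x. 0"] generated.const)
  next
    case (add F G)
    show ?case
    proof (intro conjI ballI)
      fix b :: 'a assume b: "b \<in> Basis"
      obtain F' G' where *: "generated B F'" "\<forall>x\<in>W. frechet_derivative F (at x) b = F' x"
        "generated B G'" "\<forall>x\<in>W. frechet_derivative G (at x) b = G' x"
        using add b by blast
      have "frechet_derivative (\<lambda>x. F x + G x) (at x) b = F' x + G' x" if "x \<in> W" for x
      proof -
        have "((\<lambda>x. F x + G x) has_derivative
          (\<lambda>h. frechet_derivative F (at x) h + frechet_derivative G (at x) h)) (at x)"
          using add that by (intro has_derivative_add) (auto simp: frechet_derivative_works)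
        then show ?thesis using * that by (simp add: frechet_derivative_at[symmetric])
      qed
      then show "\<exists>H. generated B H \<and> (\<forall>x\<in>W. frechet_derivative (\<lambda>x. F x + G x) (at x) b = H x)"
        using * by (intro exI[of _ "\<lambda>x. F' x + G' x"]) (auto intro: generated.intros)
    qed (use add in auto)
  next
    case (mult F G)
    show ?case
    proof (intro conjI ballI)
      fix b :: 'a assume b: "b \<in> Basis"
      obtain F' G' where *: "generated B F'" "\<forall>x\<in>W. frechet_derivative F (at x) b = F' x"
        "generated B G'" "\<forall>x\<in>W. frechet_derivative G (at x) b = G' x"
        using mult b by blast
      have "frechet_derivative (\<lambda>x. F x * G x) (at x) b = F x * G' x + F' x * G x" if "x \<in> W" for x
      proof -
        have "((\<lambda>x. F x * G x) has_derivative
          (\<lambda>h. F x * frechet_derivative G (at x) h + frechet_derivative F (at x) h * G x)) (at x)"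
          using mult that by (intro has_derivative_mult) (auto simp: frechet_derivative_works)
        then show ?thesis using * that by (simp add: frechet_derivative_at[symmetric])
      qed
      then show "\<exists>H. generated B H \<and> (\<forall>x\<in>W. frechet_derivative (\<lambda>x. F x * G x) (at x) b = H x)"
        using * mult by (intro exI[of _ "\<lambda>x. F x * G' x + F' x * G x"]) (auto intro: generated.intros)
    qed (use mult in auto)
  qed
  have iter: "\<exists>G. generated B G \<and> (\<forall>x\<in>W. iter_partial bs F x = G x)" if "set bs \<subseteq> Basis" for bs
    using that
  proof (induction bs)
    case Nil then show ?case using F by auto
  next
    case (Cons b bs)
    then obtain G where G: "generated B G" "\<forall>x\<in>W. iter_partial bs F x = G x" by auto
    obtain G' where G': "generated B G'" "\<forall>x\<in>W. frechet_derivative G (at x) b = G' x"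
      using step[OF G(1)] Cons.prems by auto
    have "iter_partial (b # bs) F x = G' x" if "x \<in> W" for x
      using frechet_derivative_cong_open(1)[OF W that, of "iter_partial bs F" G] G G' step[OF G(1)] that
      by simp
    then show ?case using G' by blast
  qed
  show ?thesis
    unfolding smooth_on_def
  proof (intro conjI allI impI ballI W)
    fix bs :: "'a list" and x assume "set bs \<subseteq> Basis" "x \<in> W"
    then show "iter_partial bs F differentiable (at x)"
      using iter[of bs] step frechet_derivative_cong_open(2)[OF W \<open>x \<in> W\<close>, of "iter_partial bs F"]
      by blast
  qed
qed

lemma smooth_on_differentiable: "smooth_on W F \<Longrightarrow> x \<in> W \<Longrightarrow> F differentiable (at x)"
  unfolding smooth_on_def by (metis empty_subsetI iter_partial.simps(1) list.set(1))

lemma smooth_on_iter_partial_differentiable: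
  "smooth_on W F \<Longrightarrow> set bs \<subseteq> Basis \<Longrightarrow> x \<in> W \<Longrightarrow> iter_partial bs F differentiable (at x)"
  unfolding smooth_on_def by blast

lemma frechet_derivative_sum_Basis:
  fixes F :: "'a::euclidean_space \<Rightarrow> 'b::real_normed_vector"
  assumes "F differentiable (at x)"
  shows "frechet_derivative F (at x) v = (\<Sum>c\<in>Basis. (v \<bullet> c) *\<^sub>R frechet_derivative F (at x) c)"
proof -
  interpret linear "frechet_derivative F (at x)"
    using assms by (rule linear_frechet_derivative)
  have "frechet_derivative F (at x) (\<Sum>c\<in>Basis. (v \<bullet> c) *\<^sub>R c) = 
    (\<Sum>c\<in>Basis. (v \<bullet> c) *\<^sub>R frechet_derivative F (at x) c)"
    by (simp add: sum scaleR)
  then show ?thesis by (simp add: euclidean_representation)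
qed

text \<open>The pullbacks of all iterated partials of \<open>F\<close> generate a suitable algebra:
  by the chain rule a partial of such a pullback is a linear combination of pullbacks of partials of
  one order more.\<close>

lemma smooth_on_affine_comp:
  fixes F :: "'a::euclidean_space \<Rightarrow> real" and L :: "'b::euclidean_space \<Rightarrow> 'a"
  assumes F: "smooth_on W F" and L: "linear L"
  shows "smooth_on ((\<lambda>x. a + L x) -` W) (\<lambda>x. F (a + L x))"
proof -
  let ?l = "\<lambda>x. a + L x"
  let ?B = "{\<lambda>x. iter_partial bs F (?l x) |bs. set bs \<subseteq> Basis}"
  have bl: "bounded_linear L" using L by (simp add: linear_conv_bounded_linear)
  have hl: "(?l has_derivative L) (at x)" for x
    using has_derivative_add[OF has_derivative_const bounded_linear_imp_has_derivative[OF bl]] by simp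
  have W: "open W" using F by (simp add: smooth_on_def)
  have cont: "continuous_on UNIV ?l"
    by (intro continuous_on_add continuous_on_const linear_continuous_on bl)
  have op: "open (?l -` W)" by (rule open_vimage[OF W cont])
  have hd: "((\<lambda>x. iter_partial bs F (?l x)) has_derivative
      (\<lambda>v. frechet_derivative (iter_partial bs F) (at (?l x)) (L v))) (at x)"
    if "set bs \<subseteq> Basis" "?l x \<in> W" for bs x
    using has_derivative_compose[OF hl frechet_derivative_works[THEN iffD1]]
      smooth_on_iter_partial_differentiable[OF F that] by blast
  show ?thesis
  proof (rule generated_smooth[OF op, of ?B])
    show "generated ?B (\<lambda>x. F (?l x))"
      by (rule generated.base) (auto intro!: exI[of _ "[]"])
    fix f assume "f \<in> ?B"
    then obtain bs where bs: "set bs \<subseteq> Basis" "f = (\<lambda>x. iter_partial bs F (?l x))" by auto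
    show "f differentiable at x" if "x \<in> ?l -` W" for x
      using hd[OF bs(1)] that bs(2) by (auto simp: differentiable_def)
    fix b :: 'b
    let ?G = "\<lambda>x. \<Sum>c\<in>Basis. (L b \<bullet> c) * iter_partial (c # bs) F (?l x)"
    have "generated ?B ?G"
      by (intro generated_sum finite_Basis generated.mult generated.const generated.base)
        (use bs in \<open>auto intro!: exI[of _ "_ # bs"]\<close>)
    moreover have "frechet_derivative f (at x) b = ?G x" if "x \<in> ?l -` W" for x
      using frechet_derivative_at[OF hd[OF bs(1)], symmetric, of x] that bs
        frechet_derivative_sum_Basis[OF smooth_on_iter_partial_differentiable[OF F bs(1)], of "?l x" "L b"]
      by simp
    ultimately show "\<exists>G. generated ?B G \<and> (\<forall>x\<in>?l -` W. frechet_derivative f (at x) b = G x)"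
      by blast
  qed
qed

text \<open>The generators include the powers with every real exponent at once, because each
  differentiation lowers the exponent by one and produces a partial of \<open>F\<close>.\<close>

lemma smooth_on_powr:
  fixes F :: "'a::euclidean_space \<Rightarrow> real"
  assumes F: "smooth_on W F"
  shows "smooth_on {x \<in> W. 0 < F x + k} (\<lambda>x. (F x + k) powr r)"
proof -
  let ?W = "{x \<in> W. 0 < F x + k}"
  let ?B = "{iter_partial bs F |bs. set bs \<subseteq> Basis} \<union> {\<lambda>x. (F x + k) powr r |r. True}"
  have W: "open W" using F by (simp add: smooth_on_def)
  have cont: "continuous_on W (\<lambda>x. F x + k)"
    by (intro continuous_intros continuous_at_imp_continuous_on ballI differentiable_imp_continuous_within
      smooth_on_differentiable[OF F])
  have op: "open ?W"
  proof -
    have "?W = (\<lambda>x. F x + k) -` {0<..} \<inter> W" by auto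
    then show ?thesis using continuous_open_preimage[OF cont W, of "{0<..}"] by (simp add: Int_commute)
  qed
  have hd: "((\<lambda>x. (F x + k) powr r) has_derivative
      (\<lambda>v. frechet_derivative F (at x) v * (r * (F x + k) powr (r - 1)))) (at x)"
    if "x \<in> ?W" for x r
  proof -
    have 1: "((\<lambda>x. F x + k) has_derivative frechet_derivative F (at x)) (at x)"
      using has_derivative_add[OF frechet_derivative_works[THEN iffD1] has_derivative_const, of F "at x" k]
        smooth_on_differentiable[OF F] that by simp
    have 2: "((\<lambda>y. y powr r) has_derivative (\<lambda>v. v * (r * (F x + k) powr (r - 1)))) (at (F x + k))"
      using has_real_derivative_powr[of "F x + k" r] that
      by (auto simp: has_field_derivative_def fun_eq_iff elim!: has_derivative_eq_rhs)
    show ?thesis using has_derivative_compose[OF 1 2] by simp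
  qed
  have g1: "generated ?B (iter_partial bs F)" if "set bs \<subseteq> Basis" for bs
    using that by (auto intro!: generated.base)
  have g2: "generated ?B (\<lambda>x. (F x + k) powr r)" for r
    by (rule generated.base) auto
  show ?thesis
  proof (rule generated_smooth[OF op _ _ g2])
    fix f assume "f \<in> ?B"
    then consider bs where "set bs \<subseteq> Basis" "f = iter_partial bs F" | r where "f = (\<lambda>x. (F x + k) powr r)" by auto
    note cs = this
    show "f differentiable at x" if "x \<in> ?W" for x
      using cs hd smooth_on_iter_partial_differentiable[OF F] that by cases (auto simp: differentiable_def)
    fix b :: 'a assume b: "b \<in> Basis"
    from cs show "\<exists>G. generated ?B G \<and> (\<forall>x\<in>?W. frechet_derivative f (at x) b = G x)"
    proof cases
      case 1
      then show ?thesis using g1[of "b # bs"] b by (intro exI[of _ "iter_partial (b # bs) F"]) auto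
    next
      case (2 r)
      have "generated ?B (\<lambda>x. iter_partial [b] F x * (r * (F x + k) powr (r - 1)))"
        using b by (intro generated.mult generated.const g1 g2) auto
      then show ?thesis
        using frechet_derivative_at[OF hd, symmetric, of _ r] 2
        by (intro exI[of _ "\<lambda>x. iter_partial [b] F x * (r * (F x + k) powr (r - 1))"]) auto
    qed
  qed
qed

text \<open>The algebra argument concerns real values only; for pairs the iterated partials are
  computed componentwise.\<close>

lemma smooth_on_Pair:
  fixes F :: "'a::euclidean_space \<Rightarrow> 'b::real_normed_vector" and G :: "'a \<Rightarrow> 'c::real_normed_vector"
  assumes F: "smooth_on W F" and G: "smooth_on W G"
  shows "smooth_on W (\<lambda>x. (F x, G x))"
proof -
  have W: "open W" using F by (simp add: smooth_on_def)
  have hd: "((\<lambda>x. (iter_partial bs F x, iter_partial bs G x)) has_derivative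
      (\<lambda>v. (frechet_derivative (iter_partial bs F) (at x) v, frechet_derivative (iter_partial bs G) (at x) v))) (at x)"
    if "set bs \<subseteq> Basis" "x \<in> W" for bs x
    using smooth_on_iter_partial_differentiable[OF F that] smooth_on_iter_partial_differentiable[OF G that]
    by (intro has_derivative_Pair) (auto simp: frechet_derivative_works)
  have dif: "(\<lambda>x. (iter_partial bs F x, iter_partial bs G x)) differentiable (at x)"
    if "set bs \<subseteq> Basis" "x \<in> W" for bs x
    using hd[OF that] by (auto simp: differentiable_def)
  have eq: "iter_partial bs (\<lambda>x. (F x, G x)) x = (iter_partial bs F x, iter_partial bs G x)"
    if "set bs \<subseteq> Basis" "x \<in> W" for bs x
    using that
  proof (induction bs arbitrary: x)
    case (Cons b bs)
    then have bs: "set bs \<subseteq> Basis" by auto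
    show ?case
      using frechet_derivative_cong_open(1)[OF W Cons.prems(2) Cons.IH[OF bs] dif[OF bs Cons.prems(2)]]
        frechet_derivative_at[OF hd[OF bs Cons.prems(2)], symmetric]
      by simp
  qed simp
  show ?thesis
    unfolding smooth_on_def
  proof (intro conjI allI impI ballI W)
    fix bs :: "'a list" and x assume "set bs \<subseteq> Basis" "x \<in> W"
    then show "iter_partial bs (\<lambda>x. (F x, G x)) differentiable (at x)"
      using frechet_derivative_cong_open(2)[OF W \<open>x \<in> W\<close> eq dif] by blast
  qed
qed

lemma smooth_on_affine:
  fixes L :: "'a::euclidean_space \<Rightarrow> 'b::real_normed_vector"
  assumes L: "bounded_linear L" and "open W"
  shows "smooth_on W (\<lambda>x. a + L x)"
proof -
  have hd: "((\<lambda>x. a + L x) has_derivative L) (at x)" for x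
    using has_derivative_add[OF has_derivative_const bounded_linear_imp_has_derivative[OF L]] by simp
  have "bs = [] \<or> (\<exists>c. iter_partial bs (\<lambda>x. a + L x) = (\<lambda>_. c))" for bs
  proof (induction bs)
    case (Cons b bs)
    then consider "bs = []" | c where "iter_partial bs (\<lambda>x. a + L x) = (\<lambda>_. c)" by auto
    then show ?case
    proof cases
      case 1
      then have "iter_partial (b # bs) (\<lambda>x. a + L x) = (\<lambda>_. L b)"
        using frechet_derivative_at[OF hd, symmetric] by auto
      then show ?thesis by blast
    next
      case 2
      then have "iter_partial (b # bs) (\<lambda>x. a + L x) = (\<lambda>_. 0)" by auto
      then show ?thesis by blast
    qed
  qed simp
  moreover have "(\<lambda>x. a + L x) differentiable (at x)" for x
    using hd by (auto simp: differentiable_def)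
  ultimately show ?thesis
    unfolding smooth_on_def using assms(2) by (metis differentiable_const iter_partial.simps(1))
qed

section \<open>Gradients, Hessians and the symmetry of second derivatives\<close>

lemma has_derivative_grad:
  fixes F :: "'a::euclidean_space \<Rightarrow> real"
  assumes "F differentiable (at x)"
  shows "(F has_derivative (\<lambda>v. grad F x \<bullet> v)) (at x)"
proof -
  have "frechet_derivative F (at x) v = grad F x \<bullet> v" for v
    using frechet_derivative_sum_Basis[OF assms, of v]
    by (simp add: grad_def inner_sum_left mult.commute[of _ "_ \<bullet> v"] inner_commute[of v])
  then have "frechet_derivative F (at x) = (\<lambda>v. grad F x \<bullet> v)" by auto
  then show ?thesis using assms frechet_derivative_works by metis
qed

lemma grad_unique:
  fixes F :: "'a::euclidean_space \<Rightarrow> real"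
  assumes "(F has_derivative (\<lambda>v. g \<bullet> v)) (at x)"
  shows "grad F x = g"
  using frechet_derivative_at[OF assms, symmetric] by (simp add: grad_def euclidean_representation)

definition hess :: "('a::euclidean_space \<Rightarrow> real) \<Rightarrow> 'a \<Rightarrow> 'a \<Rightarrow> 'a" where
  "hess F x = frechet_derivative (grad F) (at x)"

lemma has_derivative_hess:
  fixes F :: "'a::euclidean_space \<Rightarrow> real"
  assumes "smooth_on W F" "x \<in> W"
  shows "(grad F has_derivative hess F x) (at x)"
proof -
  have "grad F differentiable (at x)"
    unfolding grad_def
    using smooth_on_iter_partial_differentiable[OF assms(1) _ assms(2), of "[_]"]
    by (auto intro!: differentiable_sum differentiable_scaleR)
  then show ?thesis unfolding hess_def by (simp add: frechet_derivative_works)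
qed

lemma hess_unique:
  assumes "(grad F has_derivative L) (at x)"
  shows "hess F x = L"
  unfolding hess_def using frechet_derivative_at[OF assms] by simp

lemma linear_hess:
  fixes F :: "'a::euclidean_space \<Rightarrow> real"
  assumes "smooth_on W F" "x \<in> W"
  shows "linear (hess F x)"
  using has_derivative_hess[OF assms] has_derivative_linear by blast

lemma smooth_on_subset: "smooth_on W F \<Longrightarrow> open V \<Longrightarrow> V \<subseteq> W \<Longrightarrow> smooth_on V F"
  unfolding smooth_on_def by blast

text \<open>The second difference \<open>\<Delta> s u v\<close> is symmetric in \<open>u\<close> and
  \<open>v\<close>, and it equals \<open>s^2 * (hess F x u \<bullet> v)\<close> up to an error small
  compared with \<open>s^2\<close>. Only differentiability of the gradient at the single point
  \<open>x\<close> is used for the estimate.\<close>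

lemma hess_symmetric:
  fixes F :: "'a::euclidean_space \<Rightarrow> real"
  assumes F: "smooth_on W F" and x: "x \<in> W"
  shows "hess F x u \<bullet> v = hess F x v \<bullet> u"
proof -
  define A where "A = norm u + norm v + 1"
  define \<Delta> where "\<Delta> s u v = F (x + s *\<^sub>R u + s *\<^sub>R v) - F (x + s *\<^sub>R u) - F (x + s *\<^sub>R v) + F x" for s u v
  have A: "A > 0" by (simp add: A_def add_nonneg_pos)
  have bd: "\<bar>\<Delta> s u v - s\<^sup>2 * (hess F x u \<bullet> v)\<bar> \<le> 2 * e * A\<^sup>2 * s\<^sup>2"
    if r: "ball x r \<subseteq> W" and e: "e > 0" and s: "0 < s" "s * A < r"
      and uv: "norm u + norm v + 1 = A"
      and small: "\<And>y. norm (y - x) < r \<Longrightarrow> norm (grad F y - grad F x - hess F x (y - x)) \<le> e * norm (y - x)"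
    for r e s u v
  proof -
    have nle: "norm (a *\<^sub>R u + b *\<^sub>R v) \<le> s * A" "norm (a *\<^sub>R u + b *\<^sub>R v) < r"
      if "0 \<le> a" "a \<le> s" "0 \<le> b" "b \<le> s" for a b
    proof -
      have "norm (a *\<^sub>R u + b *\<^sub>R v) \<le> a * norm u + b * norm v"
        using norm_triangle_ineq[of "a *\<^sub>R u" "b *\<^sub>R v"] that by simp
      also have "\<dots> \<le> s * norm u + s * norm v" using that by (intro add_mono mult_right_mono) auto
      also have "\<dots> \<le> s * A" using s uv by (simp add: algebra_simps flip: uv)
      finally show "norm (a *\<^sub>R u + b *\<^sub>R v) \<le> s * A" .
      then show "norm (a *\<^sub>R u + b *\<^sub>R v) < r" using s by simp
    qed
    have inW: "x + (a *\<^sub>R u + b *\<^sub>R v) \<in> W" if "0 \<le> a" "a \<le> s" "0 \<le> b" "b \<le> s" for a b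
    proof -
      have "dist (x + (a *\<^sub>R u + b *\<^sub>R v)) x < r"
        using nle(2)[OF that] unfolding dist_norm add_diff_cancel_left' .
      then show ?thesis using r by (auto simp: dist_commute subset_iff)
    qed
    \<comment> \<open>\<open>\<Delta>\<close> is the increment of \<open>?g\<close> over
      \<open>{0..s}\<close>. The mean value theorem turns it into a difference of two gradients, to
      which the first-order expansion of the gradient at \<open>x\<close> applies.\<close>
    let ?g = "\<lambda>t. F (x + (s *\<^sub>R u + t *\<^sub>R v)) - F (x + (0 *\<^sub>R u + t *\<^sub>R v))"
    let ?g' = "\<lambda>t. (grad F (x + (s *\<^sub>R u + t *\<^sub>R v)) - grad F (x + (0 *\<^sub>R u + t *\<^sub>R v))) \<bullet> v"
    have line: "((\<lambda>t. F (x + (a *\<^sub>R u + t *\<^sub>R v))) has_real_derivative grad F (x + (a *\<^sub>R u + t *\<^sub>R v)) \<bullet> v) (at t)"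
      if "0 \<le> a" "a \<le> s" "0 \<le> t" "t \<le> s" for a t
    proof -
      have 1: "((\<lambda>t. x + (a *\<^sub>R u + t *\<^sub>R v)) has_derivative (\<lambda>h. h *\<^sub>R v)) (at t)"
        by (auto intro!: derivative_eq_intros)
      from has_derivative_compose[OF 1 has_derivative_grad[OF smooth_on_differentiable[OF F inW[OF that]]]]
      show ?thesis by (auto simp: has_field_derivative_def mult.commute elim!: has_derivative_eq_rhs)
    qed
    have "\<exists>z. 0 < z \<and> z < s \<and> ?g s - ?g 0 = (s - 0) * ?g' z"
    proof (rule MVT2[OF s(1)])
      fix t assume "0 \<le> t" "t \<le> s"
      then show "(?g has_real_derivative ?g' t) (at t)"
        using s(1) unfolding inner_diff_left by (intro DERIV_diff line) auto
    qed
    then obtain t where t: "0 < t" "t < s" "?g s - ?g 0 = s * ?g' t" by auto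
    define y1 where "y1 = s *\<^sub>R u + t *\<^sub>R v" 
    define y2 where "y2 = 0 *\<^sub>R u + t *\<^sub>R v"
    have y: "norm y1 \<le> s * A" "norm y1 < r" "norm y2 \<le> s * A" "norm y2 < r"
      unfolding y1_def y2_def using nle[of s t] nle[of 0 t] t s by auto
    interpret H: linear "hess F x" by (rule linear_hess[OF F x])
    have h1: "norm (grad F (x + y1) - grad F x - hess F x y1) \<le> e * (s * A)"
      using small[of "x + y1"] y e by (auto intro: order_trans mult_left_mono)
    have h2: "norm (grad F (x + y2) - grad F x - hess F x y2) \<le> e * (s * A)"
      using small[of "x + y2"] y e by (auto intro: order_trans mult_left_mono)
    have "hess F x y1 - hess F x y2 = s *\<^sub>R hess F x u"
      unfolding H.diff[symmetric] y1_def y2_def by (simp add: H.scaleR)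
    then have eq: "grad F (x + y1) - grad F (x + y2) - s *\<^sub>R hess F x u
      = (grad F (x + y1) - grad F x - hess F x y1) - (grad F (x + y2) - grad F x - hess F x y2)"
      by (simp add: algebra_simps)
    have n: "norm (grad F (x + y1) - grad F (x + y2) - s *\<^sub>R hess F x u) \<le> 2 * e * (s * A)"
      unfolding eq using norm_triangle_ineq4[of "grad F (x + y1) - grad F x - hess F x y1" "grad F (x + y2) - grad F x - hess F x y2"]
        h1 h2 by simp
    have D: "\<Delta> s u v = s * ((grad F (x + y1) - grad F (x + y2)) \<bullet> v)"
      using t(3) unfolding \<Delta>_def y1_def y2_def by (simp add: algebra_simps)
    have "\<Delta> s u v - s\<^sup>2 * (hess F x u \<bullet> v) = s * ((grad F (x + y1) - grad F (x + y2) - s *\<^sub>R hess F x u) \<bullet> v)"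
      unfolding D by (simp add: inner_diff_left power2_eq_square algebra_simps)
    also have "\<bar>\<dots>\<bar> \<le> s * ((2 * e * (s * A)) * A)"
    proof -
      have "\<bar>(grad F (x + y1) - grad F (x + y2) - s *\<^sub>R hess F x u) \<bullet> v\<bar> \<le> (2 * e * (s * A)) * norm v"
        using Cauchy_Schwarz_ineq2 n by (meson mult_right_mono norm_ge_zero order_trans)
      also have "\<dots> \<le> (2 * e * (s * A)) * A"
        using e s A uv norm_ge_zero[of u] by (intro mult_left_mono mult_nonneg_nonneg) linarith+
      finally show ?thesis using s by (simp add: abs_mult)
    qed
    finally show ?thesis by (simp add: power2_eq_square algebra_simps)
  qed
  have "\<bar>hess F x u \<bullet> v - hess F x v \<bullet> u\<bar> \<le> 4 * A\<^sup>2 * e" if e: "e > 0" for e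
  proof -
    obtain r0 where r0: "r0 > 0" "ball x r0 \<subseteq> W"
      using F x open_contains_ball unfolding smooth_on_def by metis
    obtain d where d: "d > 0" "\<And>y. norm (y - x) < d \<Longrightarrow> norm (grad F y - grad F x - hess F x (y - x)) \<le> e * norm (y - x)"
      using has_derivative_hess[OF F x] e unfolding has_derivative_at_alt by blast
    define r where "r = min r0 d"
    define s where "s = r / (2 * A)"
    have s: "0 < s" "s * A < r" using r0 d A by (auto simp: s_def r_def field_simps)
    have 1: "\<bar>\<Delta> s u v - s\<^sup>2 * (hess F x u \<bullet> v)\<bar> \<le> 2 * e * A\<^sup>2 * s\<^sup>2"
      by (rule bd[of r]) (use r0 d e s in \<open>auto simp: r_def A_def\<close>)
    have 2: "\<bar>\<Delta> s v u - s\<^sup>2 * (hess F x v \<bullet> u)\<bar> \<le> 2 * e * A\<^sup>2 * s\<^sup>2"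
      by (rule bd[of r]) (use r0 d e s in \<open>auto simp: r_def A_def\<close>)
    have sw: "\<Delta> s v u = \<Delta> s u v" unfolding \<Delta>_def by (simp add: algebra_simps)
    have "s\<^sup>2 * \<bar>hess F x u \<bullet> v - hess F x v \<bullet> u\<bar> = \<bar>s\<^sup>2 * (hess F x u \<bullet> v) - s\<^sup>2 * (hess F x v \<bullet> u)\<bar>"
      by (simp flip: right_diff_distrib add: abs_mult)
    also have "\<dots> \<le> s\<^sup>2 * (4 * A\<^sup>2 * e)" using 1 2 unfolding sw by (simp add: algebra_simps)
    finally show ?thesis using s(1) by simp
  qed
  then have "\<bar>hess F x u \<bullet> v - hess F x v \<bullet> u\<bar> \<le> 0 + e" if "e > 0" for e
    using that[THEN divide_pos_pos, of "4 * A\<^sup>2"] A by (metis add_0 mult_pos_pos nonzero_eq_divide_eq order_less_irrefl mult.commute zero_less_numeral zero_less_power)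
  then have "\<bar>hess F x u \<bullet> v - hess F x v \<bullet> u\<bar> \<le> 0" by (rule field_le_epsilon)
  then show ?thesis by simp
qed

section \<open>Graphs\<close>

definition graph_over :: "'a set \<Rightarrow> ('a \<Rightarrow> real) \<Rightarrow> ('a \<times> real) set" where
  "graph_over D \<phi> = (\<lambda>x. (x, \<phi> x)) ` D"

lemma curve_through_graph_over:
  fixes \<phi> :: "'a::euclidean_space \<Rightarrow> real"
  assumes \<phi>: "smooth_on D \<phi>" and x: "x \<in> D"
  shows "curve_through (graph_over D \<phi>) (x, \<phi> x) (\<lambda>t. (x + t *\<^sub>R w, \<phi> (x + t *\<^sub>R w)))"
    and "\<forall>\<^sub>F t in nhds 0. x + t *\<^sub>R w \<in> D"
proof -
  have lin: "linear (\<lambda>t. t *\<^sub>R w)" by (simp add: linear_iff algebra_simps)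
  have sm: "smooth_on ((\<lambda>t. x + t *\<^sub>R w) -` D) (\<lambda>t. \<phi> (x + t *\<^sub>R w))"
    by (rule smooth_on_affine_comp[OF \<phi> lin])
  then have op: "open ((\<lambda>t. x + t *\<^sub>R w) -` D)" by (simp add: smooth_on_def)
  then show "\<forall>\<^sub>F t in nhds 0. x + t *\<^sub>R w \<in> D"
    using x eventually_nhds_in_open[OF op, of 0] by simp
  obtain e where e: "e > 0" "ball 0 e \<subseteq> (\<lambda>t. x + t *\<^sub>R w) -` D"
  proof -
    have "0 \<in> (\<lambda>t. x + t *\<^sub>R w) -` D" using x by simp
    then show ?thesis using that open_contains_ball_eq[OF op] by blast
  qed
  have b: "ball 0 e = {-e<..<e}" by (auto simp: dist_norm)
  have "smooth_on {-e<..<e} (\<lambda>t. (x + t *\<^sub>R w, \<phi> (x + t *\<^sub>R w)))"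
    using smooth_on_subset[OF sm] e b lin
    by (intro smooth_on_Pair smooth_on_affine) (auto intro: bounded_linear_scaleR_left)
  moreover have "(\<lambda>t. (x + t *\<^sub>R w, \<phi> (x + t *\<^sub>R w))) ` {-e<..<e} \<subseteq> graph_over D \<phi>"
    using e b by (auto simp: graph_over_def)
  ultimately show "curve_through (graph_over D \<phi>) (x, \<phi> x) (\<lambda>t. (x + t *\<^sub>R w, \<phi> (x + t *\<^sub>R w)))"
    using e(1) unfolding curve_through_def by auto
qed

lemma velocity_graph_line:
  fixes \<phi> :: "'a::euclidean_space \<Rightarrow> real"
  assumes \<phi>: "smooth_on D \<phi>" and x: "x + t *\<^sub>R w \<in> D"
  shows "velocity (\<lambda>t. (x + t *\<^sub>R w, \<phi> (x + t *\<^sub>R w))) t = (w, grad \<phi> (x + t *\<^sub>R w) \<bullet> w)"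
proof -
  have 1: "((\<lambda>t. x + t *\<^sub>R w) has_derivative (\<lambda>h. h *\<^sub>R w)) (at t)"
    by (auto intro!: derivative_eq_intros)
  have "((\<lambda>t. (x + t *\<^sub>R w, \<phi> (x + t *\<^sub>R w))) has_derivative (\<lambda>h. (h *\<^sub>R w, grad \<phi> (x + t *\<^sub>R w) \<bullet> (h *\<^sub>R w)))) (at t)"
    by (intro has_derivative_Pair 1 has_derivative_compose[OF 1 has_derivative_grad[OF smooth_on_differentiable[OF \<phi> x]]])
  then have "((\<lambda>t. (x + t *\<^sub>R w, \<phi> (x + t *\<^sub>R w))) has_vector_derivative (w, grad \<phi> (x + t *\<^sub>R w) \<bullet> w)) (at t)"
    by (simp add: has_vector_derivative_def)
  then show ?thesis unfolding velocity_def by (rule vector_derivative_at)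
qed

text \<open>Lifted straight lines realize every such vector. Conversely, differentiating
  \<open>snd (c t) = \<phi> (fst (c t))\<close> at \<open>0\<close> constrains the velocity of an
  arbitrary curve.\<close>

lemma tangent_space_graph_over:
  fixes \<phi> :: "'a::euclidean_space \<Rightarrow> real"
  assumes \<phi>: "smooth_on D \<phi>" and x: "x \<in> D"
  shows "tangent_space (graph_over D \<phi>) (x, \<phi> x) = {(w, grad \<phi> x \<bullet> w) |w. True}"
proof (intro equalityI subsetI)
  fix q assume "q \<in> {(w, grad \<phi> x \<bullet> w) |w. True}"
  then obtain w where "q = (w, grad \<phi> x \<bullet> w)" by auto
  then show "q \<in> tangent_space (graph_over D \<phi>) (x, \<phi> x)"
    unfolding tangent_space_def
    using curve_through_graph_over(1)[OF \<phi> x, of w] velocity_graph_line[OF \<phi>, of x 0 w] x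
    by (auto intro!: exI[of _ "\<lambda>t. (x + t *\<^sub>R w, \<phi> (x + t *\<^sub>R w))"])
next
  fix q assume "q \<in> tangent_space (graph_over D \<phi>) (x, \<phi> x)"
  then obtain c where c: "curve_through (graph_over D \<phi>) (x, \<phi> x) c" "q = velocity c 0"
    by (auto simp: tangent_space_def)
  then obtain e where e: "e > 0" "smooth_on {-e<..<e} c" "c ` {-e<..<e} \<subseteq> graph_over D \<phi>" "c 0 = (x, \<phi> x)"
    by (auto simp: curve_through_def)
  have "c differentiable (at 0)" using smooth_on_differentiable[OF e(2), of 0] e(1) by simp
  then have "(c has_vector_derivative q) (at 0)"
    unfolding c(2) velocity_def by (simp add: vector_derivative_works)
  then have d: "(c has_derivative (\<lambda>h. h *\<^sub>R q)) (at 0)" by (simp add: has_vector_derivative_def)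
  have f: "((\<lambda>t. fst (c t)) has_derivative (\<lambda>h. h *\<^sub>R fst q)) (at 0)"
    using has_derivative_fst[OF d] by simp
  have s: "((\<lambda>t. snd (c t)) has_derivative (\<lambda>h. h *\<^sub>R snd q)) (at 0)"
    using has_derivative_snd[OF d] by simp
  have g: "(\<phi> has_derivative (\<lambda>v. grad \<phi> x \<bullet> v)) (at (fst (c 0)))"
    using has_derivative_grad[OF smooth_on_differentiable[OF \<phi> x]] e(4) by simp
  have s': "((\<lambda>t. \<phi> (fst (c t))) has_derivative (\<lambda>h. grad \<phi> x \<bullet> (h *\<^sub>R fst q))) (at 0)"
    by (rule has_derivative_compose[OF f g])
  have on: "\<phi> (fst (c t)) = snd (c t)" if "t \<in> {-e<..<e}" for t
  proof -
    have "c t \<in> graph_over D \<phi>" using e(3) that by blast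
    then show ?thesis by (auto simp: graph_over_def)
  qed
  have "((\<lambda>t. snd (c t)) has_derivative (\<lambda>h. grad \<phi> x \<bullet> (h *\<^sub>R fst q))) (at 0)"
    by (rule has_derivative_transform_within_open[OF s', of "{-e<..<e}"]) (use e(1) on in auto)
  then have "(\<lambda>h. h *\<^sub>R snd q) = (\<lambda>h. grad \<phi> x \<bullet> (h *\<^sub>R fst q))"
    using s has_derivative_unique by blast
  from fun_cong[OF this, of 1] have "snd q = grad \<phi> x \<bullet> fst q" by simp
  then show "q \<in> {(w, grad \<phi> x \<bullet> w) |w. True}" by (metis (mono_tags, lifting) mem_Collect_eq prod.collapse)
qed

lemma tangent_hyperplane_graph_over:
  fixes \<phi> :: "'a::euclidean_space \<Rightarrow> real"
  assumes \<phi>: "smooth_on D \<phi>" and x: "x \<in> D"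
  shows "tangent_hyperplane (graph_over D \<phi>) (x, \<phi> x) = {(y, z). z = grad \<phi> x \<bullet> y + (\<phi> x - grad \<phi> x \<bullet> x)}"
proof -
  have "(y, z) \<in> (\<lambda>w. (x, \<phi> x) + w) ` {(w, grad \<phi> x \<bullet> w) |w. True} \<longleftrightarrow> z = grad \<phi> x \<bullet> y + (\<phi> x - grad \<phi> x \<bullet> x)" for y z
    by (auto simp: image_iff inner_diff_right algebra_simps intro!: exI[of _ "y - x"])
  then show ?thesis
    unfolding tangent_hyperplane_def tangent_space_graph_over[OF assms] by (auto simp: set_eq_iff)
qed

lemma unit_normal_graph_over:
  fixes \<phi> :: "'a::euclidean_space \<Rightarrow> real"
  assumes \<phi>: "smooth_on D \<phi>" and x: "x \<in> D" and N: "unit_normal (graph_over D \<phi>) (x, \<phi> x) N"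
  shows "fst N = - snd N *\<^sub>R grad \<phi> x" "snd N \<noteq> 0"
proof -
  have "fst N \<bullet> w + snd N * (grad \<phi> x \<bullet> w) = 0" for w
    using N unfolding unit_normal_def tangent_space_graph_over[OF \<phi> x]
    by (metis (mono_tags, lifting) inner_prod_def fst_conv snd_conv inner_real_def mem_Collect_eq)
  then have "(fst N + snd N *\<^sub>R grad \<phi> x) \<bullet> w = 0" for w
    by (simp add: inner_add_left)
  then have "fst N + snd N *\<^sub>R grad \<phi> x = 0" using inner_eq_zero_iff by blast
  then show 1: "fst N = - snd N *\<^sub>R grad \<phi> x" by (simp add: eq_neg_iff_add_eq_0)
  show "snd N \<noteq> 0"
  proof
    assume "snd N = 0"
    then have "N = 0" using 1 by (simp add: prod_eq_iff)
    then show False using N by (simp add: unit_normal_def)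
  qed
qed

text \<open>The lift of a straight line has vertical acceleration, whose length is the Hessian form
  in the direction of the line. The direction is rescaled by \<open>s\<close> because normal
  curvature asks for a unit velocity of the lift, not of its projection.\<close>

lemma positive_normal_curvatures_graph_over:
  fixes \<phi> :: "'a::euclidean_space \<Rightarrow> real"
  assumes \<phi>: "smooth_on D \<phi>" and x: "x \<in> D"
    and pos: "positive_normal_curvatures (graph_over D \<phi>) (x, \<phi> x) N"
    and w: "w \<noteq> 0"
  shows "0 < snd N * (w \<bullet> hess \<phi> x w)"
proof -
  define s where "s = 1 / norm (w, grad \<phi> x \<bullet> w)"
  define u where "u = s *\<^sub>R w"
  have nz: "norm (w, grad \<phi> x \<bullet> w) > 0" using w by (simp add: prod_eq_iff)
  then have s: "s > 0" by (simp add: s_def)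
  let ?c = "\<lambda>t. (x + t *\<^sub>R u, \<phi> (x + t *\<^sub>R u))"
  have v0: "velocity ?c 0 = (u, grad \<phi> x \<bullet> u)"
    using velocity_graph_line[OF \<phi>, of x 0 u] x by simp
  have "(u, grad \<phi> x \<bullet> u) = s *\<^sub>R (w, grad \<phi> x \<bullet> w)" by (simp add: u_def)
  then have "norm (velocity ?c 0) = s * norm (w, grad \<phi> x \<bullet> w)" unfolding v0 using s by (metis norm_scaleR abs_of_pos)
  then have n1: "norm (velocity ?c 0) = 1" using nz by (simp add: s_def)
  have ev: "\<forall>\<^sub>F t in nhds 0. x + t *\<^sub>R u \<in> D" by (rule curve_through_graph_over(2)[OF \<phi> x])
  then obtain V where V: "open V" "0 \<in> V" "\<And>t. t \<in> V \<Longrightarrow> x + t *\<^sub>R u \<in> D"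
    unfolding eventually_nhds by blast
  have 1: "((\<lambda>t. x + t *\<^sub>R u) has_derivative (\<lambda>h. h *\<^sub>R u)) (at 0)"
    by (auto intro!: derivative_eq_intros)
  have 2: "(grad \<phi> has_derivative hess \<phi> x) (at (x + 0 *\<^sub>R u))" using has_derivative_hess[OF \<phi> x] by simp
  interpret H: linear "hess \<phi> x" by (rule linear_hess[OF \<phi> x])
  have "((\<lambda>t. (u, grad \<phi> (x + t *\<^sub>R u) \<bullet> u)) has_derivative (\<lambda>h. (0, hess \<phi> x (h *\<^sub>R u) \<bullet> u))) (at 0)"
    by (intro has_derivative_Pair has_derivative_const has_derivative_inner_left has_derivative_compose[OF 1 2])
  then have "((\<lambda>t. velocity ?c t) has_derivative (\<lambda>h. (0, hess \<phi> x (h *\<^sub>R u) \<bullet> u))) (at 0)"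
    by (rule has_derivative_transform_within_open[OF _ V(1,2)]) (use velocity_graph_line[OF \<phi>] V in auto)
  then have "(velocity ?c has_vector_derivative (0, hess \<phi> x u \<bullet> u)) (at 0)"
    by (simp add: has_vector_derivative_def H.scaleR)
  then have vv: "velocity (velocity ?c) 0 = (0, hess \<phi> x u \<bullet> u)"
    unfolding velocity_def[of "velocity ?c"] by (rule vector_derivative_at)
  have "normal_curvature (graph_over D \<phi>) (x, \<phi> x) N (velocity ?c 0) (velocity (velocity ?c) 0 \<bullet> N)"
    unfolding normal_curvature_def using n1 curve_through_graph_over(1)[OF \<phi> x, of u] by blast
  then have "0 < velocity (velocity ?c) 0 \<bullet> N" using pos unfolding positive_normal_curvatures_def by blast
  then have "0 < (hess \<phi> x u \<bullet> u) * snd N" unfolding vv by (simp add: inner_prod_def)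
  then have "0 < s * (s * (snd N * (w \<bullet> hess \<phi> x w)))" by (simp add: u_def H.scaleR inner_commute mult_ac)
  then show ?thesis using s by (simp add: zero_less_mult_iff)
qed

text \<open>The slab is an intersection of two half-spaces, and each of its points lies on a
  vertical segment between the two hyperplanes. For \<open>\<tau> = 0\<close> there is no segment to
  divide, whence the case distinction.\<close>

lemma convex_hull_parallel_graphs:
  fixes l :: "'a::euclidean_space"
  assumes "0 \<le> \<tau>"
  shows "convex hull ({(y, z). z = l \<bullet> y + b + \<tau>} \<union> {(y, z). z = l \<bullet> y + b}) = {(y, z). l \<bullet> y + b \<le> z \<and> z \<le> l \<bullet> y + b + \<tau>}"
    (is "convex hull ?U = ?S")
proof (rule hull_unique)
  have "?S = {p. (l, -1) \<bullet> p \<le> -b} \<inter> {p. (- l, 1) \<bullet> p \<le> b + \<tau>}" by (auto simp: inner_prod_def)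
  then show "convex ?S" by (simp add: convex_Int convex_halfspace_le)
  show "?U \<subseteq> ?S" using assms by auto
  fix T assume T: "?U \<subseteq> T" "convex T"
  show "?S \<subseteq> T"
  proof (cases "\<tau> = 0")
    case True then show ?thesis using T by auto
  next
    case False
    then have tp: "\<tau> > 0" using assms by simp
    show ?thesis
    proof (clarify)
      fix y z assume yz: "l \<bullet> y + b \<le> z" "z \<le> l \<bullet> y + b + \<tau>"
      define \<theta> where "\<theta> = (z - (l \<bullet> y + b)) / \<tau>"
      have th: "0 \<le> \<theta>" "\<theta> \<le> 1" using yz tp by (auto simp: \<theta>_def field_simps)
      have "(1 - \<theta>) *\<^sub>R (y, l \<bullet> y + b) + \<theta> *\<^sub>R (y, l \<bullet> y + b + \<tau>) \<in> T"
        using T th by (intro convexD) auto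
      moreover have "(1 - \<theta>) *\<^sub>R (y, l \<bullet> y + b) + \<theta> *\<^sub>R (y, l \<bullet> y + b + \<tau>) = (y, l \<bullet> y + b + \<theta> * \<tau>)"
        by (simp add: algebra_simps)
      moreover have "\<theta> * \<tau> = z - (l \<bullet> y + b)" using tp by (simp add: \<theta>_def)
      ultimately show "(y, z) \<in> T" by simp
    qed
  qed
qed

section \<open>Change of variables over arbitrary finite index types\<close>

text \<open>The library proves the change of variables formula for \<open>real^'n\<close> only when the index type is
  well-ordered. Every finite index type is in bijection with such a type.\<close>

typedef (overloaded) ('n::finite) ordered_index = "{..<CARD('n)}"
  by (rule exI[of _ 0]) simp

instantiation ordered_index :: (finite) "{finite, wellorder}"
begin

definition "less_eq_ordered_index (a :: 'a ordered_index) (b :: 'a ordered_index) \<longleftrightarrow> Rep_ordered_index a \<le> Rep_ordered_index b"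
definition "less_ordered_index (a :: 'a ordered_index) (b :: 'a ordered_index) \<longleftrightarrow> Rep_ordered_index a < Rep_ordered_index b"

instance
proof
  have "range (Rep_ordered_index :: 'a ordered_index \<Rightarrow> nat) \<subseteq> {..<CARD('a)}"
    using Rep_ordered_index by blast
  then show "finite (UNIV :: 'a ordered_index set)"
    using finite_imageD[of Rep_ordered_index "UNIV :: 'a ordered_index set"] finite_subset
    by (metis Rep_ordered_index_inject finite_lessThan injI)
  fix P :: "'a ordered_index \<Rightarrow> bool" and a
  assume *: "\<And>x. (\<And>y. y < x \<Longrightarrow> P y) \<Longrightarrow> P x"
  show "P a"
    by (rule measure_induct_rule[of Rep_ordered_index P a], rule *) (simp add: less_ordered_index_def)
qed (auto simp: less_eq_ordered_index_def less_ordered_index_def Rep_ordered_index_inject)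

end

lemma card_ordered_index: "CARD('n::finite ordered_index) = CARD('n)"
  using type_definition.card[OF type_definition_ordered_index] by simp

definition reindex :: "('m \<Rightarrow> 'n) \<Rightarrow> real^'n \<Rightarrow> real^'m" where
  "reindex \<sigma> x = (\<chi> i. x $ \<sigma> i)"

lemma linear_reindex: "linear (reindex \<sigma>)"
  by (rule linearI) (simp_all add: reindex_def vec_eq_iff)

lemma reindex_inverse:
  assumes "bij \<sigma>"
  shows "reindex (inv \<sigma>) (reindex \<sigma> x) = x" "reindex \<sigma> (reindex (inv \<sigma>) y) = y"
  using assms by (simp_all add: reindex_def vec_eq_iff bij_is_inj bij_is_surj surj_f_inv_f)

text \<open>The measure is determined by its values on boxes, and relabelling the coordinates turns
  a box into a box with the same side lengths.\<close>

lemma lborel_reindex: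
  fixes \<sigma> :: "'m::finite \<Rightarrow> 'n::finite"
  assumes "bij \<sigma>"
  shows "distr lborel lborel (reindex \<sigma>) = lborel"
proof (rule lborel_eqI[symmetric])
  have cont: "continuous_on UNIV (reindex \<sigma>)"
    by (intro linear_continuous_on) (simp add: linear_conv_bounded_linear[symmetric] linear_reindex)
  have meas: "reindex \<sigma> \<in> borel_measurable lborel"
    using borel_measurable_continuous_onI[OF cont] by simp
  show "sets (distr lborel lborel (reindex \<sigma>)) = sets borel" by simp
  fix l u :: "real^'m" assume lu: "\<And>b. b \<in> Basis \<Longrightarrow> l \<bullet> b \<le> u \<bullet> b"
  let ?Q = "reindex (inv \<sigma>)"
  have pb: "(\<Prod>b\<in>Basis. (u - l) \<bullet> b) = (\<Prod>i\<in>UNIV. u $ i - l $ i)" for u l :: "real^'k"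
    by (simp add: Basis_vec_def cart_eq_inner_axis axis_eq_axis prod.UNION_disjoint inner_diff_left)
  have vim: "reindex \<sigma> -` box l u = box (?Q l) (?Q u)"
  proof -
    have "(\<forall>i. l $ i < x $ \<sigma> i \<and> x $ \<sigma> i < u $ i) \<longleftrightarrow> (\<forall>j. l $ inv \<sigma> j < x $ j \<and> x $ j < u $ inv \<sigma> j)" for x
      using assms by (metis bij_inv_eq_iff)
    then show ?thesis by (auto simp: mem_box_cart reindex_def)
  qed
  have le: "?Q l \<bullet> b \<le> ?Q u \<bullet> b" if b: "b \<in> Basis" for b
  proof -
    obtain j where "b = axis j 1" using b by (auto simp: Basis_vec_def)
    then show ?thesis using lu[of "axis (inv \<sigma> j) 1"] by (simp add: cart_eq_inner_axis[symmetric] reindex_def axis_in_Basis_iff)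
  qed
  have "emeasure (distr lborel lborel (reindex \<sigma>)) (box l u) = emeasure lborel (box (?Q l) (?Q u))"
    using meas by (subst emeasure_distr) (auto simp: vim)
  also have "\<dots> = (\<Prod>b\<in>Basis. (?Q u - ?Q l) \<bullet> b)" using emeasure_lborel_box[OF le] by simp
  also have "(\<Prod>b\<in>Basis. (?Q u - ?Q l) \<bullet> b) = (\<Prod>j\<in>UNIV. u $ inv \<sigma> j - l $ inv \<sigma> j)"
    unfolding pb by (simp add: reindex_def)
  also have "\<dots> = (\<Prod>i\<in>UNIV. u $ i - l $ i)"
    by (rule prod.reindex_bij_betw[OF bij_imp_bij_inv[OF assms]])
  finally show "emeasure (distr lborel lborel (reindex \<sigma>)) (box l u) = (\<Prod>b\<in>Basis. (u - l) \<bullet> b)"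
    unfolding pb .
qed

lemma lebesgue_reindex:
  fixes \<sigma> :: "'m::finite \<Rightarrow> 'n::finite"
  assumes "bij \<sigma>"
  shows "reindex \<sigma> \<in> lebesgue \<rightarrow>\<^sub>M lebesgue" "distr lebesgue lebesgue (reindex \<sigma>) = lebesgue"
proof -
  have cont: "continuous_on UNIV (reindex \<sigma>)"
    by (intro linear_continuous_on) (simp add: linear_conv_bounded_linear[symmetric] linear_reindex)
  have m: "reindex \<sigma> \<in> lborel \<rightarrow>\<^sub>M lborel"
    using borel_measurable_continuous_onI[OF cont] by simp
  then have m': "reindex \<sigma> \<in> lebesgue \<rightarrow>\<^sub>M lborel" by (rule measurable_completion)
  have d: "distr lebesgue lborel (reindex \<sigma>) = lborel"
    using lborel_reindex[OF assms] distr_completion[OF m] by simp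
  have cm: "complete_measure (lebesgue :: (real^'n) measure)" ..
  show "reindex \<sigma> \<in> lebesgue \<rightarrow>\<^sub>M lebesgue"
    by (rule complete_measure.measurable_completion2[OF cm m']) (simp add: d)
  show "distr lebesgue lebesgue (reindex \<sigma>) = lebesgue"
    using complete_measure.completion_distr_eq[OF cm m'] by (simp add: d)
qed

lemma absolutely_integrable_reindex:
  fixes \<sigma> :: "'m::finite \<Rightarrow> 'n::finite" and F :: "real^'m \<Rightarrow> real"
  assumes "bij \<sigma>" and F: "F absolutely_integrable_on A"
  shows "(\<lambda>x. F (reindex \<sigma> x)) absolutely_integrable_on reindex \<sigma> -` A"
    and "integral (reindex \<sigma> -` A) (\<lambda>x. F (reindex \<sigma> x)) = integral A F"
proof -
  let ?P = "reindex \<sigma> :: real^'n \<Rightarrow> real^'m"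
  have i: "integrable lebesgue (\<lambda>x. indicator A x *\<^sub>R F x)"
    using F unfolding set_integrable_def .
  then have i': "integrable (distr lebesgue lebesgue ?P) (\<lambda>x. indicator A x *\<^sub>R F x)"
    unfolding lebesgue_reindex(2)[OF assms(1)] .
  have ind: "indicator A (?P x) = (indicator (?P -` A) x :: real)" for x by (auto simp: indicator_def)
  show a: "(\<lambda>x. F (?P x)) absolutely_integrable_on ?P -` A"
    unfolding set_integrable_def
    using integrable_distr[OF lebesgue_reindex(1)[OF assms(1)] i'] by (simp add: ind)
  have "integral\<^sup>L (distr lebesgue lebesgue ?P) (\<lambda>x. indicator A x *\<^sub>R F x)
    = integral\<^sup>L lebesgue (\<lambda>x. indicator A (?P x) *\<^sub>R F (?P x))"
    by (rule integral_distr[OF lebesgue_reindex(1)[OF assms(1)]]) (use i in auto)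
  then have "set_lebesgue_integral lebesgue A F = set_lebesgue_integral lebesgue (?P -` A) (\<lambda>x. F (?P x))"
    unfolding set_lebesgue_integral_def lebesgue_reindex(2)[OF assms(1)] ind by simp
  then show "integral (?P -` A) (\<lambda>x. F (?P x)) = integral A F"
    using set_lebesgue_integral_eq_integral(2)[OF a] set_lebesgue_integral_eq_integral(2)[OF F] by simp
qed

text \<open>Conjugation with \<open>\<sigma>\<close> is a bijection between the permutations of the
  two index types that preserves signs.\<close>

lemma det_reindex:
  fixes A :: "real^'n::finite^'n" and \<sigma> :: "'m::finite \<Rightarrow> 'n"
  assumes \<sigma>: "bij \<sigma>"
  shows "det (\<chi> i j. A $ \<sigma> i $ \<sigma> j) = det A"
proof -
  let ?f = "map_permutation UNIV \<sigma>"
  let ?g = "map_permutation UNIV (inv \<sigma>)"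
  have inj: "inj \<sigma>" "inj (inv \<sigma>)" using \<sigma> by (auto simp: bij_is_inj bij_imp_bij_inv)
  have f: "?f p permutes UNIV" if "p permutes UNIV" for p
    using map_permutation_permutes[OF _ that, of \<sigma> UNIV] \<sigma> by simp
  have g: "?g p permutes UNIV" if "p permutes UNIV" for p
    using map_permutation_permutes[OF _ that, of "inv \<sigma>" UNIV] \<sigma> by (simp add: bij_imp_bij_inv)
  have fa: "?f p (\<sigma> i) = \<sigma> (p i)" for p i
    using \<sigma> by (simp add: map_permutation_apply bij_is_inj)
  have "det A = (\<Sum>p | p permutes UNIV. of_int (sign p) * (\<Prod>i\<in>UNIV. A $ i $ p i))"
    by (simp add: det_def)
  also have "\<dots> = (\<Sum>p | p permutes (UNIV :: 'm set). of_int (sign p) * (\<Prod>i\<in>UNIV. A $ \<sigma> i $ \<sigma> (p i)))"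
  proof (rule sum.reindex_bij_witness[of _ ?f ?g])
    fix p :: "'n \<Rightarrow> 'n" assume "p \<in> {p. p permutes UNIV}"
    then have p: "p permutes UNIV" by simp
    show e: "?f (?g p) = p"
      using map_permutation_compose_inv[OF _ p, of "inv \<sigma>" UNIV \<sigma>] \<sigma>
      by (simp add: bij_imp_bij_inv bij_is_surj surj_f_inv_f)
    show "?g p \<in> {p. p permutes UNIV}" using g[OF p] by simp
    have "(\<Prod>i\<in>UNIV. A $ i $ p i) = (\<Prod>i\<in>UNIV. A $ \<sigma> i $ p (\<sigma> i))"
      using prod.reindex_bij_betw[OF \<sigma>, of "\<lambda>i. A $ i $ p i"] by simp
    moreover have "p (\<sigma> i) = \<sigma> (?g p i)" for i using fa[of "?g p" i] e by simp
    moreover have "sign (?g p) = sign p" using sign_map_permutation[OF inj(2) p] by simp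
    ultimately show "of_int (sign (?g p)) * (\<Prod>i\<in>UNIV. A $ \<sigma> i $ \<sigma> (?g p i)) = of_int (sign p) * (\<Prod>i\<in>UNIV. A $ i $ p i)"
      by simp
  next
    fix p :: "'m \<Rightarrow> 'm" assume "p \<in> {p. p permutes UNIV}"
    then have p: "p permutes UNIV" by simp
    show "?g (?f p) = p"
      using map_permutation_compose_inv[OF _ p, of \<sigma> UNIV "inv \<sigma>"] \<sigma> by (simp add: bij_is_inj)
    show "?f p \<in> {p. p permutes UNIV}" using f[OF p] by simp
  qed
  also have "\<dots> = det (\<chi> i j. A $ \<sigma> i $ \<sigma> j)" by (simp add: det_def)
  finally show ?thesis ..
qed

lemma change_of_variables_wellorder:
  fixes f :: "real^'m::{finite,wellorder} \<Rightarrow> real" and g :: "real^'m::_ \<Rightarrow> real^'m::_"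
  assumes "S \<in> sets lebesgue" "\<And>x. x \<in> S \<Longrightarrow> (g has_derivative g' x) (at x within S)"
    and "inj_on g S" and f: "f absolutely_integrable_on g ` S"
  shows "(\<lambda>x. \<bar>det (matrix (g' x))\<bar> * f (g x)) absolutely_integrable_on S"
    "integral S (\<lambda>x. \<bar>det (matrix (g' x))\<bar> * f (g x)) = integral (g ` S) f"
proof -
  have v: "(\<lambda>x. \<bar>det (matrix (g' x))\<bar> *\<^sub>R (vec (f (g x)) :: real^1)) = (\<lambda>x. vec (\<bar>det (matrix (g' x))\<bar> * f (g x)))"
    by (rule ext) (simp add: vec_eq_iff)
  have v1: "(\<lambda>x. vec (f x) :: real^1) absolutely_integrable_on g ` S \<and>
      integral (g ` S) (\<lambda>x. vec (f x) :: real^1) = vec (integral (g ` S) f)"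
    using f by (simp add: absolutely_integrable_on_1_iff integral_on_1_eq)
  have "(\<lambda>x. vec (\<bar>det (matrix (g' x))\<bar> * f (g x)) :: real^1) absolutely_integrable_on S \<and>
     integral S (\<lambda>x. vec (\<bar>det (matrix (g' x))\<bar> * f (g x)) :: real^1) = vec (integral (g ` S) f)"
    using has_absolute_integral_change_of_variables[OF assms(1-3), of "\<lambda>x. vec (f x) :: real^1"] v1 unfolding v by blast
  then show "(\<lambda>x. \<bar>det (matrix (g' x))\<bar> * f (g x)) absolutely_integrable_on S"
    "integral S (\<lambda>x. \<bar>det (matrix (g' x))\<bar> * f (g x)) = integral (g ` S) f"
    by (simp_all add: absolutely_integrable_on_1_iff integral_on_1_eq vec_eq_iff)
qed

text \<open>Conjugating \<open>g\<close> with the relabelling of coordinates moves the formula to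
  the ordered index type; the Jacobian determinant and both integrals are unchanged by this.\<close>

theorem change_of_variables:
  fixes f :: "real^'n::finite \<Rightarrow> real" and g :: "real^'n \<Rightarrow> real^'n"
  assumes S: "S \<in> sets lebesgue" and g: "\<And>x. x \<in> S \<Longrightarrow> (g has_derivative g' x) (at x within S)"
    and inj: "inj_on g S" and f: "f absolutely_integrable_on g ` S"
  shows "integral S (\<lambda>x. \<bar>det (matrix (g' x))\<bar> * f (g x)) = integral (g ` S) f"
proof -
  obtain \<sigma> :: "'n ordered_index \<Rightarrow> 'n" where \<sigma>: "bij \<sigma>"
    using finite_same_card_bij[of "UNIV :: 'n ordered_index set" "UNIV :: 'n set"] card_ordered_index
    by (metis finite)
  let ?P = "reindex \<sigma>" and ?Q = "reindex (inv \<sigma>)"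
  have \<sigma>': "bij (inv \<sigma>)" using \<sigma> by (rule bij_imp_bij_inv)
  note PQ = reindex_inverse[OF \<sigma>]
  have PV: "?P ` A = ?Q -` A" for A using PQ by (auto simp: image_iff) (metis)
  define G where "G = (\<lambda>y. ?P (g (?Q y)))"
  define G' where "G' = (\<lambda>y v. ?P (g' (?Q y) (?Q v)))"
  have hdl: "(reindex s has_derivative reindex s) F" for s :: "'b::finite \<Rightarrow> 'c::finite" and F
    using linear_reindex[of s] by (simp add: linear_conv_bounded_linear bounded_linear_imp_has_derivative)
  have "?Q -` S \<in> sets lebesgue"
    using measurable_sets[OF lebesgue_reindex(1)[OF \<sigma>'] S] by simp
  then have S': "?P ` S \<in> sets lebesgue" by (simp add: PV)
  have G: "(G has_derivative G' y) (at y within ?P ` S)" if "y \<in> ?P ` S" for y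
  proof -
    have yS: "?Q y \<in> S" using that PQ by auto
    have "((\<lambda>y. g (?Q y)) has_derivative (\<lambda>v. g' (?Q y) (?Q v))) (at y within ?P ` S)"
    proof (rule has_derivative_in_compose2[where g = g and g' = g' and t = S])
      show "?Q ` ?P ` S \<subseteq> S" using PQ by auto
    qed (use g that hdl in auto)
    from has_derivative_compose[OF this hdl] show ?thesis unfolding G_def G'_def .
  qed
  have injG: "inj_on G (?P ` S)"
    using inj PQ unfolding G_def inj_on_def by (auto) (metis)
  have im: "G ` ?P ` S = ?P ` g ` S" unfolding G_def using PQ by (auto simp: image_iff)
  have f': "(\<lambda>y. f (?Q y)) absolutely_integrable_on ?P ` g ` S"
    using absolutely_integrable_reindex(1)[OF \<sigma>' f] by (simp add: PV)
  have f'': "(\<lambda>y. f (?Q y)) absolutely_integrable_on G ` ?P ` S" using f' im by simp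
  have det: "det (matrix (G' y)) = det (matrix (g' (?Q y)))" if "y \<in> ?P ` S" for y
  proof -
    have ax: "?Q (axis j 1) = axis (\<sigma> j) 1" for j
    proof -
      have "inv \<sigma> i = j \<longleftrightarrow> i = \<sigma> j" for i using bij_inv_eq_iff[OF \<sigma>] by metis
      then show ?thesis by (simp add: reindex_def vec_eq_iff axis_def)
    qed
    have "matrix (G' y) = (\<chi> i j. matrix (g' (?Q y)) $ \<sigma> i $ \<sigma> j)"
      by (simp add: matrix_def G'_def vec_eq_iff ax) (simp add: reindex_def)
    then show ?thesis using det_reindex[OF \<sigma>] by simp
  qed
  have "integral (?P ` S) (\<lambda>y. \<bar>det (matrix (g' (?Q y)))\<bar> * f (?Q (G y))) = integral (G ` ?P ` S) (\<lambda>y. f (?Q y))"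
    and a: "(\<lambda>y. \<bar>det (matrix (g' (?Q y)))\<bar> * f (?Q (G y))) absolutely_integrable_on ?P ` S"
    using change_of_variables_wellorder[OF S' G injG f''] det
    by (simp_all cong: integral_cong set_integrable_cong)
  moreover have "integral (G ` ?P ` S) (\<lambda>y. f (?Q y)) = integral (g ` S) f"
    unfolding im using absolutely_integrable_reindex(2)[OF \<sigma>' f] by (simp add: PV)
  moreover have "integral (?P ` S) (\<lambda>y. \<bar>det (matrix (g' (?Q y)))\<bar> * f (?Q (G y))) = integral S (\<lambda>x. \<bar>det (matrix (g' x))\<bar> * f (g x))"
  proof -
    have "?P -` (?P ` S) = S" using PQ by (auto) (metis)
    then show ?thesis using absolutely_integrable_reindex(2)[OF \<sigma> a] by (simp add: PQ G_def)
  qed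
  ultimately show ?thesis by simp
qed

text \<open>This is the matrix determinant lemma, obtained by switching the rank one term on row by
  row.\<close>

lemma det_identity_plus_rank_one:
  fixes u v :: "real^'n::finite"
  shows "det (\<chi> i j. (if i = j then 1 else 0) + u $ i * v $ j) = 1 + u \<bullet> v"
proof -
  let ?e = "\<lambda>k. axis k (1::real) :: real^'n"
  \<comment> \<open>Row \<open>i\<close> is \<open>v\<close>, so multiples of it can be subtracted
    from the rows in \<open>K\<close>. What remains is the identity with one row replaced by
    \<open>v\<close>.\<close>
  have a: "det (\<chi> k. if k = i then v else if k \<in> K then ?e k + u $ k *s v else ?e k) = v $ i"
    if "finite K" "i \<notin> K" for K i
    using that
  proof (induction K rule: finite_induct)
    case empty
    have v: "v = (\<Sum>j\<in>UNIV. v $ j *s row j (mat 1 :: real^'n^'n))"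
      by (simp add: vec_eq_iff row_def mat_def if_distrib cong: if_cong)
    have e: "?e k = row k (mat 1)" for k by (simp add: vec_eq_iff row_def mat_def axis_def)
    have "(\<chi> k. if k = i then v else if k \<in> {} then ?e k + u $ k *s v else ?e k)
      = (\<chi> k. if k = i then \<Sum>j\<in>UNIV. v $ j *s row j (mat 1) else row k (mat 1))"
      unfolding e by (simp only: v[symmetric] empty_iff if_False)
    then show ?case using cramer_lemma_transpose[of i v "mat 1 :: real^'n^'n"] by simp
  next
    case (insert l K)
    let ?A = "(\<chi> k. if k = i then v else if k \<in> K then ?e k + u $ k *s v else ?e k) :: real^'n^'n"
    have "(\<chi> k. if k = i then v else if k \<in> insert l K then ?e k + u $ k *s v else ?e k)
      = (\<chi> k. if k = l then row l ?A + u $ l *s row i ?A else row k ?A)"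
      using insert by (auto simp: vec_eq_iff row_def)
    then show ?case using det_row_operation[of l i ?A "u $ l"] insert by auto
  qed
  \<comment> \<open>Row \<open>l\<close> is expanded by linearity: one summand removes
    \<open>l\<close> from the modified rows, the other is computed by \<open>a\<close>.\<close>
  have b: "det (\<chi> k. if k \<in> K then ?e k + u $ k *s v else ?e k) = 1 + (\<Sum>k\<in>K. u $ k * v $ k)"
    if "finite K" for K
    using that
  proof (induction K rule: finite_induct)
    case empty
    have "(\<chi> k. ?e k) = (mat 1 :: real^'n^'n)" by (auto simp: vec_eq_iff mat_def axis_def)
    then show ?case by simp
  next
    case (insert l K)
    let ?c = "\<lambda>k. if k \<in> K then ?e k + u $ k *s v else ?e k"
    have 1: "(\<chi> k. if k \<in> insert l K then ?e k + u $ k *s v else ?e k) = (\<chi> k. if k = l then ?e l + u $ l *s v else ?c k)"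
      by (auto simp: vec_eq_iff)
    have 2: "det (\<chi> k. if k = l then ?e l + u $ l *s v else ?c k)
        = det (\<chi> k. if k = l then ?e l else ?c k) + det (\<chi> k. if k = l then u $ l *s v else ?c k)"
      by (rule det_row_add[of l "\<lambda>_. ?e l" "\<lambda>_. u $ l *s v" ?c])
    have 3: "det (\<chi> k. if k = l then u $ l *s v else ?c k) = u $ l * det (\<chi> k. if k = l then v else ?c k)"
      by (rule det_row_mul[of l "u $ l" "\<lambda>_. v" ?c])
    have 4: "det (\<chi> k. if k = l then v else ?c k) = v $ l" by (rule a) (use insert in auto)
    have 5: "(\<chi> k. if k = l then ?e l else ?c k) = (\<chi> k. ?c k)" using insert by (auto simp: vec_eq_iff)
    show ?case unfolding 1 2 3 4 5 insert.IH using insert by simp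
  qed
  have "(\<chi> i j. (if i = j then 1 else 0) + u $ i * v $ j) = (\<chi> k. if k \<in> UNIV then ?e k + u $ k *s v else ?e k)"
    by (simp add: vec_eq_iff axis_def eq_commute)
  then show ?thesis using b[of UNIV] by (simp add: inner_vec_def)
qed

lemma det_matrix_rank_one: "det (matrix (\<lambda>x. x + (v \<bullet> x) *\<^sub>R u)) = 1 + u \<bullet> (v :: real^'n::finite)"
proof -
  have "matrix (\<lambda>x. x + (v \<bullet> x) *\<^sub>R u) = (\<chi> i j. (if i = j then 1 else 0) + u $ i * v $ j)"
    by (simp add: matrix_def vec_eq_iff inner_axis) (simp add: axis_def)
  then show ?thesis using det_identity_plus_rank_one[of u v] by simp
qed

lemma absolutely_integrable_continuous_compact:
  fixes f :: "'a::euclidean_space \<Rightarrow> real"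
  assumes "compact S" "continuous_on S f"
  shows "f absolutely_integrable_on S"
proof -
  have i: "integrable lborel (\<lambda>x. indicator S x *\<^sub>R f x)"
    using borel_integrable_compact[OF assms] .
  show ?thesis
    unfolding set_integrable_def using integrable_completion[OF borel_measurable_integrable[OF i]] i by simp
qed

section \<open>Area of pieces of graphs\<close>

lemma continuous_on_smooth: "smooth_on D F \<Longrightarrow> continuous_on D F"
  by (intro continuous_at_imp_continuous_on ballI differentiable_imp_continuous_within smooth_on_differentiable)

lemma continuous_on_grad:
  fixes F :: "'a::euclidean_space \<Rightarrow> real"
  assumes "smooth_on D F"
  shows "continuous_on D (grad F)"
  by (intro continuous_at_imp_continuous_on ballI) (rule has_derivative_continuous, rule has_derivative_hess[OF assms])

text \<open>Near a point of \<open>U\<close> where the \<open>i\<close>-th partial derivative of \<open>F\<close> does not vanish, replacing the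
  \<open>i\<close>-th coordinate by \<open>F\<close> is injective and maps the zeros of \<open>F\<close> into a hyperplane.\<close>

lemma negligible_zeros_nonzero_derivative:
  fixes F :: "real^'n \<Rightarrow> real"
  assumes der: "\<And>u. u \<in> U \<Longrightarrow> (F has_derivative F' u) (at u)" and zero: "\<And>u. u \<in> U \<Longrightarrow> F u = 0"
  shows "negligible {u \<in> U. F' u \<noteq> (\<lambda>_. 0)}"
proof -
  define Z where "Z i = {u \<in> U. F' u (axis i 1) \<noteq> 0}" for i
  have "negligible (Z i)" for i
  proof -
    let ?T = "\<lambda>u. u + (F u - u $ i) *\<^sub>R axis i 1"
    let ?T' = "\<lambda>u v. v + (F' u v - v $ i) *\<^sub>R axis i 1"
    have "negligible {u \<in> Z i. ?T u \<in> {y. axis i (1::real) \<bullet> y = 0}}"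
    proof (rule negligible_differentiable_vimage)
      show "negligible {y. axis i (1::real) \<bullet> y = 0}" by (rule negligible_hyperplane) (simp add: axis_eq_0_iff)
      fix u assume u: "u \<in> Z i"
      then have d: "(F has_derivative F' u) (at u)" using der by (simp add: Z_def)
      have bl: "bounded_linear (\<lambda>v :: real^'n. v $ i)" by (rule bounded_linear_vec_nth)
      show "(?T has_derivative ?T' u) (at u within Z i)"
        by (intro has_derivative_add has_derivative_ident has_derivative_scaleR_left has_derivative_diff
          has_derivative_at_withinI[OF d] bounded_linear_imp_has_derivative[OF bl])
      interpret linear "F' u" using d has_derivative_linear by blast
      have "v = 0" if v: "?T' u v = 0" for v
      proof -
        have "v = - ((F' u v - v $ i) *\<^sub>R axis i 1)" using v unfolding eq_neg_iff_add_eq_0 .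
        then obtain c where c: "v = c *\<^sub>R axis i 1" unfolding scaleR_minus_left[symmetric] by blast
        have "?T' u v $ i = F' u v" by simp
        then have "F' u v = 0" using v by simp
        then have "c * F' u (axis i 1) = 0" by (simp add: c scaleR)
        then show "v = 0" using u c by (simp add: Z_def)
      qed
      moreover have "linear (?T' u)"
        by (rule linearI) (simp_all add: add scale algebra_simps)
      ultimately show "inj (?T' u)" using linear_injective_0 by blast
    qed
    moreover have "{u \<in> Z i. ?T u \<in> {y. axis i (1::real) \<bullet> y = 0}} = Z i"
      by (auto simp: Z_def zero inner_axis' )
    ultimately show ?thesis by simp
  qed
  then have "negligible (\<Union>i. Z i)" by (intro negligible_Union) auto
  moreover have "{u \<in> U. F' u \<noteq> (\<lambda>_. 0)} \<subseteq> (\<Union>i. Z i)"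
  proof
    fix u assume u: "u \<in> {u \<in> U. F' u \<noteq> (\<lambda>_. 0)}"
    then have l: "linear (F' u)" using der has_derivative_linear by blast
    have "\<exists>i. F' u (axis i 1) \<noteq> 0"
    proof (rule ccontr)
      assume "\<not> ?thesis"
      then have "F' u b = 0" if "b \<in> Basis" for b using that by (auto simp: Basis_vec_def)
      then have "F' u = (\<lambda>_. 0)" using linear_eq_stdbasis[OF l linear_zero] by blast
      then show False using u by simp
    qed
    then show "u \<in> (\<Union>i. Z i)" using u by (auto simp: Z_def)
  qed
  ultimately show ?thesis by (rule negligible_subset)
qed

text \<open>The first fundamental form of a graph in the parametrization with base derivative
  \<open>a\<close> factors as \<open>A^T (I + g g^T) A\<close>, where \<open>A\<close> is the matrix
  of \<open>a\<close> and \<open>g\<close> the gradient of the height.\<close>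

lemma det_gram_of_graph:
  fixes a :: "real^'n \<Rightarrow> real^'n" and g :: "real^'n"
  assumes "linear a"
  shows "det (\<chi> i j. a (axis i 1) \<bullet> a (axis j 1) + (g \<bullet> a (axis i 1)) * (g \<bullet> a (axis j 1)))
    = (det (matrix a))\<^sup>2 * (1 + (norm g)\<^sup>2)"
proof -
  let ?A = "matrix a" 
  let ?B = "matrix (\<lambda>x. x + (g \<bullet> x) *\<^sub>R g)"
  have A: "?A *v axis i 1 = a (axis i 1)" for i using assms by simp
  have B: "?B *v x = x + (g \<bullet> x) *\<^sub>R g" for x
  proof -
    have "linear (\<lambda>x. x + (g \<bullet> x) *\<^sub>R g)" by (rule linearI) (simp_all add: algebra_simps)
    then show ?thesis by simp
  qed
  have "(\<chi> i j. a (axis i 1) \<bullet> a (axis j 1) + (g \<bullet> a (axis i 1)) * (g \<bullet> a (axis j 1))) = transpose ?A ** ?B ** ?A"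
    (is "?G = _")
  proof -
    have "(transpose ?A ** ?B ** ?A) $ i $ j = ?G $ i $ j" for i j
    proof -
      have "(transpose ?A ** ?B ** ?A) $ i $ j = axis i 1 \<bullet> ((transpose ?A ** ?B ** ?A) *v axis j 1)"
        by (simp add: inner_axis' matrix_vector_mul_component) (simp add: inner_axis)
      also have "\<dots> = (?A *v axis i 1) \<bullet> (?B *v (?A *v axis j 1))"
        unfolding matrix_vector_mul_assoc[symmetric] vector_transpose_matrix[of "axis i 1" ?A, symmetric] dot_lmul_matrix ..
      also have "\<dots> = ?G $ i $ j" unfolding A B by (simp add: inner_add_right inner_commute)
      finally show ?thesis .
    qed
    then show ?thesis by (simp add: vec_eq_iff)
  qed
  then show ?thesis
    unfolding power2_norm_eq_inner by (simp add: det_mul det_transpose det_matrix_rank_one power2_eq_square)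
qed

text \<open>As the area is a definite description, every admissible parametrization must be shown to
  give the same value. Its projection \<open>\<xi>\<close> to the base is an injective change of
  variables onto \<open>R\<close>, under which the Gram determinant becomes the squared Jacobian
  times the squared slope factor.\<close>

lemma surface_area_graph:
  fixes \<phi> :: "real^'n \<Rightarrow> real"
  assumes \<phi>: "smooth_on D \<phi>" and RD: "R \<subseteq> D" and R: "compact R"
  shows "surface_area ((\<lambda>x. (x, \<phi> x)) ` R) = integral R (\<lambda>x. sqrt (1 + (norm (grad \<phi> x))\<^sup>2))"
proof -
  let ?w = "\<lambda>x. sqrt (1 + (norm (grad \<phi> x))\<^sup>2)"
  have D: "open D" using \<phi> by (simp add: smooth_on_def)
  have cont: "continuous_on R ?w"
    by (intro continuous_intros continuous_on_subset[OF continuous_on_grad[OF \<phi>] RD])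
  have abs_int: "?w absolutely_integrable_on R" by (rule absolutely_integrable_continuous_compact[OF R cont])
  let ?P = "\<lambda>s. \<exists>X U. parametrizes X U ((\<lambda>x. (x, \<phi> x)) ` R) \<and> s = integral U (\<lambda>u. sqrt (gram_det X u))"
  have ex: "?P (integral R ?w)"
  proof -
    let ?X = "\<lambda>x. (x, \<phi> x)"
    have hd: "(?X has_derivative (\<lambda>v. (v, grad \<phi> x \<bullet> v))) (at x)" if "x \<in> D" for x
      using has_derivative_grad[OF smooth_on_differentiable[OF \<phi> that]]
      by (intro has_derivative_Pair has_derivative_ident)
    have fd: "frechet_derivative ?X (at x) = (\<lambda>v. (v, grad \<phi> x \<bullet> v))" if "x \<in> D" for x
      using frechet_derivative_at[OF hd[OF that]] by simp
    have sX: "smooth_on D ?X"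
      using smooth_on_Pair[OF smooth_on_affine[OF bounded_linear_ident D, of 0] \<phi>] by simp
    have "parametrizes ?X R (?X ` R)"
      unfolding parametrizes_def
      using R RD sX fd by (auto simp: lmeasurable_compact fmeasurableD inj_on_def intro!: exI[of _ D])
    moreover have "integral R ?w = integral R (\<lambda>u. sqrt (gram_det ?X u))"
    proof (rule integral_cong)
      fix x assume "x \<in> R"
      then have "frechet_derivative ?X (at x) = (\<lambda>v. (v, grad \<phi> x \<bullet> v))" using fd RD by blast
      then have "gram_det ?X x = det (\<chi> i j. id (axis i (1::real)) \<bullet> id (axis j 1) + (grad \<phi> x \<bullet> id (axis i 1)) * (grad \<phi> x \<bullet> id (axis j 1)))"
        by (simp add: gram_det_def inner_prod_def)
      then show "?w x = sqrt (gram_det ?X x)"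
        using det_gram_of_graph[OF linear_id, of "grad \<phi> x"] by (simp only: matrix_id power_one mult_1)
    qed
    ultimately show ?thesis by blast
  qed
  have uni: "s = integral R ?w" if P: "?P s" for s
  proof -
    obtain X U where X: "parametrizes X U ((\<lambda>x. (x, \<phi> x)) ` R)" and s: "s = integral U (\<lambda>u. sqrt (gram_det X u))"
      using P by blast
    then obtain W where U: "U \<in> sets lebesgue" "inj_on X U" "X ` U = (\<lambda>x. (x, \<phi> x)) ` R" "U \<subseteq> W" "smooth_on W X"
      by (auto simp: parametrizes_def)
    define \<xi> where "\<xi> u = fst (X u)" for u
    define A where "A u v = fst (frechet_derivative X (at u) v)" for u v
    define B where "B u v = snd (frechet_derivative X (at u) v)" for u v
    have Xu: "\<xi> u \<in> R" "snd (X u) = \<phi> (\<xi> u)" if "u \<in> U" for u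
    proof -
      have "X u \<in> (\<lambda>x. (x, \<phi> x)) ` R" using U(3) that by blast
      then show "\<xi> u \<in> R" "snd (X u) = \<phi> (\<xi> u)" by (auto simp: \<xi>_def)
    qed
    have hX: "(X has_derivative frechet_derivative X (at u)) (at u)" if "u \<in> U" for u
      using smooth_on_differentiable[OF U(5)] U(4) that by (auto simp: frechet_derivative_works)
    have hA: "(\<xi> has_derivative A u) (at u)" if "u \<in> U" for u
      unfolding \<xi>_def A_def by (rule has_derivative_fst[OF hX[OF that]])
    have hB: "((\<lambda>u. snd (X u)) has_derivative B u) (at u)" if "u \<in> U" for u
      unfolding B_def by (rule has_derivative_snd[OF hX[OF that]])
    have h\<phi>: "((\<lambda>u. \<phi> (\<xi> u)) has_derivative (\<lambda>v. grad \<phi> (\<xi> u) \<bullet> A u v)) (at u)" if "u \<in> U" for u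
      using has_derivative_compose[OF hA[OF that] has_derivative_grad[OF smooth_on_differentiable[OF \<phi>]]] Xu[OF that] RD
      by blast
    \<comment> \<open>The parameter set \<open>U\<close> is only measurable, so the identity
      \<open>snd (X u) = \<phi> (\<xi> u)\<close> on \<open>U\<close> cannot be differentiated at
      every point. The points where the derivatives of both sides differ form a null set and do not
      affect the integral.\<close>
    define N where "N = {u \<in> U. (\<lambda>v. B u v - grad \<phi> (\<xi> u) \<bullet> A u v) \<noteq> (\<lambda>_. 0)}"
    have N: "negligible N"
      unfolding N_def
      by (rule negligible_zeros_nonzero_derivative[where F = "\<lambda>u. snd (X u) - \<phi> (\<xi> u)"])
        (use hB h\<phi> Xu in \<open>auto intro!: has_derivative_diff\<close>)
    have img: "\<xi> ` U = R"
    proof -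
      have "fst ` X ` U = R" unfolding U(3) by force
      then show ?thesis by (simp add: \<xi>_def image_image)
    qed
    have inj: "inj_on \<xi> U"
    proof (rule inj_onI)
      fix u v assume *: "u \<in> U" "v \<in> U" "\<xi> u = \<xi> v"
      then have "X u = X v" using Xu(2)[of u] Xu(2)[of v] by (simp add: prod_eq_iff \<xi>_def)
      then show "u = v" using U(2) * by (simp add: inj_on_def)
    qed
    have "s = integral U (\<lambda>u. \<bar>det (matrix (A u))\<bar> * ?w (\<xi> u))"
      unfolding s
    proof (rule integral_spike[OF N])
      fix u assume u: "u \<in> U - N"
      then have b: "B u v = grad \<phi> (\<xi> u) \<bullet> A u v" for v unfolding N_def by (auto simp: fun_eq_iff)
      have "gram_det X u = det (\<chi> i j. A u (axis i 1) \<bullet> A u (axis j 1)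
          + (grad \<phi> (\<xi> u) \<bullet> A u (axis i 1)) * (grad \<phi> (\<xi> u) \<bullet> A u (axis j 1)))"
        unfolding gram_det_def b[symmetric] by (simp add: inner_prod_def A_def B_def)
      also have "\<dots> = (det (matrix (A u)))\<^sup>2 * (1 + (norm (grad \<phi> (\<xi> u)))\<^sup>2)"
        by (rule det_gram_of_graph) (use hA u has_derivative_linear in blast)
      finally show "\<bar>det (matrix (A u))\<bar> * ?w (\<xi> u) = sqrt (gram_det X u)"
        by (simp add: real_sqrt_mult)
    qed
    also have "\<dots> = integral (\<xi> ` U) ?w"
      by (rule change_of_variables[OF U(1) _ inj]) (use hA abs_int img in \<open>auto intro: has_derivative_at_withinI\<close>)
    finally show ?thesis using img by simp
  qed
  show ?thesis unfolding surface_area_def by (rule the_equality[where P = ?P]) (fact ex, fact uni)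
qed

section \<open>Ellipsoids\<close>

definition ellipsoid :: "('a::euclidean_space \<Rightarrow> 'a) \<Rightarrow> real \<Rightarrow> 'a set" where
  "ellipsoid Q t = {u. u \<bullet> Q u \<le> t}"

definition pos_def :: "('a::euclidean_space \<Rightarrow> 'a) \<Rightarrow> bool" where
  "pos_def Q \<longleftrightarrow> linear Q \<and> (\<forall>u. u \<noteq> 0 \<longrightarrow> 0 < u \<bullet> Q u)"

lemma continuous_on_quadratic: "linear Q \<Longrightarrow> continuous_on S (\<lambda>u. u \<bullet> Q (u::'a::euclidean_space))"
  by (intro continuous_intros linear_continuous_on) (simp add: linear_conv_bounded_linear)

lemma pos_def_coercive:
  fixes Q :: "'a::euclidean_space \<Rightarrow> 'a"
  assumes "pos_def Q"
  obtains c where "c > 0" "\<And>u. c * (norm u)\<^sup>2 \<le> u \<bullet> Q u"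
proof -
  have lin: "linear Q" and pos: "\<And>u. u \<noteq> 0 \<Longrightarrow> 0 < u \<bullet> Q u" using assms by (auto simp: pos_def_def)
  obtain b :: 'a where "b \<in> Basis" using nonempty_Basis by blast
  then have "b \<in> sphere 0 1" by simp
  then have ne: "sphere (0::'a) 1 \<noteq> {}" by blast
  obtain m where m: "m \<in> sphere (0::'a) 1" "\<And>y. y \<in> sphere 0 1 \<Longrightarrow> m \<bullet> Q m \<le> y \<bullet> Q y"
    using continuous_attains_inf[OF compact_sphere ne continuous_on_quadratic[OF lin]] by blast
  show thesis
  proof (rule that)
    have "m \<noteq> 0" using m(1) by auto
    then show "m \<bullet> Q m > 0" by (rule pos)
    fix u :: 'a
    show "(m \<bullet> Q m) * (norm u)\<^sup>2 \<le> u \<bullet> Q u"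
    proof (cases "u = 0")
      case False
      have "m \<bullet> Q m \<le> (u /\<^sub>R norm u) \<bullet> Q (u /\<^sub>R norm u)" by (rule m(2)) (use False in simp)
      also have "\<dots> = (u \<bullet> Q u) / (norm u)\<^sup>2"
        using linear_scale[OF lin] by (simp add: power2_eq_square divide_simps)
      finally show ?thesis using False by (simp add: pos_le_divide_eq)
    qed (simp add: linear_0[OF lin])
  qed
qed

lemma ellipsoid_bound:
  assumes "c > 0" "\<And>u. c * (norm u)\<^sup>2 \<le> u \<bullet> Q u" "u \<in> ellipsoid Q t" "t < c * r\<^sup>2" "r > 0"
  shows "norm u < r"
proof -
  have "c * (norm u)\<^sup>2 < c * r\<^sup>2" using assms(2)[of u] assms(3,4) by (simp add: ellipsoid_def)
  then show ?thesis using assms(1,5) by (simp add: power2_less_imp_less)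
qed

lemma compact_ellipsoid:
  fixes Q :: "'a::euclidean_space \<Rightarrow> 'a"
  assumes Q: "pos_def Q"
  shows "compact (ellipsoid Q t)"
proof -
  obtain c where c: "c > 0" "\<And>u. c * (norm u)\<^sup>2 \<le> u \<bullet> Q u" using pos_def_coercive[OF Q] by blast
  have "norm u < sqrt ((\<bar>t\<bar> + 1) / c)" if "u \<in> ellipsoid Q t" for u
    by (rule ellipsoid_bound[OF c that]) (use c in auto)
  then have "bounded (ellipsoid Q t)" unfolding bounded_iff by (meson less_imp_le)
  moreover have "closed (ellipsoid Q t)"
    unfolding ellipsoid_def
    by (intro closed_Collect_le continuous_on_quadratic continuous_on_const) (use Q in \<open>simp add: pos_def_def\<close>)
  ultimately show ?thesis by (simp add: compact_eq_bounded_closed)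
qed

text \<open>For symmetric \<open>Q\<close> this is a constant depending on \<open>t\<close> and the
  dimension, divided by the square root of the determinant of \<open>Q\<close>.\<close>

definition ell_vol :: "('a::euclidean_space \<Rightarrow> 'a) \<Rightarrow> real \<Rightarrow> real" where
  "ell_vol Q t = measure lebesgue (ellipsoid Q t)"

lemma measure_inj_linear_image:
  fixes T :: "real^'n \<Rightarrow> real^'n"
  assumes S: "compact S" and T: "linear T" "inj T"
  shows "measure lebesgue (T ` S) = \<bar>det (matrix T)\<bar> * measure lebesgue S"
proof -
  have bl: "bounded_linear T" using T by (simp add: linear_conv_bounded_linear)
  have cT: "compact (T ` S)" by (intro compact_continuous_image S linear_continuous_on bl)
  have "integral S (\<lambda>x. \<bar>det (matrix T)\<bar> * 1) = integral (T ` S) (\<lambda>_. 1)"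
    using S cT T(2)
    by (intro change_of_variables[where f = "\<lambda>_. 1" and g' = "\<lambda>_. T"] bounded_linear_imp_has_derivative bl
        absolutely_integrable_continuous_compact)
      (auto intro: inj_on_subset simp: lmeasurable_compact fmeasurableD)
  then show ?thesis
    unfolding integral_mult_right
    using lmeasure_integral[OF lmeasurable_compact[OF cT]] lmeasure_integral[OF lmeasurable_compact[OF S]] by simp
qed

lemma ell_vol_scale:
  fixes Q :: "real^'n \<Rightarrow> real^'n"
  assumes Q: "pos_def Q" and s: "s > 0"
  shows "ell_vol Q (s\<^sup>2 * t) = s ^ CARD('n) * ell_vol Q t"
proof -
  have lin: "linear Q" using Q by (simp add: pos_def_def)
  have "(*\<^sub>R) s ` ellipsoid Q t = ellipsoid Q (s\<^sup>2 * t)"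
  proof (intro equalityI subsetI)
    fix u assume "u \<in> ellipsoid Q (s\<^sup>2 * t)"
    then have "u /\<^sub>R s \<in> ellipsoid Q t"
      using s by (simp add: ellipsoid_def linear_scale[OF lin] power2_eq_square field_simps)
    moreover have "u = s *\<^sub>R (u /\<^sub>R s)" using s by simp
    ultimately show "u \<in> (*\<^sub>R) s ` ellipsoid Q t" by blast
  qed (use s in \<open>auto simp: ellipsoid_def linear_scale[OF lin] power2_eq_square mult.assoc\<close>)
  moreover have "inj ((*\<^sub>R) s :: real^'n \<Rightarrow> real^'n)" using s by (auto simp: inj_on_def)
  ultimately show ?thesis
    using measure_inj_linear_image[OF compact_ellipsoid[OF Q], of "(*\<^sub>R) s" t] s
    by (simp add: ell_vol_def linear_scaleR)
qed

lemma ell_vol_pos: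
  fixes Q :: "real^'n \<Rightarrow> real^'n"
  assumes Q: "pos_def Q" and t: "t > 0"
  shows "ell_vol Q t > 0"
proof -
  have lin: "linear Q" using Q by (simp add: pos_def_def)
  have "open {u. u \<bullet> Q u < t}"
    by (intro open_Collect_less continuous_on_quadratic[OF lin] continuous_on_const)
  moreover have "(0 :: real^'n) \<in> {u. u \<bullet> Q u < t}" using t by simp
  ultimately obtain e where e: "e > 0" "ball 0 e \<subseteq> {u. u \<bullet> Q u < t}"
    using open_contains_ball by blast
  have "0 < measure lebesgue (ball (0 :: real^'n) e)" using content_ball_pos[OF e(1)] by simp
  also have "\<dots> \<le> ell_vol Q t"
    unfolding ell_vol_def
    by (rule measure_mono_fmeasurable)
      (use e in \<open>auto simp: ellipsoid_def intro: lmeasurable_compact compact_ellipsoid[OF Q, unfolded ellipsoid_def]\<close>)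
  finally show ?thesis .
qed

text \<open>This is the matrix determinant lemma in terms of volumes: with \<open>u\<close> the
  preimage of \<open>v\<close> under \<open>Q\<close>, the determinant grows by the factor
  \<open>1 + r * (v \<bullet> u)\<close>. A linear map \<open>T\<close> that differs from the
  identity by rank one pulls the form of \<open>Q\<close> back to the perturbed form.\<close>

lemma ell_vol_rank_one:
  fixes Q :: "real^'n \<Rightarrow> real^'n"
  assumes Q: "pos_def Q" and sym: "\<And>x y. Q x \<bullet> y = x \<bullet> Q y" and u: "Q u = v" and r: "0 < 1 + r * (v \<bullet> u)"
  shows "pos_def (\<lambda>x. Q x + (r * (v \<bullet> x)) *\<^sub>R v)"
    and "sqrt (1 + r * (v \<bullet> u)) * ell_vol (\<lambda>x. Q x + (r * (v \<bullet> x)) *\<^sub>R v) t = ell_vol Q t"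
proof -
  let ?Q' = "\<lambda>x. Q x + (r * (v \<bullet> x)) *\<^sub>R v"
  define b where "b = v \<bullet> u"
  \<comment> \<open>The pulled back form requires \<open>2 * s + s^2 * b = r\<close>, that is,
    \<open>(1 + s * b)^2 = 1 + r * b\<close>; the positive root is taken. If \<open>b = 0\<close>
    then \<open>v = 0\<close> and \<open>s\<close> is irrelevant.\<close>
  define s where "s = (sqrt (1 + r * b) - 1) / b"
  define T where "T = (\<lambda>x. x + (v \<bullet> x) *\<^sub>R (s *\<^sub>R u))"
  have linQ: "linear Q" and posQ: "\<And>u. u \<noteq> 0 \<Longrightarrow> 0 < u \<bullet> Q u" using Q by (auto simp: pos_def_def)
  have b0: "v = 0" if "b = 0"
  proof -
    have "u = 0" using posQ[of u] that u by (auto simp: b_def inner_commute)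
    then show ?thesis using u linear_0[OF linQ] by simp
  qed
  have sb: "1 + s * b = sqrt (1 + r * b)"
    using r b0 by (cases "b = 0") (auto simp: s_def b_def)
  have quad: "T x \<bullet> Q (T x) = x \<bullet> ?Q' x" for x
  proof (cases "b = 0")
    case True then show ?thesis using b0 by (simp add: T_def)
  next
    case False
    have uq: "u \<bullet> Q x = v \<bullet> x" using sym[of u x] u by simp
    have "T x \<bullet> Q (T x) = x \<bullet> Q x + (v \<bullet> x)\<^sup>2 * (2 * s + s\<^sup>2 * b)"
      unfolding T_def linear_add[OF linQ] linear_scale[OF linQ] u
      by (simp add: inner_add_left inner_add_right uq b_def inner_commute power2_eq_square algebra_simps)
    moreover have "b * (2 * s + s\<^sup>2 * b) = (1 + s * b)\<^sup>2 - 1" by (simp add: power2_eq_square algebra_simps)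
    then have "b * (2 * s + s\<^sup>2 * b) = b * r" using sb r by (simp add: b_def)
    then have r': "2 * s + s\<^sup>2 * b = r" using False by simp
    ultimately have "T x \<bullet> Q (T x) = x \<bullet> Q x + (v \<bullet> x)\<^sup>2 * r" by metis
    then show ?thesis by (simp add: inner_add_right inner_commute power2_eq_square)
  qed
  have linT: "linear T" unfolding T_def by (rule linearI) (simp_all add: algebra_simps)
  have injT: "inj T"
    unfolding linear_injective_0[OF linT]
  proof (intro allI impI)
    fix x assume T0: "T x = 0"
    have "v \<bullet> T x = (v \<bullet> x) * (1 + s * b)" by (simp add: T_def b_def inner_add_right algebra_simps)
    then have "v \<bullet> x = 0" using T0 sb r by (simp add: b_def)
    then show "x = 0" using T0 by (simp add: T_def)
  qed
  have linQ': "linear ?Q'"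
    by (rule linearI) (simp_all add: linear_add[OF linQ] linear_scale[OF linQ] algebra_simps)
  show pd: "pos_def ?Q'"
    unfolding pos_def_def
  proof (intro conjI allI impI linQ')
    fix x :: "real^'n" assume "x \<noteq> 0"
    then have "T x \<noteq> 0" using injT linear_injective_0[OF linT] by blast
    then show "0 < x \<bullet> ?Q' x" using posQ quad by metis
  qed
  have surj: "surj T" by (rule linear_injective_imp_surjective[OF linT injT]) (rule refl)
  have "T ` ellipsoid ?Q' t = ellipsoid Q t"
    using quad surj by (auto simp: ellipsoid_def image_iff) (metis surj_def)
  moreover have "det (matrix T) = sqrt (1 + r * b)"
    unfolding T_def det_matrix_rank_one using sb by (simp add: b_def inner_commute)
  ultimately show "sqrt (1 + r * (v \<bullet> u)) * ell_vol ?Q' t = ell_vol Q t"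
    using measure_inj_linear_image[OF compact_ellipsoid[OF pd] linT injT, of t] r
    by (simp add: ell_vol_def b_def)
qed

section \<open>Asymptotic area of small caps\<close>

text \<open>Differentiability of the gradient at \<open>x0\<close> suffices: the mean value theorem
  along the segment converts the first-order expansion of the gradient into a second-order expansion
  of \<open>\<phi>\<close>.\<close>

lemma taylor_second_order:
  fixes \<phi> :: "'a::euclidean_space \<Rightarrow> real"
  assumes \<phi>: "smooth_on D \<phi>" and x0: "x0 \<in> D" and \<delta>: "\<delta> > 0"
  obtains \<epsilon> where "\<epsilon> > 0" "ball x0 \<epsilon> \<subseteq> D"
    "\<And>y. norm y < \<epsilon> \<Longrightarrow> \<bar>\<phi> (x0 + y) - \<phi> x0 - grad \<phi> x0 \<bullet> y - (y \<bullet> hess \<phi> x0 y) / 2\<bar> \<le> \<delta> * (norm y)\<^sup>2"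
proof -
  obtain r0 where r0: "r0 > 0" "ball x0 r0 \<subseteq> D"
    using \<phi> x0 open_contains_ball unfolding smooth_on_def by metis
  obtain d where d: "d > 0" "\<And>y. norm (y - x0) < d \<Longrightarrow> norm (grad \<phi> y - grad \<phi> x0 - hess \<phi> x0 (y - x0)) \<le> \<delta> * norm (y - x0)"
    using has_derivative_hess[OF \<phi> x0] \<delta> unfolding has_derivative_at_alt by blast
  interpret H: linear "hess \<phi> x0" by (rule linear_hess[OF \<phi> x0])
  show thesis
  proof (rule that[of "min r0 d"])
    show "min r0 d > 0" "ball x0 (min r0 d) \<subseteq> D" using r0 d by auto
    fix y :: 'a assume y: "norm y < min r0 d"
    let ?g = "\<lambda>t. \<phi> (x0 + t *\<^sub>R y) - t * (grad \<phi> x0 \<bullet> y) - t\<^sup>2 * ((y \<bullet> hess \<phi> x0 y) / 2)"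
    let ?g' = "\<lambda>t. (grad \<phi> (x0 + t *\<^sub>R y) - grad \<phi> x0 - hess \<phi> x0 (t *\<^sub>R y)) \<bullet> y"
    have ny: "norm (t *\<^sub>R y) < min r0 d" if "0 \<le> t" "t \<le> 1" for t
      using that y mult_left_le_one_le[of "norm y" t] by simp
    have inD: "x0 + t *\<^sub>R y \<in> D" if "0 \<le> t" "t \<le> 1" for t
    proof -
      have "dist (x0 + t *\<^sub>R y) x0 < r0" using ny[OF that] unfolding dist_norm add_diff_cancel_left' by simp
      then show ?thesis using r0(2) by (auto simp: dist_commute subset_iff)
    qed
    have der: "(?g has_real_derivative ?g' t) (at t)" if t: "0 \<le> t" "t \<le> 1" for t
    proof -
      have 1: "((\<lambda>t. x0 + t *\<^sub>R y) has_derivative (\<lambda>h. h *\<^sub>R y)) (at t)"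
        by (auto intro!: derivative_eq_intros)
      have 2: "((\<lambda>t. \<phi> (x0 + t *\<^sub>R y)) has_real_derivative grad \<phi> (x0 + t *\<^sub>R y) \<bullet> y) (at t)"
        using has_derivative_compose[OF 1 has_derivative_grad[OF smooth_on_differentiable[OF \<phi> inD[OF t]]]]
        by (auto simp: has_field_derivative_def mult.commute elim!: has_derivative_eq_rhs)
      have "(?g has_real_derivative grad \<phi> (x0 + t *\<^sub>R y) \<bullet> y - grad \<phi> x0 \<bullet> y - 2 * t * ((y \<bullet> hess \<phi> x0 y) / 2)) (at t)"
        by (rule DERIV_diff DERIV_cmult_right 2)+ (auto intro!: derivative_eq_intros)
      then show ?thesis by (simp add: inner_diff_left H.scale inner_commute algebra_simps)
    qed
    have "\<exists>z. 0 < z \<and> z < 1 \<and> ?g 1 - ?g 0 = (1 - 0) * ?g' z"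
      by (rule MVT2) (use der in auto)
    then obtain t where t: "0 < t" "t < 1" "?g 1 - ?g 0 = ?g' t" by auto
    have "\<bar>?g' t\<bar> \<le> norm (grad \<phi> (x0 + t *\<^sub>R y) - grad \<phi> x0 - hess \<phi> x0 (t *\<^sub>R y)) * norm y"
      by (rule Cauchy_Schwarz_ineq2)
    also have "\<dots> \<le> (\<delta> * norm (t *\<^sub>R y)) * norm y"
      using d(2)[of "x0 + t *\<^sub>R y"] ny[of t] t by (intro mult_right_mono) auto
    also have "\<dots> \<le> \<delta> * (norm y)\<^sup>2"
      using t \<delta> mult_left_le_one_le[of "norm y * norm y" t] by (simp add: power2_eq_square)
    finally show "\<bar>\<phi> (x0 + y) - \<phi> x0 - grad \<phi> x0 \<bullet> y - (y \<bullet> hess \<phi> x0 y) / 2\<bar> \<le> \<delta> * (norm y)\<^sup>2"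
      using t(3) by simp
  qed
qed

text \<open>The shadow in the domain of the piece of the graph cut off by a vertical translate of
  its tangent hyperplane.\<close>

definition cap :: "'a::euclidean_space set \<Rightarrow> ('a \<Rightarrow> real) \<Rightarrow> 'a \<Rightarrow> real \<Rightarrow> 'a set" where
  "cap D \<phi> x0 \<tau> = {x \<in> D. \<phi> x \<le> \<phi> x0 + grad \<phi> x0 \<bullet> (x - x0) + \<tau>}"

lemma compact_cap:
  assumes \<phi>: "smooth_on D \<phi>" and r: "cball x0 r \<subseteq> D" "cap D \<phi> x0 \<tau> \<subseteq> cball x0 r"
  shows "compact (cap D \<phi> x0 \<tau>)"
proof -
  have "cap D \<phi> x0 \<tau> = {x \<in> cball x0 r. \<phi> x \<le> \<phi> x0 + grad \<phi> x0 \<bullet> (x - x0) + \<tau>}"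
    using r by (auto simp: cap_def)
  also have "\<dots> = cball x0 r \<inter> {x \<in> cball x0 r. \<phi> x \<le> \<phi> x0 + grad \<phi> x0 \<bullet> (x - x0) + \<tau>}" by auto
  also have "compact \<dots>"
    by (intro compact_Int_closed compact_cball closed_cball
      continuous_on_closed_Collect_le continuous_intros continuous_on_subset[OF continuous_on_smooth[OF \<phi>] r(1)])
  finally show ?thesis .
qed

text \<open>By the Taylor expansion a small cap lies between two concentric ellipsoids of the
  Hessian whose ratio tends to one, and the area density is nearly constant on it. The hypothesis
  \<open>sep\<close> forces caps to shrink to \<open>x0\<close>; a local expansion alone would not
  exclude remote pieces.\<close>

theorem cap_area_asymptotics:
  fixes \<phi> :: "real^'n \<Rightarrow> real"
  assumes \<phi>: "smooth_on D \<phi>" and x0: "x0 \<in> D" and H: "pos_def (hess \<phi> x0)"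
    and sep: "\<And>\<epsilon>. \<epsilon> > 0 \<Longrightarrow>
      \<exists>c>0. \<forall>x\<in>D. \<epsilon> \<le> norm (x - x0) \<longrightarrow> c \<le> \<phi> x - \<phi> x0 - grad \<phi> x0 \<bullet> (x - x0)"
  shows "\<forall>\<^sub>F \<tau> in at_right 0. compact (cap D \<phi> x0 \<tau>)"
    and "((\<lambda>\<tau>. integral (cap D \<phi> x0 \<tau>) (\<lambda>x. sqrt (1 + (norm (grad \<phi> x))\<^sup>2)) / sqrt \<tau> ^ CARD('n)) \<longlongrightarrow>
      sqrt (1 + (norm (grad \<phi> x0))\<^sup>2) * ell_vol (hess \<phi> x0) 2) (at_right 0)"
proof -
  let ?H = "hess \<phi> x0" and ?n = "CARD('n)"
  define w where "w x = sqrt (1 + (norm (grad \<phi> x))\<^sup>2)" for x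
  let ?I = "\<lambda>\<tau>. integral (cap D \<phi> x0 \<tau>) w"
  define K where "K = w x0 * ell_vol ?H 2"
  have wpos: "w x > 0" for x by (simp add: w_def add_pos_nonneg)
  have contw: "continuous_on D w"
    unfolding w_def by (intro continuous_intros continuous_on_grad[OF \<phi>])
  have D: "open D" using \<phi> by (simp add: smooth_on_def)
  obtain c where c: "c > 0" "\<And>u. c * (norm u)\<^sup>2 \<le> u \<bullet> ?H u" using pos_def_coercive[OF H] by blast
  have small: "\<forall>\<^sub>F \<tau> in at_right 0. cap D \<phi> x0 \<tau> \<subseteq> ball x0 \<epsilon>" if \<epsilon>: "\<epsilon> > 0" for \<epsilon>
  proof -
    obtain c' where c': "c' > 0" "\<forall>x\<in>D. \<epsilon> \<le> norm (x - x0) \<longrightarrow> c' \<le> \<phi> x - \<phi> x0 - grad \<phi> x0 \<bullet> (x - x0)"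
      using sep[OF \<epsilon>] by blast
    have "cap D \<phi> x0 \<tau> \<subseteq> ball x0 \<epsilon>" if "\<tau> \<in> {0<..<c'}" for \<tau>
    proof
      fix x assume "x \<in> cap D \<phi> x0 \<tau>"
      then have "x \<in> D" "\<phi> x - \<phi> x0 - grad \<phi> x0 \<bullet> (x - x0) < c'" using that by (auto simp: cap_def)
      then have "norm (x - x0) < \<epsilon>" using c'(2) by force
      then show "x \<in> ball x0 \<epsilon>" by (simp add: dist_norm norm_minus_commute)
    qed
    then show ?thesis using eventually_at_right_real[OF c'(1)] by (auto elim!: eventually_mono)
  qed
  obtain r where r: "r > 0" "cball x0 r \<subseteq> D" using D x0 open_contains_cball by metis
  show comp: "\<forall>\<^sub>F \<tau> in at_right 0. compact (cap D \<phi> x0 \<tau>)"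
    using small[OF r(1)]
  proof (rule eventually_mono)
    fix \<tau> assume "cap D \<phi> x0 \<tau> \<subseteq> ball x0 r"
    then show "compact (cap D \<phi> x0 \<tau>)" by (intro compact_cap[OF \<phi> r(2)]) auto
  qed
  have squeeze: "\<forall>\<^sub>F \<tau> in at_right 0. (1 - \<eta>) * (1 / sqrt (1 + \<eta>)) ^ ?n * K \<le> ?I \<tau> / sqrt \<tau> ^ ?n
      \<and> ?I \<tau> / sqrt \<tau> ^ ?n \<le> (1 + \<eta>) * (1 / sqrt (1 - \<eta>)) ^ ?n * K" if \<eta>: "0 < \<eta>" "\<eta> < 1" for \<eta>
  proof -
    \<comment> \<open>With this tolerance, coercivity bounds the Taylor error by
      \<open>\<eta>\<close> times the quadratic term itself.\<close>
    have "c * \<eta> / 2 > 0" using c \<eta> by simp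
    then obtain \<epsilon>1 where \<epsilon>1: "\<epsilon>1 > 0" "ball x0 \<epsilon>1 \<subseteq> D"
      "\<And>y. norm y < \<epsilon>1 \<Longrightarrow> \<bar>\<phi> (x0 + y) - \<phi> x0 - grad \<phi> x0 \<bullet> y - (y \<bullet> ?H y) / 2\<bar> \<le> (c * \<eta> / 2) * (norm y)\<^sup>2"
      using taylor_second_order[OF \<phi> x0] by blast
    have "isCont w x0" using contw D x0 continuous_on_eq_continuous_at by blast
    then obtain \<epsilon>2 where \<epsilon>2: "\<epsilon>2 > 0" "\<And>x. dist x x0 < \<epsilon>2 \<Longrightarrow> dist (w x) (w x0) < \<eta> * w x0"
      unfolding continuous_at_eps_delta using \<eta> wpos[of x0] by (metis mult_pos_pos)
    define \<epsilon> where "\<epsilon> = min (min \<epsilon>1 \<epsilon>2) r"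
    have \<epsilon>: "\<epsilon> > 0" using \<epsilon>1 \<epsilon>2 r by (simp add: \<epsilon>_def)
    have wb: "(1 - \<eta>) * w x0 \<le> w x" "w x \<le> (1 + \<eta>) * w x0" if "x \<in> ball x0 \<epsilon>" for x
    proof -
      have "\<bar>w x - w x0\<bar> < \<eta> * w x0" using \<epsilon>2(2)[of x] that by (simp add: \<epsilon>_def dist_commute dist_real_def)
      then show "(1 - \<eta>) * w x0 \<le> w x" "w x \<le> (1 + \<eta>) * w x0" by (simp_all add: algebra_simps)
    qed
    have quad: "(1 - \<eta>) * (y \<bullet> ?H y) / 2 \<le> \<phi> (x0 + y) - \<phi> x0 - grad \<phi> x0 \<bullet> y"
      "\<phi> (x0 + y) - \<phi> x0 - grad \<phi> x0 \<bullet> y \<le> (1 + \<eta>) * (y \<bullet> ?H y) / 2" if "norm y < \<epsilon>" for y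
    proof -
      define q where "q = y \<bullet> ?H y"
      define e where "e = \<phi> (x0 + y) - \<phi> x0 - grad \<phi> x0 \<bullet> y"
      have 1: "(c * \<eta> / 2) * (norm y)\<^sup>2 \<le> \<eta> * q / 2"
        using mult_left_mono[OF c(2)[of y], of "\<eta> / 2"] \<eta> by (simp add: mult_ac q_def)
      have "\<bar>e - q / 2\<bar> \<le> (c * \<eta> / 2) * (norm y)\<^sup>2"
        using \<epsilon>1(3)[of y] that by (simp add: \<epsilon>_def e_def q_def)
      then have "\<bar>e - q / 2\<bar> \<le> \<eta> * q / 2" using 1 by (rule order_trans)
      then have "(1 - \<eta>) * q / 2 \<le> e" "e \<le> (1 + \<eta>) * q / 2"
        using abs_le_D1[of "e - q / 2" "\<eta> * q / 2"] abs_le_D2[of "e - q / 2" "\<eta> * q / 2"]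
        by (simp_all add: left_diff_distrib distrib_right add_divide_distrib diff_divide_distrib)
      then show "(1 - \<eta>) * (y \<bullet> ?H y) / 2 \<le> \<phi> (x0 + y) - \<phi> x0 - grad \<phi> x0 \<bullet> y"
        "\<phi> (x0 + y) - \<phi> x0 - grad \<phi> x0 \<bullet> y \<le> (1 + \<eta>) * (y \<bullet> ?H y) / 2" unfolding e_def q_def .
    qed
    have "\<forall>\<^sub>F \<tau> in at_right 0. \<tau> < c * \<epsilon>\<^sup>2 / 2 \<and> \<tau> > (0::real)"
      using eventually_at_right_real[of 0 "c * \<epsilon>\<^sup>2 / 2"] c \<epsilon> by (auto elim!: eventually_mono)
    then show ?thesis
      using small[OF \<epsilon>]
    proof eventually_elim
      case (elim \<tau>)
      then have \<tau>: "0 < \<tau>" "\<tau> < c * \<epsilon>\<^sup>2 / 2" and sub: "cap D \<phi> x0 \<tau> \<subseteq> ball x0 \<epsilon>" by auto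
      let ?C = "cap D \<phi> x0 \<tau>"
      have C: "compact ?C" using sub r by (intro compact_cap[OF \<phi> r(2)]) (auto simp: \<epsilon>_def)
      have CD: "?C \<subseteq> D" by (auto simp: cap_def)
      have iw: "w absolutely_integrable_on ?C"
        by (rule absolutely_integrable_continuous_compact[OF C continuous_on_subset[OF contw CD]])
      then have iw': "w integrable_on ?C" using set_lebesgue_integral_eq_integral(1) by blast
      have lm: "?C \<in> lmeasurable" by (rule lmeasurable_compact[OF C])
      have meas: "measure lebesgue ((+) x0 ` ellipsoid ?H (2 * \<tau> / (1 + s))) = (1 / sqrt (1 + s)) ^ ?n * sqrt \<tau> ^ ?n * ell_vol ?H 2"
        if s: "-1 < s" for s
      proof -
        have "measure lebesgue ((+) x0 ` ellipsoid ?H (2 * \<tau> / (1 + s))) = ell_vol ?H ((sqrt (\<tau> / (1 + s)))\<^sup>2 * 2)"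
          using \<tau> s by (simp add: measure_translation ell_vol_def mult.commute)
        also have "\<dots> = sqrt (\<tau> / (1 + s)) ^ ?n * ell_vol ?H 2"
          using \<tau> s by (intro ell_vol_scale[OF H]) simp
        finally show ?thesis by (simp add: real_sqrt_divide power_divide)
      qed
      have lme: "(+) x0 ` ellipsoid ?H t \<in> lmeasurable" for t
        by (rule lmeasurable_compact[OF compact_translation[OF compact_ellipsoid[OF H]]])
      have up: "?C \<subseteq> (+) x0 ` ellipsoid ?H (2 * \<tau> / (1 + - \<eta>))"
      proof
        fix x assume x: "x \<in> ?C"
        then have "norm (x - x0) < \<epsilon>" using sub by (auto simp: dist_norm norm_minus_commute)
        from quad(1)[OF this] have "(1 - \<eta>) * ((x - x0) \<bullet> ?H (x - x0)) / 2 \<le> \<tau>"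
          using x by (simp add: cap_def)
        then have "x - x0 \<in> ellipsoid ?H (2 * \<tau> / (1 + - \<eta>))"
          using \<eta> by (simp add: ellipsoid_def field_simps)
        moreover have "x = x0 + (x - x0)" by simp
        ultimately show "x \<in> (+) x0 ` ellipsoid ?H (2 * \<tau> / (1 + - \<eta>))" by blast
      qed
      \<comment> \<open>For this inclusion the bound on \<open>\<tau>\<close> is what keeps the
        ellipsoid in the ball where the Taylor estimate holds; for \<open>up\<close> it was the
        shrinking of the cap.\<close>
      have lo: "(+) x0 ` ellipsoid ?H (2 * \<tau> / (1 + \<eta>)) \<subseteq> ?C"
      proof
        fix x assume "x \<in> (+) x0 ` ellipsoid ?H (2 * \<tau> / (1 + \<eta>))"
        then obtain y where y: "x = x0 + y" "y \<in> ellipsoid ?H (2 * \<tau> / (1 + \<eta>))" by auto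
        have "2 * \<tau> / (1 + \<eta>) \<le> 2 * \<tau>" using \<tau> \<eta> by (simp add: field_simps)
        also have "\<dots> < c * \<epsilon>\<^sup>2" using \<tau> by simp
        finally have ny: "norm y < \<epsilon>" using ellipsoid_bound[OF c y(2) _ \<epsilon>] by simp
        have "(1 + \<eta>) * (y \<bullet> ?H y) / 2 \<le> \<tau>" using y(2) \<eta> by (simp add: ellipsoid_def field_simps)
        then have "\<phi> x \<le> \<phi> x0 + grad \<phi> x0 \<bullet> (x - x0) + \<tau>" using quad(2)[OF ny] y by simp
        moreover have "x \<in> D"
          using ny \<epsilon>1(2) by (auto simp: y \<epsilon>_def dist_norm subset_iff)
        ultimately show "x \<in> ?C" by (simp add: cap_def)
      qed
      have spos: "sqrt \<tau> ^ ?n > 0" using \<tau> by simp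
      have ic: "integral ?C (\<lambda>_. d) = d * measure lebesgue ?C" for d
        using integral_mult_right[of ?C d "\<lambda>_. 1"] lmeasure_integral[OF lm] by simp
      have "?I \<tau> \<le> integral ?C (\<lambda>_. (1 + \<eta>) * w x0)"
        by (rule integral_le[OF iw' integrable_on_const[OF lm]]) (use wb sub in auto)
      also have "\<dots> = (1 + \<eta>) * w x0 * measure lebesgue ?C" by (rule ic)
      also have "\<dots> \<le> (1 + \<eta>) * w x0 * measure lebesgue ((+) x0 ` ellipsoid ?H (2 * \<tau> / (1 + - \<eta>)))"
        using \<eta> wpos[of x0] by (intro mult_left_mono measure_mono_fmeasurable up lme fmeasurableD lm) auto
      also have "\<dots> = (1 + \<eta>) * (1 / sqrt (1 - \<eta>)) ^ ?n * K * sqrt \<tau> ^ ?n"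
        using meas[of "- \<eta>"] \<eta> by (simp add: K_def)
      finally have 1: "?I \<tau> / sqrt \<tau> ^ ?n \<le> (1 + \<eta>) * (1 / sqrt (1 - \<eta>)) ^ ?n * K"
        using spos by (simp add: pos_divide_le_eq)
      have "(1 - \<eta>) * (1 / sqrt (1 + \<eta>)) ^ ?n * K * sqrt \<tau> ^ ?n
        = (1 - \<eta>) * w x0 * measure lebesgue ((+) x0 ` ellipsoid ?H (2 * \<tau> / (1 + \<eta>)))"
        using meas[of "\<eta>"] \<eta> by (simp add: K_def)
      also have "\<dots> \<le> (1 - \<eta>) * w x0 * measure lebesgue ?C"
        using \<eta> wpos[of x0] by (intro mult_left_mono measure_mono_fmeasurable lo fmeasurableD lme lm) auto
      also have "\<dots> = integral ?C (\<lambda>_. (1 - \<eta>) * w x0)" by (rule ic[symmetric])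
      also have "\<dots> \<le> ?I \<tau>"
        by (rule integral_le[OF integrable_on_const[OF lm] iw']) (use wb sub in auto)
      finally have 2: "(1 - \<eta>) * (1 / sqrt (1 + \<eta>)) ^ ?n * K \<le> ?I \<tau> / sqrt \<tau> ^ ?n"
        using spos by (simp add: pos_le_divide_eq)
      show ?case using 1 2 by simp
    qed
  qed
  have "((\<lambda>\<tau>. ?I \<tau> / sqrt \<tau> ^ ?n) \<longlongrightarrow> K) (at_right 0)"
  proof (rule order_tendstoI)
    have l1: "((\<lambda>\<eta>. (1 - \<eta>) * (1 / sqrt (1 + \<eta>)) ^ ?n * K) \<longlongrightarrow> (1 - 0) * (1 / sqrt (1 + 0)) ^ ?n * K) (at_right 0)"
      by (intro tendsto_intros) auto
    have l2: "((\<lambda>\<eta>. (1 + \<eta>) * (1 / sqrt (1 - \<eta>)) ^ ?n * K) \<longlongrightarrow> (1 + 0) * (1 / sqrt (1 - 0)) ^ ?n * K) (at_right 0)"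
      by (intro tendsto_intros) auto
    have ev01: "\<forall>\<^sub>F \<eta> in at_right 0. \<eta> \<in> {0<..<(1::real)}" by (rule eventually_at_right_real) simp
    fix a
    {
      assume "a < K"
      then have "\<forall>\<^sub>F \<eta> in at_right 0. a < (1 - \<eta>) * (1 / sqrt (1 + \<eta>)) ^ ?n * K"
        using order_tendstoD(1)[OF l1] by simp
      then have "\<forall>\<^sub>F \<eta> in at_right 0. a < (1 - \<eta>) * (1 / sqrt (1 + \<eta>)) ^ ?n * K \<and> \<eta> \<in> {0<..<1}"
        using ev01 by eventually_elim auto
      then obtain \<eta> where "a < (1 - \<eta>) * (1 / sqrt (1 + \<eta>)) ^ ?n * K" "0 < \<eta>" "\<eta> < 1"
        using eventually_happens[of _ "at_right (0::real)"] by (auto simp: trivial_limit_at_right_real)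
      then show "\<forall>\<^sub>F \<tau> in at_right 0. a < ?I \<tau> / sqrt \<tau> ^ ?n"
        using squeeze[of \<eta>] by (auto elim!: eventually_mono)
    next
      assume "K < a"
      then have "\<forall>\<^sub>F \<eta> in at_right 0. (1 + \<eta>) * (1 / sqrt (1 - \<eta>)) ^ ?n * K < a"
        using order_tendstoD(2)[OF l2] by simp
      then have "\<forall>\<^sub>F \<eta> in at_right 0. (1 + \<eta>) * (1 / sqrt (1 - \<eta>)) ^ ?n * K < a \<and> \<eta> \<in> {0<..<1}"
        using ev01 by eventually_elim auto
      then obtain \<eta> where "(1 + \<eta>) * (1 / sqrt (1 - \<eta>)) ^ ?n * K < a" "0 < \<eta>" "\<eta> < 1"
        using eventually_happens[of _ "at_right (0::real)"] by (auto simp: trivial_limit_at_right_real)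
      then show "\<forall>\<^sub>F \<tau> in at_right 0. ?I \<tau> / sqrt \<tau> ^ ?n < a"
        using squeeze[of \<eta>] by (auto elim!: eventually_mono)
    }
  qed
  then show "((\<lambda>\<tau>. integral (cap D \<phi> x0 \<tau>) (\<lambda>x. sqrt (1 + (norm (grad \<phi> x))\<^sup>2)) / sqrt \<tau> ^ CARD('n)) \<longlongrightarrow>
      sqrt (1 + (norm (grad \<phi> x0))\<^sup>2) * ell_vol (hess \<phi> x0) 2) (at_right 0)"
    unfolding w_def K_def .
qed

lemma pos_def_above_tangent:
  fixes \<phi> :: "'a::euclidean_space \<Rightarrow> real"
  assumes \<phi>: "smooth_on D \<phi>" and x0: "x0 \<in> D" and H: "pos_def (hess \<phi> x0)"
  obtains \<epsilon> where "\<epsilon> > 0" "ball x0 \<epsilon> \<subseteq> D"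
    "\<And>y. y \<noteq> 0 \<Longrightarrow> norm y < \<epsilon> \<Longrightarrow> \<phi> x0 + grad \<phi> x0 \<bullet> y < \<phi> (x0 + y)"
proof -
  obtain c where c: "c > 0" "\<And>u. c * (norm u)\<^sup>2 \<le> u \<bullet> hess \<phi> x0 u" using pos_def_coercive[OF H] by blast
  \<comment> \<open>The tolerance \<open>c / 4\<close> is half of the coefficient
    \<open>c / 2\<close> guaranteed by coercivity, so a positive quadratic term survives.\<close>
  obtain \<epsilon> where \<epsilon>: "\<epsilon> > 0" "ball x0 \<epsilon> \<subseteq> D"
    "\<And>y. norm y < \<epsilon> \<Longrightarrow> \<bar>\<phi> (x0 + y) - \<phi> x0 - grad \<phi> x0 \<bullet> y - (y \<bullet> hess \<phi> x0 y) / 2\<bar> \<le> c / 4 * (norm y)\<^sup>2"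
    using taylor_second_order[OF \<phi> x0, of "c / 4"] c(1) by auto
  show thesis
  proof (rule that[OF \<epsilon>(1,2)])
    fix y :: 'a assume y: "y \<noteq> 0" "norm y < \<epsilon>"
    have "c / 4 * (norm y)\<^sup>2 > 0" using c y by simp
    then show "\<phi> x0 + grad \<phi> x0 \<bullet> y < \<phi> (x0 + y)"
      using abs_le_D2[OF \<epsilon>(3)[OF y(2)]] c(2)[of y] by simp
  qed
qed

text \<open>The tangents at the points of a small sphere around the point of contact push the graph
  away from the tangent at the centre.\<close>

lemma separated_from_tangent:
  fixes \<phi> :: "'a::euclidean_space \<Rightarrow> real"
  assumes \<phi>: "smooth_on D \<phi>" and x0: "x0 \<in> D" and H: "pos_def (hess \<phi> x0)" and r: "r > 0"
    and supp: "\<And>m x. m \<in> ball x0 r \<Longrightarrow> x \<in> D \<Longrightarrow> \<phi> m + grad \<phi> m \<bullet> (x - m) \<le> \<phi> x"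
    and \<epsilon>: "\<epsilon> > 0"
  shows "\<exists>c>0. \<forall>x\<in>D. \<epsilon> \<le> norm (x - x0) \<longrightarrow> c \<le> \<phi> x - \<phi> x0 - grad \<phi> x0 \<bullet> (x - x0)"
proof -
  obtain \<epsilon>1 where \<epsilon>1: "\<epsilon>1 > 0" "ball x0 \<epsilon>1 \<subseteq> D"
    "\<And>y. y \<noteq> 0 \<Longrightarrow> norm y < \<epsilon>1 \<Longrightarrow> \<phi> x0 + grad \<phi> x0 \<bullet> y < \<phi> (x0 + y)"
    using pos_def_above_tangent[OF \<phi> x0 H] by blast
  define s where "s = min (min (\<epsilon>1 / 2) (r / 2)) \<epsilon>"
  have s: "0 < s" "s < \<epsilon>1" "s < r" "s \<le> \<epsilon>" using \<epsilon> \<epsilon>1 r by (auto simp: s_def)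
  define \<psi> where "\<psi> x = \<phi> x - \<phi> x0 - grad \<phi> x0 \<bullet> (x - x0)" for x
  have sD: "sphere x0 s \<subseteq> D" using \<epsilon>1(2) s by (auto simp: subset_iff)
  obtain b :: 'a where b: "b \<in> Basis" using nonempty_Basis by blast
  then have "x0 + s *\<^sub>R b \<in> sphere x0 s" using s by (simp add: dist_norm)
  then have ne: "sphere x0 s \<noteq> {}" by blast
  have "continuous_on (sphere x0 s) \<psi>"
    unfolding \<psi>_def by (intro continuous_intros continuous_on_subset[OF continuous_on_smooth[OF \<phi>] sD])
  then obtain m0 where m0: "m0 \<in> sphere x0 s" "\<And>m. m \<in> sphere x0 s \<Longrightarrow> \<psi> m0 \<le> \<psi> m"
    using continuous_attains_inf[OF compact_sphere ne] by blast
  have "norm (m0 - x0) = s" using m0(1) by (simp add: dist_norm norm_minus_commute)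
  then have pos: "\<psi> m0 > 0"
    using \<epsilon>1(3)[of "m0 - x0"] s by (auto simp: \<psi>_def)
  have "\<psi> m0 \<le> \<psi> x" if x: "x \<in> D" "\<epsilon> \<le> norm (x - x0)" for x
  proof -
    define t where "t = norm (x - x0) / s"
    have t: "t \<ge> 1" using s x by (simp add: t_def)
    \<comment> \<open>The point where the segment from \<open>x0\<close> to \<open>x\<close> crosses
      the sphere of radius \<open>s\<close>.\<close>
    define m where "m = x0 + (x - x0) /\<^sub>R t"
    have "norm (x - x0) > 0" using x(2) \<epsilon> by linarith
    then have nm: "norm (m - x0) = s" using s unfolding m_def by (simp add: t_def)
    then have ms: "m \<in> sphere x0 s" "m \<in> ball x0 r" using s by (auto simp: dist_norm norm_minus_commute)
    have xm: "x - m = (t - 1) *\<^sub>R (m - x0)"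
    proof -
      have "x - x0 = t *\<^sub>R (m - x0)" using t by (simp add: m_def)
      moreover have "x - m = (x - x0) - (m - x0)" by simp
      ultimately show ?thesis by (simp add: scaleR_left_diff_distrib)
    qed
    \<comment> \<open>The derivative of \<open>\<psi>\<close> at \<open>m\<close> along
      \<open>m - x0\<close>. Since the tangent at \<open>m\<close> passes below the graph at
      \<open>x0\<close>, \<open>d\<close> is at least \<open>\<psi> m\<close>, hence nonnegative,
      and the same tangent evaluated at \<open>x\<close> gives
      \<open>\<psi> x \<ge> \<psi> m\<close>.\<close>
    define d where "d = (grad \<phi> m - grad \<phi> x0) \<bullet> (m - x0)"
    have "\<phi> m + grad \<phi> m \<bullet> (x0 - m) \<le> \<phi> x0" using supp[OF ms(2) x0] .
    then have d: "\<psi> m \<le> d" by (simp add: \<psi>_def d_def inner_diff_left inner_diff_right)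
    have "\<phi> m + grad \<phi> m \<bullet> (x - m) \<le> \<phi> x" using supp[OF ms(2) x(1)] .
    then have "\<psi> m + (grad \<phi> m - grad \<phi> x0) \<bullet> (x - m) \<le> \<psi> x"
      by (simp add: \<psi>_def inner_diff_left inner_diff_right)
    then have "\<psi> m + (t - 1) * d \<le> \<psi> x" unfolding xm d_def by simp
    moreover have "0 \<le> d" using d m0(2)[OF ms(1)] pos by simp
    then have "0 \<le> (t - 1) * d" using t by simp
    ultimately show ?thesis using m0(2)[OF ms(1)] by simp
  qed
  then show ?thesis using pos unfolding \<psi>_def by blast
qed

section \<open>The level hypersurfaces as graphs\<close>

locale power_levels =
  fixes f :: "real^'n \<Rightarrow> real" and \<alpha> :: real and g :: "(real^'n) \<times> real \<Rightarrow> real"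
  assumes scf: "strictly_convex_function f" and \<alpha>: "\<alpha> \<noteq> 0"
    and g: "\<And>x z. g (x, z) = z powr \<alpha> - f x"
begin

definition dom :: "real \<Rightarrow> (real^'n) set" where "dom k = {x. 0 < f x + k}"

definition height :: "real \<Rightarrow> real^'n \<Rightarrow> real" where "height k x = (f x + k) powr (1 / \<alpha>)"

abbreviation "M k \<equiv> graph_over (dom k) (height k)"

lemma smooth_f: "smooth_on UNIV f"
  using scf by (simp add: strictly_convex_function_def)

lemma has_derivative_f: "(f has_derivative (\<lambda>v. grad f x \<bullet> v)) (at x)"
  by (rule has_derivative_grad[OF smooth_on_differentiable[OF smooth_f]]) simp

lemma pos_def_hess_f: "pos_def (hess f x)"
  unfolding pos_def_def
proof (intro conjI allI impI)
  show "linear (hess f x)" by (rule linear_hess[OF smooth_f]) simp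
  fix u :: "real^'n" assume u: "u \<noteq> 0"
  have G: "range (\<lambda>x. (x, f x)) = graph_over UNIV f" by (simp add: graph_over_def)
  have "(x, f x) \<in> graph_over UNIV f" by (simp add: graph_over_def)
  then obtain N where N: "0 < snd N" "positive_normal_curvatures (graph_over UNIV f) (x, f x) N"
    using scf unfolding strictly_convex_function_def Let_def G by blast
  have "0 < snd N * (u \<bullet> hess f x u)"
    by (rule positive_normal_curvatures_graph_over[OF smooth_f _ N(2) u]) simp
  then show "0 < u \<bullet> hess f x u" using N(1) by (simp add: zero_less_mult_iff)
qed

lemma hess_f_symmetric: "hess f x u \<bullet> v = u \<bullet> hess f x v"
  using hess_symmetric[OF smooth_f, of x u v] by (simp add: inner_commute)

lemma continuous_f: "continuous_on A f"
  using continuous_on_smooth[OF smooth_f] continuous_on_subset by blast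

lemma open_dom: "open (dom k)"
  unfolding dom_def by (intro open_Collect_less continuous_intros continuous_f)

lemma smooth_height: "smooth_on (dom k) (height k)"
  using smooth_on_powr[OF smooth_f, of k "1 / \<alpha>"] by (simp add: dom_def height_def[abs_def])

lemma height_pos: "x \<in> dom k \<Longrightarrow> 0 < height k x"
  by (simp add: dom_def height_def)

lemma level_eq: "level upper_half_space g k = M k"
proof (intro equalityI subsetI)
  fix p assume p: "p \<in> level upper_half_space g k"
  obtain x z where xz: "p = (x, z)" by (cases p)
  have z: "z > 0" "z powr \<alpha> = f x + k" using p xz g by (auto simp: level_def upper_half_space_def)
  then have "f x + k > 0" by (metis powr_gt_zero less_irrefl)
  moreover have "(f x + k) powr (1 / \<alpha>) = z" unfolding z(2)[symmetric] using z(1) \<alpha> by (simp add: powr_powr)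
  ultimately show "p \<in> M k" by (auto simp: xz graph_over_def dom_def height_def)
next
  fix p assume "p \<in> M k"
  then obtain x where x: "x \<in> dom k" "p = (x, height k x)" by (auto simp: graph_over_def)
  then have "height k x powr \<alpha> = f x + k" using \<alpha> by (simp add: height_def dom_def powr_powr)
  then show "p \<in> level upper_half_space g k"
    using x height_pos g by (simp add: level_def upper_half_space_def)
qed

lemma has_derivative_w_powr:
  assumes "x \<in> dom k"
  shows "((\<lambda>x. (f x + k) powr s) has_derivative (\<lambda>v. (s * (f x + k) powr (s - 1)) * (grad f x \<bullet> v))) (at x)"
proof -
  have 1: "((\<lambda>x. f x + k) has_derivative (\<lambda>v. grad f x \<bullet> v)) (at x)"
    using has_derivative_add[OF has_derivative_f[of x] has_derivative_const[of k "at x"]] by simp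
  have 2: "((\<lambda>y. y powr s) has_derivative (*) (s * (f x + k) powr (s - 1))) (at (f x + k))"
    using has_real_derivative_powr[of "f x + k" s] assms by (simp add: has_field_derivative_def dom_def)
  show ?thesis using has_derivative_compose[OF 1 2] .
qed

lemma grad_height:
  assumes "x \<in> dom k"
  shows "grad (height k) x = (1 / \<alpha> * (f x + k) powr (1 / \<alpha> - 1)) *\<^sub>R grad f x"
  using has_derivative_w_powr[OF assms, of "1 / \<alpha>"]
  by (intro grad_unique) (simp add: height_def[abs_def])

text \<open>The Hessian of \<open>f\<close> corrected by a rank one term: the Hessian of \<open>height k\<close> up to a scalar.\<close>

definition P :: "real \<Rightarrow> real^'n \<Rightarrow> real^'n \<Rightarrow> real^'n" where
  "P k x v = hess f x v + ((1 / \<alpha> - 1) / (f x + k) * (grad f x \<bullet> v)) *\<^sub>R grad f x"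

lemma hess_height:
  assumes x: "x \<in> dom k"
  shows "hess (height k) x v = (1 / \<alpha> * (f x + k) powr (1 / \<alpha> - 1)) *\<^sub>R P k x v"
proof -
  have w: "f x + k > 0" using x by (simp add: dom_def)
  let ?a = "1 / \<alpha>"
  have 1: "((\<lambda>x. ?a * (f x + k) powr (?a - 1)) has_derivative
      (\<lambda>v. ?a * (((?a - 1) * (f x + k) powr (?a - 1 - 1)) * (grad f x \<bullet> v)))) (at x)"
    by (rule has_derivative_mult_right[OF has_derivative_w_powr[OF x]])
  have 2: "(grad f has_derivative hess f x) (at x)" by (rule has_derivative_hess[OF smooth_f]) simp
  have 3: "((\<lambda>x. (?a * (f x + k) powr (?a - 1)) *\<^sub>R grad f x) has_derivative
      (\<lambda>v. (?a * (f x + k) powr (?a - 1)) *\<^sub>R hess f x v +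
         (?a * (((?a - 1) * (f x + k) powr (?a - 1 - 1)) * (grad f x \<bullet> v))) *\<^sub>R grad f x)) (at x)"
    by (rule has_derivative_scaleR[OF 1 2])
  have "(grad (height k) has_derivative
      (\<lambda>v. (?a * (f x + k) powr (?a - 1)) *\<^sub>R hess f x v +
         (?a * (((?a - 1) * (f x + k) powr (?a - 1 - 1)) * (grad f x \<bullet> v))) *\<^sub>R grad f x)) (at x)"
    by (rule has_derivative_transform_within_open[OF 3 open_dom x]) (simp add: grad_height)
  from hess_unique[OF this] have "hess (height k) x v = (?a * (f x + k) powr (?a - 1)) *\<^sub>R hess f x v +
         (?a * (((?a - 1) * (f x + k) powr (?a - 1 - 1)) * (grad f x \<bullet> v))) *\<^sub>R grad f x" by simp
  moreover have "(f x + k) powr (?a - 1 - 1) = (f x + k) powr (?a - 1) / (f x + k)"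
    using w powr_diff[of "f x + k" "?a - 1" 1] by simp
  ultimately show ?thesis unfolding P_def scaleR_add_right scaleR_scaleR by (simp add: mult_ac)
qed

text \<open>The gradient of \<open>g\<close> is normal to the graph, so its norm is its vertical
  component, in absolute value \<open>\<bar>\<alpha>\<bar> * z powr (\<alpha> - 1)\<close>, times
  the slope factor. The same slope factor is the area density at the point and cancels in the
  condition.\<close>

lemma norm_grad_g:
  assumes x: "x \<in> dom k"
  shows "norm (grad g (x, height k x)) =
    \<bar>\<alpha>\<bar> * (f x + k) powr (1 - 1 / \<alpha>) * sqrt (1 + (norm (grad (height k) x))\<^sup>2)"
proof -
  let ?z = "height k x" and ?w = "f x + k"
  have w: "?w > 0" using x by (simp add: dom_def)
  have z: "?z > 0" by (rule height_pos[OF x])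
  have gg: "g = (\<lambda>p. snd p powr \<alpha> - f (fst p))" using g by (auto simp: fun_eq_iff)
  have 1: "((\<lambda>p :: (real^'n) \<times> real. snd p powr \<alpha>) has_derivative (\<lambda>v. (\<alpha> * ?z powr (\<alpha> - 1)) * snd v)) (at (x, ?z))"
  proof -
    have "((\<lambda>y. y powr \<alpha>) has_derivative (*) (\<alpha> * ?z powr (\<alpha> - 1))) (at (snd (x, ?z)))"
      using has_real_derivative_powr[of ?z \<alpha>] z by (simp add: has_field_derivative_def)
    from has_derivative_compose[OF has_derivative_snd[OF has_derivative_ident] this] show ?thesis by simp
  qed
  have "(f has_derivative (\<lambda>v. grad f x \<bullet> v)) (at (fst (x, ?z)))" using has_derivative_f by simp
  from has_derivative_compose[OF has_derivative_fst[OF has_derivative_ident] this]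
  have 2: "((\<lambda>p :: (real^'n) \<times> real. f (fst p)) has_derivative (\<lambda>v. grad f x \<bullet> fst v)) (at (x, ?z))" by simp
  have "(g has_derivative (\<lambda>v. (- grad f x, \<alpha> * ?z powr (\<alpha> - 1)) \<bullet> v)) (at (x, ?z))"
    unfolding gg using has_derivative_diff[OF 1 2] by (simp add: inner_prod_def)
  then have G: "grad g (x, ?z) = (- grad f x, \<alpha> * ?z powr (\<alpha> - 1))" by (rule grad_unique)
  have "?z powr (\<alpha> - 1) = ?w powr (1 - 1 / \<alpha>)"
    using \<alpha> by (simp add: height_def powr_powr right_diff_distrib)
  then have n: "(norm (grad g (x, ?z)))\<^sup>2 = (norm (grad f x))\<^sup>2 + (\<alpha> * ?w powr (1 - 1 / \<alpha>))\<^sup>2"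
    unfolding G by (simp add: norm_prod_def)
  have inv: "?w powr (1 - 1 / \<alpha>) * ?w powr (1 / \<alpha> - 1) = 1" using w by (simp flip: powr_add)
  have "(\<alpha> * ?w powr (1 - 1 / \<alpha>)) * (1 / \<alpha> * ?w powr (1 / \<alpha> - 1)) = 1"
    using inv \<alpha> by (simp add: field_simps)
  then have inv2: "(\<alpha> * ?w powr (1 - 1 / \<alpha>))\<^sup>2 * (1 / \<alpha> * ?w powr (1 / \<alpha> - 1))\<^sup>2 = 1"
    by (metis power_mult_distrib power_one)
  have gn: "(norm (grad (height k) x))\<^sup>2 = (1 / \<alpha> * ?w powr (1 / \<alpha> - 1))\<^sup>2 * (norm (grad f x))\<^sup>2"
    unfolding grad_height[OF x] by (simp add: power_mult_distrib power_divide)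
  have "(\<bar>\<alpha>\<bar> * ?w powr (1 - 1 / \<alpha>) * sqrt (1 + (norm (grad (height k) x))\<^sup>2))\<^sup>2
    = (\<alpha> * ?w powr (1 - 1 / \<alpha>))\<^sup>2 * (1 + (norm (grad (height k) x))\<^sup>2)"
    by (simp add: power_mult_distrib)
  also have "\<dots>
    = (\<alpha> * ?w powr (1 - 1 / \<alpha>))\<^sup>2 + ((\<alpha> * ?w powr (1 - 1 / \<alpha>))\<^sup>2 * (1 / \<alpha> * ?w powr (1 / \<alpha> - 1))\<^sup>2) * (norm (grad f x))\<^sup>2"
    unfolding gn by (simp only: distrib_left mult_1_right mult.assoc)
  also have "\<dots> = (norm (grad g (x, ?z)))\<^sup>2" unfolding inv2 n by simp
  finally have "(norm (grad g (x, ?z)))\<^sup>2 = (\<bar>\<alpha>\<bar> * ?w powr (1 - 1 / \<alpha>) * sqrt (1 + (norm (grad (height k) x))\<^sup>2))\<^sup>2"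
    by (rule sym)
  then show ?thesis by (rule power2_eq_imp_eq) simp_all
qed

text \<open>For \<open>\<alpha> < 0\<close> a critical point of \<open>f\<close> would be a local maximum of the height.\<close>

definition good :: "real^'n \<Rightarrow> bool" where "good x \<longleftrightarrow> 0 < \<alpha> \<or> grad f x \<noteq> 0"

lemma eventually_good:
  assumes "good x" "x \<in> dom k"
  obtains r where "r > 0" "cball x r \<subseteq> dom k" "\<And>y. y \<in> cball x r \<Longrightarrow> good y"
proof -
  have "open {y. grad f y \<noteq> 0}"
    by (intro open_Collect_neq continuous_on_grad[OF smooth_f] continuous_on_const)
  then have "open ({y. good y} \<inter> dom k)"
    using open_dom by (cases "0 < \<alpha>") (auto simp: good_def)
  moreover have "x \<in> {y. good y} \<inter> dom k" using assms by simp
  ultimately obtain r where "r > 0" "cball x r \<subseteq> {y. good y} \<inter> dom k" using open_contains_cball by metis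
  then show thesis by (intro that) auto
qed

text \<open>If the gradient vanished on an open set, so would the Hessian, which is positive
  definite.\<close>

lemma exists_regular_point:
  assumes "open A" "a \<in> A"
  shows "\<exists>x\<in>A. grad f x \<noteq> 0"
proof (rule ccontr)
  assume "\<not> ?thesis"
  then have z: "grad f x = 0" if "x \<in> A" for x using that by blast
  have "(grad f has_derivative (\<lambda>_. 0)) (at a)"
    by (rule has_derivative_transform_within_open[OF has_derivative_const[of 0] assms]) (simp add: z)
  then have "hess f a = (\<lambda>_. 0)" by (rule hess_unique)
  moreover have "0 < axis undefined 1 \<bullet> hess f a (axis undefined 1)"
    using pos_def_hess_f[of a] unfolding pos_def_def by (simp add: axis_eq_0_iff)
  ultimately show False by simp
qed

end

section \<open>The convex side of a level lies above the graph\<close>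

context power_levels
begin

lemma M_eq: "p \<in> M k \<longleftrightarrow> fst p \<in> dom k \<and> snd p = height k (fst p)"
  by (auto simp: graph_over_def prod_eq_iff)

lemma height_zero_limit:
  assumes "\<And>i. X i \<in> dom k" "X \<longlonglongrightarrow> x" "f x + k = 0" "0 < \<alpha>"
  shows "(\<lambda>i. height k (X i)) \<longlonglongrightarrow> 0"
proof -
  have "(\<lambda>i. f (X i)) \<longlonglongrightarrow> f x" using continuous_on_tendsto_compose[OF continuous_f[of UNIV] assms(2)] by simp
  then have "(\<lambda>i. f (X i) + k) \<longlonglongrightarrow> f x + k" by (intro tendsto_intros)
  then have "(\<lambda>i. f (X i) + k) \<longlonglongrightarrow> 0" using assms(3) by simp
  then show ?thesis
    unfolding height_def
    by (rule tendsto_zero_powrI[OF _ tendsto_const]) (use assms in \<open>auto simp: dom_def intro!: always_eventually less_imp_le\<close>)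
qed

text \<open>A boundary point of the domain would be a limit point of the level at height \<open>0\<close>, respectively
  \<open>\<infinity>\<close>; the former is excluded by closedness of the level, the latter by an affine upper bound.\<close>

lemma dom_eq_UNIV:
  assumes sc: "strictly_convex_hypersurface (M k)"
    and ub: "0 < \<alpha> \<or> (\<exists>l b. \<forall>x\<in>dom k. height k x \<le> l \<bullet> x + b)"
  shows "dom k = UNIV"
proof -
  have ne: "dom k \<noteq> {}" using sc by (auto simp: strictly_convex_hypersurface_def graph_over_def)
  obtain U where U: "convex_side (M k) U" using sc by (auto simp: strictly_convex_hypersurface_def)
  then have cl: "closed (M k)" unfolding convex_side_def by (metis frontier_closed)
  have "closed (dom k)"
    unfolding closed_sequential_limits
  proof (intro allI impI, elim conjE)
    fix X x assume X: "\<forall>i. X i \<in> dom k" "X \<longlonglongrightarrow> x"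
    have lim: "(\<lambda>i. f (X i)) \<longlonglongrightarrow> f x" using continuous_on_tendsto_compose[OF continuous_f[of UNIV] X(2)] by simp
    have lim': "(\<lambda>i. f (X i) + k) \<longlonglongrightarrow> f x + k" by (intro tendsto_intros lim)
    have "0 \<le> f x + k"
      by (rule tendsto_lowerbound[OF lim']) (use X in \<open>auto simp: dom_def intro!: always_eventually less_imp_le\<close>)
    moreover have "f x + k \<noteq> 0"
    proof
      assume z: "f x + k = 0"
      show False
      proof (cases "0 < \<alpha>")
        case True
        have a: "(\<lambda>i. (X i, height k (X i))) \<longlonglongrightarrow> (x, 0)"
          using X z True by (intro tendsto_Pair height_zero_limit[where x = x]) auto
        have b: "\<And>i. (X i, height k (X i)) \<in> M k" using X by (simp add: M_eq)
        have "(x, 0) \<in> M k" by (rule closed_sequentially[OF cl b a])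
        then show False using height_pos[of x k] by (simp add: M_eq)
      next
        case False
        then obtain l b where lb: "\<And>x. x \<in> dom k \<Longrightarrow> height k x \<le> l \<bullet> x + b" using ub by auto
        have a: "\<alpha> < 0" using False \<alpha> by simp
        define B where "B = \<bar>l \<bullet> x + b\<bar> + 1"
        have B: "B > 0" by (simp add: B_def add_nonneg_pos)
        have "(\<lambda>i. l \<bullet> X i + b) \<longlonglongrightarrow> l \<bullet> x + b" by (intro tendsto_intros X)
        then have "\<forall>\<^sub>F i in sequentially. l \<bullet> X i + b < B"
          by (rule order_tendstoD) (simp add: B_def)
        moreover have "\<forall>\<^sub>F i in sequentially. f (X i) + k < B powr \<alpha>"
          using order_tendstoD(2)[OF lim', of "B powr \<alpha>"] B z by simp
        ultimately have "\<forall>\<^sub>F i in sequentially. False"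
        proof eventually_elim
          case (elim i)
          have Xi: "X i \<in> dom k" using X by blast
          then have "height k (X i) < B" using lb[OF Xi] elim(1) by linarith
          then have "B powr \<alpha> < height k (X i) powr \<alpha>"
            using height_pos[OF Xi] a by (intro powr_less_mono2_neg) auto
          also have "height k (X i) powr \<alpha> = f (X i) + k" using Xi \<alpha> by (simp add: height_def dom_def powr_powr)
          finally show False using elim(2) by simp
        qed
        then show False by simp
      qed
    qed
    ultimately show "x \<in> dom k" by (simp add: dom_def)
  qed
  then show ?thesis using open_dom[of k] ne clopen by blast
qed

text \<open>An affine upper bound makes the domain the whole space. A nonconstant affine bound has a
  zero, against positivity of the height. A constant one puts the point of contact at a critical
  point of \<open>f\<close>; there \<open>good\<close> gives \<open>0 < \<alpha>\<close>, so the
  height is larger nearby.\<close>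

lemma no_upper_tangent:
  assumes sc: "strictly_convex_hypersurface (M k)" and x0: "x0 \<in> dom k" and gd: "good x0"
    and ub: "\<And>x. x \<in> dom k \<Longrightarrow> height k x \<le> height k x0 + grad (height k) x0 \<bullet> (x - x0)"
  shows False
proof -
  let ?l = "grad (height k) x0"
  have "\<forall>x\<in>dom k. height k x \<le> ?l \<bullet> x + (height k x0 - ?l \<bullet> x0)"
    using ub by (simp add: inner_diff_right algebra_simps)
  then have D: "dom k = UNIV" using dom_eq_UNIV[OF sc] by blast
  show False
  proof (cases "?l = 0")
    case False
    define t where "t = height k x0 / (?l \<bullet> ?l)"
    have "height k (x0 - t *\<^sub>R ?l) \<le> height k x0 + ?l \<bullet> (- t *\<^sub>R ?l)"
      using ub[of "x0 - t *\<^sub>R ?l"] D by simp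
    also have "\<dots> = 0" using False by (simp add: t_def)
    finally show False using height_pos[of "x0 - t *\<^sub>R ?l" k] D by simp
  next
    case True
    have w: "f x0 + k > 0" using x0 by (simp add: dom_def)
    have G0: "grad f x0 = 0" using True w \<alpha> by (simp add: grad_height[OF x0])
    then have a: "\<alpha> > 0" using gd by (simp add: good_def)
    obtain \<epsilon> where \<epsilon>: "\<epsilon> > 0" "ball x0 \<epsilon> \<subseteq> UNIV"
      "\<And>y. y \<noteq> 0 \<Longrightarrow> norm y < \<epsilon> \<Longrightarrow> f x0 + grad f x0 \<bullet> y < f (x0 + y)"
      by (rule pos_def_above_tangent[OF smooth_f UNIV_I pos_def_hess_f[of x0]]) (rule that)
    define y :: "real^'n" where "y = (\<epsilon> / 2) *\<^sub>R axis undefined 1"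
    have y: "y \<noteq> 0" "norm y < \<epsilon>" using \<epsilon> by (auto simp: y_def axis_eq_0_iff)
    have "f x0 < f (x0 + y)" using \<epsilon>(3)[OF y] G0 by simp
    then have "height k x0 < height k (x0 + y)"
      using w a by (simp add: height_def powr_less_mono2)
    then show False using ub[of "x0 + y"] D True by simp
  qed
qed

text \<open>The definition provides some convex side. A hyperplane separating it from a point of the
  graph has the graph on one side and is therefore the tangent hyperplane; its orientation fixes the
  supporting inequality and the direction of the normal.\<close>

lemma convex_side_above:
  assumes sc: "strictly_convex_hypersurface (M k)" and x0: "x0 \<in> dom k" and gd: "good x0"
  shows supporting: "\<And>x. x \<in> dom k \<Longrightarrow> height k x0 + grad (height k) x0 \<bullet> (x - x0) \<le> height k x"
    and pos_def_hess_height: "pos_def (hess (height k) x0)"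
    and "\<exists>U. convex_side (M k) U \<and> (\<forall>x s. x \<in> dom k \<longrightarrow> 0 < s \<longrightarrow> (x, height k x + s) \<in> U)"
proof -
  let ?l = "grad (height k) x0" and ?p = "(x0, height k x0)"
  have pM: "?p \<in> M k" using x0 by (simp add: M_eq)
  obtain U where U: "convex_side (M k) U" "\<And>p. p \<in> M k \<Longrightarrow> \<exists>N. unit_normal (M k) p N \<and>
      (\<forall>\<^sub>F t in at_right 0. p + t *\<^sub>R N \<in> U) \<and> positive_normal_curvatures (M k) p N"
    using sc by (auto simp: strictly_convex_hypersurface_def)
  have Uo: "open U" "convex U" "U \<noteq> {}" "frontier U = M k" using U(1) by (auto simp: convex_side_def)
  have pU: "?p \<notin> U" using pM Uo by (auto simp: frontier_def interior_open)
  have "\<exists>a b. a \<noteq> 0 \<and> (\<forall>y\<in>{?p}. a \<bullet> y \<le> b) \<and> (\<forall>y\<in>U. b \<le> a \<bullet> y)"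
    by (rule separating_hyperplane_sets) (use Uo pU in auto)
  then obtain a b where ab: "a \<noteq> 0" "a \<bullet> ?p \<le> b" "\<And>y. y \<in> U \<Longrightarrow> b \<le> a \<bullet> y"
    by blast
  have aU: "a \<bullet> ?p \<le> a \<bullet> y" if "y \<in> U" for y using ab(2) ab(3)[OF that] by simp
  have "closure U \<subseteq> {y. a \<bullet> ?p \<le> a \<bullet> y}"
    by (rule closure_minimal) (auto intro: aU closed_halfspace_ge)
  then have aM: "a \<bullet> ?p \<le> a \<bullet> y" if "y \<in> M k" for y
    using that Uo(4) by (auto simp: frontier_def)
  obtain a1 c where a: "a = (a1, c)" by (cases a)
  have min: "a1 \<bullet> x0 + c * height k x0 \<le> a1 \<bullet> x + c * height k x" if "x \<in> dom k" for x
    using aM[of "(x, height k x)"] that by (simp add: a M_eq)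
  have hd: "((\<lambda>x. a1 \<bullet> x + c * height k x) has_derivative (\<lambda>v. a1 \<bullet> v + c * (?l \<bullet> v))) (at x0)"
    by (intro has_derivative_add has_derivative_mult_right has_derivative_inner_right has_derivative_ident
      has_derivative_grad smooth_on_differentiable[OF smooth_height x0])
  \<comment> \<open>The separating functional, restricted to the graph, has a minimum at
    \<open>x0\<close>. First-order optimality makes \<open>a\<close> a multiple of the upward
    normal, with factor \<open>c\<close>.\<close>
  have "(\<lambda>v. a1 \<bullet> v + c * (?l \<bullet> v)) = (\<lambda>v. 0)"
    by (rule differential_zero_maxmin[OF x0 open_dom hd]) (use min in auto)
  then have "(a1 + c *\<^sub>R ?l) \<bullet> v = 0" for v by (simp add: inner_add_left fun_eq_iff)
  then have "a1 + c *\<^sub>R ?l = 0" using inner_eq_zero_iff by blast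
  then have a1: "a1 = - c *\<^sub>R ?l" by (simp add: eq_neg_iff_add_eq_0)
  have c0: "c \<noteq> 0" using ab(1) a a1 by (auto simp: zero_prod_def)
  have sup0: "0 \<le> c * (height k x - (height k x0 + ?l \<bullet> (x - x0)))" if "x \<in> dom k" for x
    using min[OF that] by (simp add: a1 inner_diff_right algebra_simps)
  \<comment> \<open>A negative factor would place the whole graph below its tangent
    hyperplane.\<close>
  have c: "c > 0"
  proof (rule ccontr)
    assume "\<not> ?thesis"
    then have "c < 0" using c0 by simp
    then have "height k x \<le> height k x0 + ?l \<bullet> (x - x0)" if "x \<in> dom k" for x
      using sup0[OF that] by (simp add: zero_le_mult_iff)
    then show False using no_upper_tangent[OF sc x0 gd] by blast
  qed
  show "height k x0 + ?l \<bullet> (x - x0) \<le> height k x" if "x \<in> dom k" for x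
    using sup0[OF that] c by (simp add: zero_le_mult_iff)
  obtain N where N: "unit_normal (M k) ?p N" "\<forall>\<^sub>F t in at_right 0. ?p + t *\<^sub>R N \<in> U"
    "positive_normal_curvatures (M k) ?p N" using U(2)[OF pM] by blast
  have fN: "fst N = - snd N *\<^sub>R ?l" "snd N \<noteq> 0" using unit_normal_graph_over[OF smooth_height x0 N(1)] by auto
  have pos1: "0 < 1 + ?l \<bullet> ?l" by (simp add: add_pos_nonneg)
  obtain t where t: "?p + t *\<^sub>R N \<in> U" "0 < t"
    using eventually_happens[OF eventually_conj[OF N(2) eventually_at_right_less]]
    by (auto simp: trivial_limit_at_right_real)
  have "0 \<le> t * (a \<bullet> N)" using aU[OF t(1)] by (simp add: inner_add_right)
  then have "0 \<le> a \<bullet> N" using t(2) by (simp add: zero_le_mult_iff)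
  moreover have "a \<bullet> N = c * (snd N * (1 + ?l \<bullet> ?l))"
    by (simp add: a a1 inner_prod_def fN algebra_simps)
  ultimately have sN: "snd N > 0" using c fN(2) pos1 by (simp add: zero_le_mult_iff)
  show "pos_def (hess (height k) x0)"
    unfolding pos_def_def
  proof (intro conjI allI impI linear_hess[OF smooth_height x0])
    fix u :: "real^'n" assume "u \<noteq> 0"
    from positive_normal_curvatures_graph_over[OF smooth_height x0 N(3) this]
    show "0 < u \<bullet> hess (height k) x0 u" using sN by (simp add: zero_less_mult_iff)
  qed
  \<comment> \<open>The open region above the graph is connected and misses the frontier of
    \<open>U\<close>, so a single common point puts all of it inside \<open>U\<close>.\<close>
  define E where "E = (\<lambda>(x, s). (x, height k x + s)) ` (dom k \<times> {0<..})"
  have "connected (M k)" using sc by (simp add: strictly_convex_hypersurface_def)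
  then have "connected (fst ` M k)" by (intro connected_continuous_image continuous_intros)
  moreover have "fst ` M k = dom k" by (force simp: graph_over_def image_image)
  ultimately have "connected (dom k)" by simp
  then have "connected (dom k \<times> {(0::real)<..})" by (intro connected_Times) auto
  then have conE: "connected E"
    unfolding E_def case_prod_beta
    by (intro connected_continuous_image continuous_intros
      continuous_on_compose2[OF continuous_on_smooth[OF smooth_height[of k]]]) auto
  have EM: "E \<inter> M k = {}" by (auto simp: E_def M_eq)
  \<comment> \<open>Along the inward normal the height above the graph has initial slope
    \<open>snd N * (1 + ?l \<bullet> ?l)\<close>, which is positive, so short steps land in both
    \<open>U\<close> and \<open>E\<close>.\<close>
  have "\<exists>t>0. ?p + t *\<^sub>R N \<in> U \<and> ?p + t *\<^sub>R N \<in> E"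
  proof -
    let ?d = "\<lambda>t. t * snd N + height k x0 - height k (x0 + t *\<^sub>R fst N)"
    have 1: "((\<lambda>t. x0 + t *\<^sub>R fst N) has_derivative (\<lambda>h. h *\<^sub>R fst N)) (at 0)"
      by (auto intro!: derivative_eq_intros)
    have "(height k has_derivative (\<lambda>v. ?l \<bullet> v)) (at (x0 + 0 *\<^sub>R fst N))"
      using has_derivative_grad[OF smooth_on_differentiable[OF smooth_height x0]] by simp
    from has_derivative_compose[OF 1 this]
    have "((\<lambda>t. height k (x0 + t *\<^sub>R fst N)) has_real_derivative ?l \<bullet> fst N) (at 0)"
      by (auto simp: has_field_derivative_def mult.commute elim!: has_derivative_eq_rhs)
    then have "(?d has_real_derivative snd N - ?l \<bullet> fst N) (at 0)"
      by (auto intro!: derivative_eq_intros)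
    moreover have "snd N - ?l \<bullet> fst N > 0"
    proof -
      have "snd N - ?l \<bullet> fst N = snd N * (1 + ?l \<bullet> ?l)" by (simp add: fN algebra_simps)
      then show ?thesis using sN pos1 by simp
    qed
    ultimately obtain d where d: "d > 0" "\<And>h. 0 < h \<Longrightarrow> h < d \<Longrightarrow> ?d 0 < ?d (0 + h)"
      using DERIV_pos_inc_right by blast
    have "\<forall>\<^sub>F t in at_right 0. x0 + t *\<^sub>R fst N \<in> dom k"
      using curve_through_graph_over(2)[OF smooth_height x0] by (rule eventually_at_filter[THEN iffD2, OF eventually_mono]) auto
    moreover have "\<forall>\<^sub>F t in at_right 0. t \<in> {0<..<d}" using d(1) by (rule eventually_at_right_real)
    ultimately have "\<forall>\<^sub>F t in at_right 0. t > 0 \<and> ?p + t *\<^sub>R N \<in> U \<and> ?p + t *\<^sub>R N \<in> E"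
      using N(2)
    proof eventually_elim
      case (elim t)
      define s where "s = height k x0 + t * snd N - height k (x0 + t *\<^sub>R fst N)"
      have "s > 0" using d(2)[of t] elim by (simp add: s_def)
      then have "(x0 + t *\<^sub>R fst N, height k (x0 + t *\<^sub>R fst N) + s) \<in> E"
        using elim(1) by (auto simp: E_def intro!: image_eqI[where x = "(x0 + t *\<^sub>R fst N, s)"])
      then have "?p + t *\<^sub>R N \<in> E" by (simp add: s_def plus_prod_def scaleR_prod_def)
      then show ?case using elim by simp
    qed
    then show ?thesis using eventually_happens trivial_limit_at_right_real by blast
  qed
  then have "E \<inter> U \<noteq> {}" by blast
  then have "E \<subseteq> U" using connected_Int_frontier[OF conE] EM Uo(4) by blast
  then show "\<exists>U. convex_side (M k) U \<and> (\<forall>x s. x \<in> dom k \<longrightarrow> 0 < s \<longrightarrow> (x, height k x + s) \<in> U)"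
    using U(1) by (intro exI[of _ U]) (auto simp: E_def image_subset_iff)
qed

lemma height_separated:
  assumes sc: "strictly_convex_hypersurface (M k)" and x0: "x0 \<in> dom k" and gd: "good x0" and "\<epsilon> > 0"
  shows "\<exists>c>0. \<forall>x\<in>dom k. \<epsilon> \<le> norm (x - x0) \<longrightarrow> c \<le> height k x - height k x0 - grad (height k) x0 \<bullet> (x - x0)"
proof -
  obtain r where r: "r > 0" "cball x0 r \<subseteq> dom k" "\<And>y. y \<in> cball x0 r \<Longrightarrow> good y"
    using eventually_good[OF gd x0] by blast
  show ?thesis
  proof (rule separated_from_tangent[OF smooth_height x0 pos_def_hess_height[OF sc x0 gd] r(1) _ assms(4)])
    fix m x assume "m \<in> ball x0 r" "x \<in> dom k"
    moreover from this have "m \<in> dom k" "good m" using r by auto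
    ultimately show "height k m + grad (height k) m \<bullet> (x - m) \<le> height k x"
      using supporting[OF sc] by blast
  qed
qed

end

section \<open>Nested levels, parallel tangent hyperplanes and the gap between them\<close>

context power_levels
begin

text \<open>Heights increase with \<open>k\<close> for positive \<open>\<alpha>\<close> and decrease
  for negative \<open>\<alpha>\<close>. Hence \<open>h = sg * e\<close> with \<open>e > 0\<close>
  moves into the convex side in both cases.\<close>

abbreviation "sg \<equiv> sgn \<alpha>"

lemma sg_cases: obtains "sg = 1" "0 < \<alpha>" | "sg = -1" "\<alpha> < 0"
  using \<alpha> by (cases "0 < \<alpha>") auto

lemma sg_mult: "sg * \<alpha> = \<bar>\<alpha>\<bar>" "sg / \<alpha> = 1 / \<bar>\<alpha>\<bar>" "sg * sg = 1" "\<bar>sg\<bar> = 1"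
  by (rule sg_cases; simp)+

lemma height_mono:
  assumes "x \<in> dom k" "x \<in> dom k'" "0 < sg * (k' - k)"
  shows "height k x < height k' x"
proof (cases rule: sg_cases)
  case 1
  then show ?thesis using assms by (auto simp: height_def dom_def intro!: powr_less_mono2)
next
  case 2
  then show ?thesis using assms by (auto simp: height_def dom_def intro!: powr_less_mono2_neg)
qed

text \<open>Moving in the direction \<open>sg\<close> raises the height, so it remains to see that
  the neighbouring domain is contained in \<open>dom k\<close>. For positive \<open>\<alpha>\<close>
  the latter is everything; for negative \<open>\<alpha>\<close> the domain shrinks with
  \<open>k'\<close>.\<close>

lemma levels_nested:
  assumes sc: "strictly_convex_hypersurface (M k)" and k': "0 < sg * (k' - k)"
  shows "lies_in_convex_side (M k') (M k)"
proof -
  have "dom k \<noteq> {}" using sc by (auto simp: strictly_convex_hypersurface_def graph_over_def)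
  then obtain x0 where x0: "x0 \<in> dom k" "good x0"
    using exists_regular_point[OF open_dom] by (auto simp: good_def)
  obtain U where U: "convex_side (M k) U" "\<And>x s. x \<in> dom k \<Longrightarrow> 0 < s \<Longrightarrow> (x, height k x + s) \<in> U"
    using convex_side_above(3)[OF sc x0] by blast
  have "M k' \<subseteq> U"
  proof
    fix p assume "p \<in> M k'"
    then obtain x where x: "x \<in> dom k'" "p = (x, height k' x)" by (auto simp: graph_over_def)
    have "x \<in> dom k"
    proof (cases rule: sg_cases)
      case 1
      then show ?thesis using dom_eq_UNIV[OF sc] by blast
    next
      case 2
      then show ?thesis using x k' by (auto simp: dom_def)
    qed
    then show "p \<in> U" using U(2)[of x "height k' x - height k x"] height_mono[of x k k'] x k' by simp
  qed
  then show ?thesis using U(1) by (auto simp: lies_in_convex_side_def)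
qed

lemma is_S_D:
  assumes "is_S upper_half_space g S"
  shows "is_interval S" "interior S \<noteq> {}" "\<And>k. k \<in> S \<Longrightarrow> strictly_convex_hypersurface (M k)"
  using assms by (auto simp: is_S_def maximal_interval_def interval_with_def level_eq)

text \<open>Without an actual interval the condition would be vacuous. The witness is the part of
  \<open>S\<close> beyond \<open>k\<close> in the direction \<open>sg\<close>.\<close>

lemma is_I_exists:
  assumes S: "is_S upper_half_space g S" and k: "k \<in> interior S"
  obtains I where "is_I upper_half_space g S k I" "\<forall>\<^sub>F e in at_right 0. k + sg * e \<in> I"
proof -
  define I where "I = {k' \<in> S. 0 < sg * (k' - k)}"
  have kS: "k \<in> S" using k interior_subset by blast
  obtain r where r: "r > 0" "ball k r \<subseteq> S" using k mem_interior by blast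
  have ev: "\<forall>\<^sub>F e in at_right 0. k + sg * e \<in> I"
  proof -
    have "k + sg * e \<in> I" if "e \<in> {0<..<r}" for e
    proof -
      have "k + sg * e \<in> ball k r" using that sg_mult(4) by (simp add: dist_real_def abs_mult)
      moreover have "sg * (sg * e) = e" using sg_mult(3) by (metis mult.assoc mult_1)
      ultimately show ?thesis using r that by (auto simp: I_def)
    qed
    then show ?thesis using eventually_at_right_real[OF r(1)] by (auto elim!: eventually_mono)
  qed
  have bI: "ball (k + sg * (r / 2)) (r / 2) \<subseteq> I"
  proof
    fix x assume "x \<in> ball (k + sg * (r / 2)) (r / 2)"
    then have "x \<in> ball k r \<and> 0 < sg * (x - k)"
      by (cases rule: sg_cases) (auto simp: dist_real_def abs_if split: if_splits)
    then show "x \<in> I" using r by (auto simp: I_def)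
  qed
  have intI: "interior I \<noteq> {}"
    using interior_maximal[OF bI open_ball] r(1) by (metis centre_in_ball empty_iff half_gt_zero subset_empty)
  have iv: "is_interval I"
    unfolding is_interval_1
  proof (intro ballI allI impI)
    fix a b x assume ab: "a \<in> I" "b \<in> I" and x: "a \<le> x \<and> x \<le> b"
    then have "x \<in> S" using is_S_D(1)[OF S] unfolding is_interval_1 I_def by blast
    then show "x \<in> I" using ab x by (cases rule: sg_cases) (auto simp: I_def)
  qed
  have ne: "M k \<noteq> {}" using is_S_D(3)[OF S kS] by (auto simp: strictly_convex_hypersurface_def)
  have "is_I upper_half_space g S k I"
    unfolding is_I_def maximal_interval_def interval_with_def level_eq
  proof (intro conjI allI impI ballI iv intI)
    show "I \<subseteq> S" by (auto simp: I_def)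
    show "lies_in_convex_side (M k') (M k)" if "k' \<in> I" for k'
      using levels_nested[OF is_S_D(3)[OF S kS]] that by (simp add: I_def)
    \<comment> \<open>A larger admissible interval would reach across \<open>k\<close> and so
      contain it, but \<open>M k\<close> is disjoint from its own open convex side.\<close>
    fix J assume J: "(is_interval J \<and> interior J \<noteq> {} \<and> J \<subseteq> S \<and> (\<forall>k'\<in>J. lies_in_convex_side (M k') (M k))) \<and> I \<subseteq> J"
    have kJ: "k \<notin> J"
    proof
      assume "k \<in> J"
      then have "lies_in_convex_side (M k) (M k)" using J by blast
      then obtain U where "convex_side (M k) U" "M k \<subseteq> U" unfolding lies_in_convex_side_def by blast
      then have "frontier U = M k" "open U" by (auto simp: convex_side_def)
      then have "U \<inter> M k = {}" by (auto simp: frontier_def interior_open)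
      then show False using ne \<open>M k \<subseteq> U\<close> by blast
    qed
    have "J \<subseteq> I"
    proof
      fix j assume j: "j \<in> J"
      have "k + sg * (r / 2) \<in> I" by (rule subsetD[OF bI]) (use r(1) in simp)
      then have i: "k + sg * (r / 2) \<in> J" using J by blast
      have "0 < sg * (j - k)"
      proof (rule ccontr)
        assume n: "\<not> ?thesis"
        have Jint: "x \<in> J" if "a \<in> J" "b \<in> J" "a \<le> x" "x \<le> b" for a b x
          using J that unfolding is_interval_1 by blast
        have "k \<in> J"
        proof (cases rule: sg_cases)
          case 1
          show ?thesis by (rule Jint[OF j i]) (use 1 n r(1) in auto)
        next
          case 2
          show ?thesis by (rule Jint[OF i j]) (use 2 n r(1) in auto)
        qed
        then show False using kJ by simp
      qed
      then show "j \<in> I" using J j by (auto simp: I_def)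
    qed
    then show "J = I" using J by blast
  qed
  then show thesis using that ev by blast
qed

text \<open>Equal gradients make the two tangent hyperplanes vertical translates by
  \<open>\<tau>\<close>. As the graph lies above its own tangent, being in the slab between them is
  only an upper bound, namely the one defining the cap.\<close>

lemma parallel_tangents:
  fixes k' y \<tau>
  assumes sc: "strictly_convex_hypersurface (M k)" and x0: "x0 \<in> dom k" and gd: "good x0"
    and y: "y \<in> dom k'" "grad (height k') y = grad (height k) x0"
    and \<tau>: "height k' y = height k x0 + grad (height k) x0 \<bullet> (y - x0) + \<tau>" "0 \<le> \<tau>"
  defines "\<Psi> \<equiv> tangent_hyperplane (M k) (x0, height k x0)"
    and "\<Phi> \<equiv> tangent_hyperplane (M k') (y, height k' y)"
  shows "affine_parallel \<Psi> \<Phi>"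
    and "compact (cap (dom k) (height k) x0 \<tau>) \<Longrightarrow>
      surface_area (region_between (M k) \<Phi> \<Psi>) =
        integral (cap (dom k) (height k) x0 \<tau>) (\<lambda>x. sqrt (1 + (norm (grad (height k) x))\<^sup>2))"
proof -
  let ?l = "grad (height k) x0"
  define b where "b = height k x0 - ?l \<bullet> x0"
  have \<Psi>: "\<Psi> = {(y, z). z = ?l \<bullet> y + b}"
    unfolding \<Psi>_def b_def by (rule tangent_hyperplane_graph_over[OF smooth_height x0])
  have \<Phi>: "\<Phi> = {(y, z). z = ?l \<bullet> y + b + \<tau>}"
  proof -
    have "height k' y - ?l \<bullet> y = b + \<tau>" using \<tau>(1) by (simp add: b_def inner_diff_right)
    then show ?thesis
      unfolding \<Phi>_def tangent_hyperplane_graph_over[OF smooth_height y(1)] y(2) by (simp add: add.assoc)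
  qed
  have "\<Phi> = (\<lambda>x. (0, \<tau>) + x) ` \<Psi>"
  proof (intro equalityI subsetI)
    fix p assume "p \<in> \<Phi>"
    then have "p = (0, \<tau>) + (fst p, snd p - \<tau>)" "(fst p, snd p - \<tau>) \<in> \<Psi>"
      unfolding \<Phi> \<Psi> by (auto simp: prod_eq_iff)
    then show "p \<in> (\<lambda>x. (0, \<tau>) + x) ` \<Psi>" by blast
  qed (auto simp: \<Phi> \<Psi>)
  then show "affine_parallel \<Psi> \<Phi>" unfolding affine_parallel_def by blast
  have "region_between (M k) \<Phi> \<Psi> = (\<lambda>x. (x, height k x)) ` cap (dom k) (height k) x0 \<tau>"
  proof -
    have "p \<in> M k \<inter> convex hull (\<Phi> \<union> \<Psi>) \<longleftrightarrow> p \<in> (\<lambda>x. (x, height k x)) ` cap (dom k) (height k) x0 \<tau>" for p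
    proof -
      obtain x z where p: "p = (x, z)" by (cases p)
      have "?l \<bullet> x + b \<le> height k x" if "x \<in> dom k"
        using supporting[OF sc x0 gd that] by (simp add: b_def inner_diff_right)
      then show ?thesis
        unfolding \<Phi> \<Psi> convex_hull_parallel_graphs[OF \<tau>(2)]
        by (auto simp: p M_eq cap_def b_def inner_diff_right algebra_simps)
    qed
    then show ?thesis unfolding region_between_def by blast
  qed
  then show "surface_area (region_between (M k) \<Phi> \<Psi>) =
        integral (cap (dom k) (height k) x0 \<tau>) (\<lambda>x. sqrt (1 + (norm (grad (height k) x))\<^sup>2))"
    if "compact (cap (dom k) (height k) x0 \<tau>)"
    using surface_area_graph[OF smooth_height _ that] by (auto simp: cap_def)
qed

text \<open>The point with a parallel tangent is found by minimizing, over a small ball, the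
  neighbouring height minus the tangent affine function at \<open>x0\<close>. The minimum
  \<open>\<tau> e\<close> is squeezed between the height increments at the minimizer and at
  \<open>x0\<close>, both of which are \<open>e\<close> times the derivative of the height in
  \<open>k\<close>, up to lower order.\<close>

lemma gap_asymptotics:
  assumes sc: "strictly_convex_hypersurface (M k)" and x0: "x0 \<in> dom k" and gd: "good x0"
  obtains y \<tau> where
    "\<forall>\<^sub>F e in at_right 0. y e \<in> dom (k + sg * e) \<and> grad (height (k + sg * e)) (y e) = grad (height k) x0 \<and>
       height (k + sg * e) (y e) = height k x0 + grad (height k) x0 \<bullet> (y e - x0) + \<tau> e \<and> 0 < \<tau> e"
    "((\<lambda>e. \<tau> e / e) \<longlongrightarrow> 1 / \<bar>\<alpha>\<bar> * (f x0 + k) powr (1 / \<alpha> - 1)) (at_right 0)"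
proof -
  let ?l = "grad (height k) x0" and ?a = "1 / \<alpha>"
  define \<theta> where "\<theta> w = 1 / \<bar>\<alpha>\<bar> * w powr (?a - 1)" for w
  obtain r where r: "r > 0" "cball x0 r \<subseteq> dom k" using open_dom x0 open_contains_cball by metis
  have ne: "cball x0 r \<noteq> {}" using r(1) by simp
  obtain m where m: "m \<in> cball x0 r" "\<And>y. y \<in> cball x0 r \<Longrightarrow> f m \<le> f y"
    using continuous_attains_inf[OF compact_cball ne continuous_f] by blast
  \<comment> \<open>For shifts below \<open>c0\<close> the base \<open>f + k + sg * u\<close> of the
    power stays positive on the ball, also when \<open>sg\<close> is negative.\<close>
  define c0 where "c0 = f m + k"
  have c0: "c0 > 0" using m(1) r(2) by (auto simp: c0_def dom_def)
  have wpos: "0 < f y + k + sg * u" if "y \<in> cball x0 r" "0 \<le> u" "u < c0" for y u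
  proof -
    have "\<bar>sg * u\<bar> < c0" using that sg_mult(4) by (simp add: abs_mult)
    then show ?thesis using m(2)[OF that(1)] by (simp add: c0_def abs_less_iff)
  qed
  have inc: "y \<in> dom (k + sg * e)" if "y \<in> cball x0 r" "0 \<le> e" "e < c0" for y e
    using wpos[OF that] by (simp add: dom_def add.assoc)
  define \<Psi> where "\<Psi> e y = height (k + sg * e) y - ?l \<bullet> (y - x0) - height k x0" for e y
  have "\<exists>y. y \<in> cball x0 r \<and> (\<forall>y'\<in>cball x0 r. \<Psi> e y \<le> \<Psi> e y')" if "0 < e" "e < c0" for e
  proof -
    have "cball x0 r \<subseteq> dom (k + sg * e)" using inc that by auto
    then have "continuous_on (cball x0 r) (\<Psi> e)"
      unfolding \<Psi>_def by (intro continuous_intros continuous_on_subset[OF continuous_on_smooth[OF smooth_height]])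
    then show ?thesis using continuous_attains_inf[OF compact_cball ne] by blast
  qed
  then obtain y where y: "\<And>e. 0 < e \<Longrightarrow> e < c0 \<Longrightarrow> y e \<in> cball x0 r"
    "\<And>e y'. 0 < e \<Longrightarrow> e < c0 \<Longrightarrow> y' \<in> cball x0 r \<Longrightarrow> \<Psi> e (y e) \<le> \<Psi> e y'" by metis
  define \<tau> where "\<tau> e = \<Psi> e (y e)" for e
  have der: "((\<lambda>u. height (k + sg * u) y') has_real_derivative \<theta> (f y' + k + sg * u)) (at u)"
    if "0 < f y' + k + sg * u" for u y'
  proof -
    have 1: "((\<lambda>u. f y' + k + sg * u) has_real_derivative sg) (at u)" by (auto intro!: derivative_eq_intros)
    have "((\<lambda>u. (f y' + k + sg * u) powr ?a) has_real_derivative (?a * (f y' + k + sg * u) powr (?a - 1)) * sg) (at u)"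
      by (rule DERIV_chain2[OF has_real_derivative_powr 1]) (use that in simp)
    moreover have "(?a * (f y' + k + sg * u) powr (?a - 1)) * sg = \<theta> (f y' + k + sg * u)"
    proof -
      have "(?a * (f y' + k + sg * u) powr (?a - 1)) * sg = (sg / \<alpha>) * (f y' + k + sg * u) powr (?a - 1)" by simp
      then show ?thesis unfolding sg_mult(2) \<theta>_def .
    qed
    ultimately show ?thesis by (simp add: height_def add.assoc)
  qed
  have mvt: "\<exists>u. 0 < u \<and> u < e \<and> height (k + sg * e) y' - height k y' = e * \<theta> (f y' + k + sg * u)"
    if "0 < e" "e < c0" "y' \<in> cball x0 r" for e y'
  proof -
    have "\<exists>u. 0 < u \<and> u < e \<and> height (k + sg * e) y' - height (k + sg * 0) y' = (e - 0) * \<theta> (f y' + k + sg * u)"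
      by (rule MVT2[OF that(1)]) (use that der wpos in auto)
    then show ?thesis by simp
  qed
  have ev0: "\<forall>\<^sub>F e in at_right 0. e \<in> {0<..<c0}" by (rule eventually_at_right_real[OF c0])
  have lim_x0: "((\<lambda>e. (height (k + sg * e) x0 - height k x0) / e) \<longlongrightarrow> \<theta> (f x0 + k)) (at_right 0)"
  proof -
    have "((\<lambda>e. height (k + sg * e) x0) has_real_derivative \<theta> (f x0 + k)) (at 0)"
      using der[of x0 0] x0 by (simp add: dom_def)
    then have "((\<lambda>e. (height (k + sg * e) x0 - height k x0) / e) \<longlongrightarrow> \<theta> (f x0 + k)) (at 0)"
      by (simp add: DERIV_def)
    then show ?thesis by (rule filterlim_mono[OF _ order_refl]) (simp add: at_within_le_at)
  qed
  have lim0: "((\<lambda>e. height (k + sg * e) x0 - height k x0) \<longlongrightarrow> 0) (at_right 0)"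
  proof -
    have "((\<lambda>e. e * ((height (k + sg * e) x0 - height k x0) / e)) \<longlongrightarrow> 0 * \<theta> (f x0 + k)) (at_right 0)"
      by (intro tendsto_mult lim_x0 tendsto_ident_at)
    moreover have "\<forall>\<^sub>F e in at_right 0. e * ((height (k + sg * e) x0 - height k x0) / e) = height (k + sg * e) x0 - height k x0"
      using ev0 by eventually_elim simp
    ultimately show ?thesis using tendsto_cong by fastforce
  qed
  \<comment> \<open>The upper bound evaluates the minimized function at \<open>x0\<close>; the lower
    bound \<open>lo\<close> uses that the old level lies above its tangent at the minimizer.\<close>
  have up: "\<tau> e \<le> height (k + sg * e) x0 - height k x0" if "0 < e" "e < c0" for e
    using y(2)[OF that, of x0] r(1) by (simp add: \<tau>_def \<Psi>_def)
  have sup: "0 \<le> height k y' - height k x0 - ?l \<bullet> (y' - x0)" if "y' \<in> cball x0 r" for y'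
    using supporting[OF sc x0 gd, of y'] r(2) that by auto
  have lo: "height (k + sg * e) (y e) - height k (y e) \<le> \<tau> e" if "0 < e" "e < c0" for e
    using sup[OF y(1)[OF that]] by (simp add: \<tau>_def \<Psi>_def)
  have \<theta>pos: "\<theta> w > 0" if "w > 0" for w using that \<alpha> by (simp add: \<theta>_def)
  \<comment> \<open>A minimizer at distance at least \<open>\<epsilon>\<close> from
    \<open>x0\<close> would face the fixed separation of the level from its tangent, while the upper
    bound on the minimum tends to \<open>0\<close>. This also makes the minimizer interior.\<close>
  have close: "\<forall>\<^sub>F e in at_right 0. norm (y e - x0) < \<epsilon>" if \<epsilon>: "\<epsilon> > 0" for \<epsilon>
  proof -
    obtain c where c: "c > 0" "\<forall>x\<in>dom k. \<epsilon> \<le> norm (x - x0) \<longrightarrow> c \<le> height k x - height k x0 - ?l \<bullet> (x - x0)"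
      using height_separated[OF sc x0 gd \<epsilon>] by blast
    have "\<forall>\<^sub>F e in at_right 0. height (k + sg * e) x0 - height k x0 < c"
      using order_tendstoD(2)[OF lim0 c(1)] .
    with ev0 show ?thesis
    proof eventually_elim
      case (elim e)
      then have e: "0 < e" "e < c0" by simp_all
      obtain u where u: "0 < u" "u < e" "height (k + sg * e) (y e) - height k (y e) = e * \<theta> (f (y e) + k + sg * u)"
        using mvt[OF e y(1)[OF e]] by blast
      have "0 < e * \<theta> (f (y e) + k + sg * u)"
        using e u wpos[OF y(1)[OF e], of u] \<theta>pos by simp
      then have "height k (y e) - height k x0 - ?l \<bullet> (y e - x0) < c"
        using u(3) up[OF e] elim(2) by (simp add: \<tau>_def \<Psi>_def)
      moreover have "y e \<in> dom k" using y(1)[OF e] r(2) by blast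
      ultimately show ?case using c(2) by force
    qed
  qed
  have ylim: "(y \<longlongrightarrow> x0) (at_right 0)"
    using close by (intro tendstoI) (simp add: dist_norm)
  \<comment> \<open>Intermediate points of the mean value theorem are selected as a function of
    \<open>e\<close>, so that a limit can be taken along them.\<close>
  define R where "R e u \<longleftrightarrow> 0 < u \<and> u < e \<and>
      height (k + sg * e) (y e) - height k (y e) = e * \<theta> (f (y e) + k + sg * u)" for e u
  define u where "u e = (SOME u. R e u)" for e
  have "R e (u e)" if "0 < e" "e < c0" for e
    unfolding u_def by (rule someI_ex) (use mvt[OF that y(1)[OF that]] in \<open>simp only: R_def\<close>)
  then have u: "0 < u e \<and> u e < e \<and>
      height (k + sg * e) (y e) - height k (y e) = e * \<theta> (f (y e) + k + sg * u e)" if "0 < e" "e < c0" for e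
    using that by (simp only: R_def)
  have ulim: "(u \<longlongrightarrow> 0) (at_right 0)"
  proof (rule tendsto_sandwich[of "\<lambda>_. 0" _ _ "\<lambda>e. e"])
    have "0 < u e \<and> u e < e" if "e \<in> {0<..<c0}" for e
      using u[of e] that unfolding greaterThanLessThan_iff by blast
    then have u01: "\<forall>\<^sub>F e in at_right 0. 0 < u e \<and> u e < e" by (rule eventually_mono[OF ev0])
    show "\<forall>\<^sub>F e in at_right 0. 0 \<le> u e" using u01 by (rule eventually_mono) (rule less_imp_le, erule conjunct1)
    show "\<forall>\<^sub>F e in at_right 0. u e \<le> e" using u01 by (rule eventually_mono) (rule less_imp_le, erule conjunct2)
  qed (auto intro: tendsto_ident_at)
  have flim: "((\<lambda>e. f (y e)) \<longlongrightarrow> f x0) (at_right 0)"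
    using continuous_on_tendsto_compose[OF continuous_f[of UNIV] ylim] by simp
  have W: "((\<lambda>e. f (y e) + k + sg * u e) \<longlongrightarrow> f x0 + k + sg * 0) (at_right 0)"
    by (intro tendsto_intros flim ulim)
  have \<theta>lim: "((\<lambda>e. \<theta> (W e)) \<longlongrightarrow> \<theta> w) F" if "(W \<longlongrightarrow> w) F" "w > 0" for W :: "real \<Rightarrow> real" and w F
    unfolding \<theta>_def using that by (intro tendsto_intros) auto
  have wlim: "((\<lambda>e. \<theta> (f (y e) + k + sg * u e)) \<longlongrightarrow> \<theta> (f x0 + k)) (at_right 0)"
    using \<theta>lim[OF W] x0 by (simp add: dom_def)
  have \<tau>lim: "((\<lambda>e. \<tau> e / e) \<longlongrightarrow> \<theta> (f x0 + k)) (at_right 0)"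
  proof (rule tendsto_sandwich[OF _ _ wlim lim_x0])
    show "\<forall>\<^sub>F e in at_right 0. \<theta> (f (y e) + k + sg * u e) \<le> \<tau> e / e"
      using ev0
    proof eventually_elim
      case (elim e)
      then have "e * \<theta> (f (y e) + k + sg * u e) \<le> \<tau> e" using lo[of e] u[of e] by simp
      then show ?case using elim by (simp add: pos_le_divide_eq mult.commute)
    qed
    show "\<forall>\<^sub>F e in at_right 0. \<tau> e / e \<le> (height (k + sg * e) x0 - height k x0) / e"
      using ev0 by eventually_elim (use up in \<open>auto intro: divide_right_mono\<close>)
  qed
  have "\<forall>\<^sub>F e in at_right 0. y e \<in> dom (k + sg * e) \<and> grad (height (k + sg * e)) (y e) = ?l \<and>
       height (k + sg * e) (y e) = height k x0 + ?l \<bullet> (y e - x0) + \<tau> e \<and> 0 < \<tau> e"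
    using ev0 close[OF r(1)]
  proof eventually_elim
    case (elim e)
    then have e: "0 < e" "e < c0" by auto
    have yd: "y e \<in> dom (k + sg * e)" using inc[OF y(1)[OF e]] e by simp
    have yb: "y e \<in> ball x0 r" using elim(2) by (simp add: dist_norm norm_minus_commute)
    have hd: "(\<Psi> e has_derivative (\<lambda>v. grad (height (k + sg * e)) (y e) \<bullet> v - ?l \<bullet> v - 0)) (at (y e))"
      unfolding \<Psi>_def
      by (intro has_derivative_diff has_derivative_const has_derivative_inner_right
        has_derivative_grad smooth_on_differentiable[OF smooth_height yd])
        (auto intro!: derivative_eq_intros)
    have "(\<lambda>v. grad (height (k + sg * e)) (y e) \<bullet> v - ?l \<bullet> v - 0) = (\<lambda>v. 0)"
      by (rule differential_zero_maxmin[OF yb open_ball hd]) (use y(2)[OF e] in auto)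
    then have "(grad (height (k + sg * e)) (y e) - ?l) \<bullet> v = 0" for v
      by (simp add: inner_diff_left fun_eq_iff)
    then have "grad (height (k + sg * e)) (y e) - ?l = 0" using inner_eq_zero_iff by blast
    moreover have "0 < \<tau> e"
    proof -
      have "0 < e * \<theta> (f (y e) + k + sg * u e)"
        using e u[OF e] wpos[OF y(1)[OF e], of "u e"] \<theta>pos by simp
      then show ?thesis using lo[OF e] u[OF e] by simp
    qed
    ultimately show ?case using yd by (simp add: \<tau>_def \<Psi>_def)
  qed
  then show thesis using that \<tau>lim unfolding \<theta>_def by blast
qed

end

section \<open>The area condition in the limit\<close>

lemma ell_vol_scaleR:
  fixes Q :: "real^'n \<Rightarrow> real^'n"
  assumes Q: "pos_def Q" and c: "c > 0"
  shows "sqrt c ^ CARD('n) * ell_vol (\<lambda>v. c *\<^sub>R Q v) t = ell_vol Q t"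
proof -
  have "ellipsoid (\<lambda>v. c *\<^sub>R Q v) t = ellipsoid Q ((1 / sqrt c)\<^sup>2 * t)"
    using c by (auto simp: ellipsoid_def power_divide field_simps)
  then have "ell_vol (\<lambda>v. c *\<^sub>R Q v) t = (1 / sqrt c) ^ CARD('n) * ell_vol Q t"
    using ell_vol_scale[OF Q, of "1 / sqrt c" t] c by (simp add: ell_vol_def)
  then show ?thesis using c by (simp add: power_divide)
qed

context power_levels
begin

definition condition_with :: "(real \<Rightarrow> real \<Rightarrow> real) \<Rightarrow> real set \<Rightarrow> bool" where
  "condition_with \<eta> S \<longleftrightarrow>
     (\<forall>k\<in>S. \<forall>I. is_I upper_half_space g S k I \<longrightarrow>
         (\<forall>p\<in>level upper_half_space g k. \<forall>\<^sub>F h in at 0. k + h \<in> I \<longrightarrow>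
           (\<forall>v\<in>level upper_half_space g (k + h).
             let \<Psi> = tangent_hyperplane (level upper_half_space g k) p;
                 \<Phi> = tangent_hyperplane (level upper_half_space g (k + h)) v
             in affine_parallel \<Psi> \<Phi> \<longrightarrow>
                surface_area (region_between (level upper_half_space g k) \<Phi> \<Psi>) / norm (grad g p) = \<eta> k h)))"

text \<open>Point of contact and gap are quantified inside the eventual statement. So it serves both
  the minimizers of the asymptotic argument and the explicit points on hyperboloids.\<close>

lemma eventually_cap_area:
  assumes S: "is_S upper_half_space g S" and k: "k \<in> interior S" and x0: "x0 \<in> dom k" and gd: "good x0"
    and \<eta>: "condition_with \<eta> S"
  shows "\<forall>\<^sub>F e in at_right 0. \<forall>y \<tau>. y \<in> dom (k + sg * e) \<longrightarrow> grad (height (k + sg * e)) y = grad (height k) x0 \<longrightarrow>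
    height (k + sg * e) y = height k x0 + grad (height k) x0 \<bullet> (y - x0) + \<tau> \<longrightarrow> 0 \<le> \<tau> \<longrightarrow>
    compact (cap (dom k) (height k) x0 \<tau>) \<longrightarrow>
    integral (cap (dom k) (height k) x0 \<tau>) (\<lambda>x. sqrt (1 + (norm (grad (height k) x))\<^sup>2))
      = norm (grad g (x0, height k x0)) * \<eta> k (sg * e)"
proof -
  have kS: "k \<in> S" using k interior_subset by blast
  have sc: "strictly_convex_hypersurface (M k)" by (rule is_S_D(3)[OF S kS])
  obtain I where I: "is_I upper_half_space g S k I" "\<forall>\<^sub>F e in at_right 0. k + sg * e \<in> I"
    using is_I_exists[OF S k] by blast
  have p: "(x0, height k x0) \<in> M k" using x0 by (simp add: M_eq)
  have gpos: "norm (grad g (x0, height k x0)) > 0"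
    unfolding norm_grad_g[OF x0] using x0 \<alpha> by (auto simp: dom_def add_pos_nonneg intro!: mult_pos_pos)
  have ev: "\<forall>\<^sub>F h in at 0. k + h \<in> I \<longrightarrow>
           (\<forall>v\<in>M (k + h). let \<Psi> = tangent_hyperplane (M k) (x0, height k x0); \<Phi> = tangent_hyperplane (M (k + h)) v
             in affine_parallel \<Psi> \<Phi> \<longrightarrow>
                surface_area (region_between (M k) \<Phi> \<Psi>) / norm (grad g (x0, height k x0)) = \<eta> k h)"
    using \<eta>[unfolded condition_with_def level_eq, rule_format, OF kS I(1) p] .
  have "filterlim (\<lambda>e. sg * e) (at 0) (at_right 0)"
    unfolding filterlim_at
  proof
    show "((\<lambda>e. sg * e) \<longlongrightarrow> 0) (at_right 0)"
      using tendsto_mult_left[OF tendsto_ident_at, of sg 0 "{0<..}"] by simp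
    show "\<forall>\<^sub>F e in at_right 0. sg * e \<in> UNIV \<and> sg * e \<noteq> 0"
      using eventually_at_right_less[of 0] by eventually_elim (use \<alpha> in \<open>simp add: sgn_zero_iff\<close>)
  qed
  from eventually_compose_filterlim[OF ev this]
  have "\<forall>\<^sub>F e in at_right 0. k + sg * e \<in> I \<longrightarrow>
           (\<forall>v\<in>M (k + sg * e). let \<Psi> = tangent_hyperplane (M k) (x0, height k x0); \<Phi> = tangent_hyperplane (M (k + sg * e)) v
             in affine_parallel \<Psi> \<Phi> \<longrightarrow>
                surface_area (region_between (M k) \<Phi> \<Psi>) / norm (grad g (x0, height k x0)) = \<eta> k (sg * e))" by blast
  with I(2) show ?thesis
  proof eventually_elim
    case (elim e)
    show ?case
    proof (intro allI impI)
      fix y \<tau>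
      assume y: "y \<in> dom (k + sg * e)" "grad (height (k + sg * e)) y = grad (height k) x0"
        "height (k + sg * e) y = height k x0 + grad (height k) x0 \<bullet> (y - x0) + \<tau>" "0 \<le> \<tau>"
        and c: "compact (cap (dom k) (height k) x0 \<tau>)"
      note par = parallel_tangents[OF sc x0 gd y]
      have "(y, height (k + sg * e) y) \<in> M (k + sg * e)" using y(1) by (simp add: M_eq)
      then have "surface_area (region_between (M k) (tangent_hyperplane (M (k + sg * e)) (y, height (k + sg * e) y))
          (tangent_hyperplane (M k) (x0, height k x0))) / norm (grad g (x0, height k x0)) = \<eta> k (sg * e)"
        using elim par(1) unfolding Let_def by blast
      then show "integral (cap (dom k) (height k) x0 \<tau>) (\<lambda>x. sqrt (1 + (norm (grad (height k) x))\<^sup>2))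
        = norm (grad g (x0, height k x0)) * \<eta> k (sg * e)"
        unfolding par(2)[OF c] using gpos by (simp add: field_simps)
    qed
  qed
qed

text \<open>The quotient of which the limit is taken does not mention \<open>x0\<close>, so the
  limit has the same value at all good points. The slope factor cancels between area and gradient,
  and the rate \<open>\<theta>\<close> of the gap cancels against the scalar in the Hessian of the
  height.\<close>

theorem area_limit:
  assumes S: "is_S upper_half_space g S" and k: "k \<in> interior S" and x0: "x0 \<in> dom k" and gd: "good x0"
    and \<eta>: "condition_with \<eta> S"
  shows "pos_def (\<lambda>v. sg *\<^sub>R P k x0 v)"
    and "((\<lambda>e. \<eta> k (sg * e) / sqrt e ^ CARD('n)) \<longlongrightarrow>
      ell_vol (\<lambda>v. sg *\<^sub>R P k x0 v) 2 / (\<bar>\<alpha>\<bar> * (f x0 + k) powr (1 - 1 / \<alpha>))) (at_right 0)"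
proof -
  let ?n = "CARD('n)"
  have kS: "k \<in> S" using k interior_subset by blast
  have sc: "strictly_convex_hypersurface (M k)" by (rule is_S_D(3)[OF S kS])
  have w: "f x0 + k > 0" using x0 by (simp add: dom_def)
  define \<theta> where "\<theta> = 1 / \<bar>\<alpha>\<bar> * (f x0 + k) powr (1 / \<alpha> - 1)"
  have \<theta>: "\<theta> > 0" using w \<alpha> by (simp add: \<theta>_def)
  have H: "hess (height k) x0 = (\<lambda>v. \<theta> *\<^sub>R (sg *\<^sub>R P k x0 v))"
  proof
    fix v
    have "1 / \<bar>\<alpha>\<bar> * sg = 1 / \<alpha>" using sg_mult(2,3) by (metis mult.commute mult.left_neutral times_divide_eq_right mult.assoc)
    then show "hess (height k) x0 v = \<theta> *\<^sub>R (sg *\<^sub>R P k x0 v)"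
      unfolding hess_height[OF x0] scaleR_scaleR \<theta>_def by (metis mult.assoc mult.commute)
  qed
  have pdH: "pos_def (hess (height k) x0)" by (rule pos_def_hess_height[OF sc x0 gd])
  show pd: "pos_def (\<lambda>v. sg *\<^sub>R P k x0 v)"
  proof -
    have "(\<lambda>v. sg *\<^sub>R P k x0 v) = (\<lambda>v. (1 / \<theta>) *\<^sub>R hess (height k) x0 v)"
      unfolding H using \<theta> by simp
    moreover have "pos_def (\<lambda>v. (1 / \<theta>) *\<^sub>R hess (height k) x0 v)"
      using pdH \<theta> by (auto simp: pos_def_def intro: linear_compose_scale_right)
    ultimately show ?thesis by simp
  qed
  have sep: "\<exists>c>0. \<forall>x\<in>dom k. \<epsilon> \<le> norm (x - x0) \<longrightarrow> c \<le> height k x - height k x0 - grad (height k) x0 \<bullet> (x - x0)"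
    if "\<epsilon> > 0" for \<epsilon> by (rule height_separated[OF sc x0 gd that])
  note cap = cap_area_asymptotics[OF smooth_height x0 pdH sep]
  define A where "A \<tau> = integral (cap (dom k) (height k) x0 \<tau>) (\<lambda>x. sqrt (1 + (norm (grad (height k) x))\<^sup>2))" for \<tau>
  define q where "q = sqrt (1 + (norm (grad (height k) x0))\<^sup>2)"
  define N where "N = norm (grad g (x0, height k x0))"
  have q: "q > 0" by (simp add: q_def add_pos_nonneg)
  have N: "N = \<bar>\<alpha>\<bar> * (f x0 + k) powr (1 - 1 / \<alpha>) * q" unfolding N_def q_def by (rule norm_grad_g[OF x0])
  have N0: "N > 0" unfolding N using q w \<alpha> by simp
  obtain y \<tau> where y: "\<forall>\<^sub>F e in at_right 0. y e \<in> dom (k + sg * e) \<and> grad (height (k + sg * e)) (y e) = grad (height k) x0 \<and>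
       height (k + sg * e) (y e) = height k x0 + grad (height k) x0 \<bullet> (y e - x0) + \<tau> e \<and> 0 < \<tau> e"
    and \<tau>: "((\<lambda>e. \<tau> e / e) \<longlongrightarrow> \<theta>) (at_right 0)"
    using gap_asymptotics[OF sc x0 gd] unfolding \<theta>_def by blast
  have evp: "\<forall>\<^sub>F e in at_right 0. 0 < (e::real)" by (rule eventually_at_right_less)
  have \<tau>0: "filterlim \<tau> (at_right 0) (at_right 0)"
    unfolding filterlim_at
  proof
    show "\<forall>\<^sub>F e in at_right 0. \<tau> e \<in> {0<..} \<and> \<tau> e \<noteq> 0" using y by eventually_elim auto
    have "((\<lambda>e. e * (\<tau> e / e)) \<longlongrightarrow> 0 * \<theta>) (at_right 0)"
      by (intro tendsto_mult \<tau> tendsto_ident_at)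
    moreover have "\<forall>\<^sub>F e in at_right 0. e * (\<tau> e / e) = \<tau> e" using evp by eventually_elim simp
    ultimately show "(\<tau> \<longlongrightarrow> 0) (at_right 0)" using tendsto_cong by fastforce
  qed
  have comp: "\<forall>\<^sub>F e in at_right 0. compact (cap (dom k) (height k) x0 (\<tau> e))"
    using eventually_compose_filterlim[OF cap(1) \<tau>0] .
  have area: "((\<lambda>e. A (\<tau> e) / sqrt (\<tau> e) ^ ?n) \<longlongrightarrow> q * ell_vol (hess (height k) x0) 2) (at_right 0)"
    using filterlim_compose[OF cap(2) \<tau>0] unfolding A_def q_def .
  \<comment> \<open>Here \<open>sqrt e\<close> is written as \<open>sqrt (\<tau> e)\<close> divided
    by \<open>sqrt (\<tau> e / e)\<close>, whose limit is known.\<close>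
  have eq: "\<forall>\<^sub>F e in at_right 0. A (\<tau> e) / sqrt (\<tau> e) ^ ?n * sqrt (\<tau> e / e) ^ ?n / N = \<eta> k (sg * e) / sqrt e ^ ?n"
    using eventually_cap_area[OF S k x0 gd \<eta>] y comp evp
  proof eventually_elim
    case (elim e)
    have "A (\<tau> e) = N * \<eta> k (sg * e)"
      unfolding A_def N_def
      by (rule elim(1)[rule_format, of "y e"]) (use elim(2,3) in auto)
    then have A: "\<eta> k (sg * e) = A (\<tau> e) / N" using N0 by simp
    have "sqrt (\<tau> e) ^ ?n \<noteq> 0" using elim(2) by simp
    moreover have "a / s * (s / t) / N = a / N / t" if "s \<noteq> 0" for a s t :: real using that by simp
    ultimately show ?case unfolding A real_sqrt_divide power_divide by blast
  qed
  have "((\<lambda>e. A (\<tau> e) / sqrt (\<tau> e) ^ ?n * sqrt (\<tau> e / e) ^ ?n / N) \<longlongrightarrow>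
      (q * ell_vol (hess (height k) x0) 2) * sqrt \<theta> ^ ?n / N) (at_right 0)"
    by (intro tendsto_intros area \<tau>) (use N0 in simp)
  then have "((\<lambda>e. \<eta> k (sg * e) / sqrt e ^ ?n) \<longlongrightarrow> (q * ell_vol (hess (height k) x0) 2) * sqrt \<theta> ^ ?n / N) (at_right 0)"
    using tendsto_cong[OF eq] by blast
  \<comment> \<open>The Hessian of the height is \<open>\<theta>\<close> times the corrected
    Hessian, and \<open>sqrt \<theta> ^ CARD('n)\<close> is exactly the volume factor of that
    scaling.\<close>
  moreover have "(q * ell_vol (hess (height k) x0) 2) * sqrt \<theta> ^ ?n / N
    = ell_vol (\<lambda>v. sg *\<^sub>R P k x0 v) 2 / (\<bar>\<alpha>\<bar> * (f x0 + k) powr (1 - 1 / \<alpha>))"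
    unfolding H N using ell_vol_scaleR[OF pd \<theta>, of 2] q by (simp add: mult_ac)
  ultimately show "((\<lambda>e. \<eta> k (sg * e) / sqrt e ^ ?n) \<longlongrightarrow>
      ell_vol (\<lambda>v. sg *\<^sub>R P k x0 v) 2 / (\<bar>\<alpha>\<bar> * (f x0 + k) powr (1 - 1 / \<alpha>))) (at_right 0)" by simp
qed

end

section \<open>Exponents other than two\<close>

lemma rational_identity_contradiction:
  fixes a1 a2 c1 c2 \<beta> p q :: real
  assumes ne: "a1 \<noteq> a2" "c1 \<noteq> 0" "c2 \<noteq> 0" "\<beta> \<noteq> 0" "\<beta> \<noteq> 1" and pq: "p < q"
    and id: "\<And>k. p < k \<Longrightarrow> k < q \<Longrightarrow>
      (k + a1 + c1) * (k + a1) * ((k + a2) + \<beta> * (k + a2 + c2)) = (k + a2 + c2) * (k + a2) * ((k + a1) + \<beta> * (k + a1 + c1))"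
  shows False
proof -
  \<comment> \<open>With \<open>F_i = (k + a_i + c_i) * (k + a_i) powr \<beta>\<close>, the
    hypothesis is the equation \<open>F_1 * F_2' = F_2 * F_1'\<close> of proportional functions,
    freed of the powers. As a polynomial identity it holds for all \<open>k\<close>, also outside
    the interval.\<close>
  define F where "F = [:a1 + c1, 1:] * [:a1, 1:] * ([:a2, 1:] + smult \<beta> [:a2 + c2, 1:]) - [:a2 + c2, 1:] * [:a2, 1:] * ([:a1, 1:] + smult \<beta> [:a1 + c1, 1:])"
  have F: "poly F k = (k + a1 + c1) * (k + a1) * ((k + a2) + \<beta> * (k + a2 + c2)) - (k + a2 + c2) * (k + a2) * ((k + a1) + \<beta> * (k + a1 + c1))" for k
    by (simp add: F_def algebra_simps)
  have "{p<..<q} \<subseteq> {k. poly F k = 0}" using id by (auto simp: F)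
  then have "infinite {k. poly F k = 0}" using pq infinite_Ioo finite_subset by blast
  then have "F = 0" using poly_roots_finite by blast
  then have all: "(k + a1 + c1) * (k + a1) * ((k + a2) + \<beta> * (k + a2 + c2)) = (k + a2 + c2) * (k + a2) * ((k + a1) + \<beta> * (k + a1 + c1))" for k
    using F[of k] by simp
  \<comment> \<open>At the root \<open>- a1\<close> of the left side the right side is
    \<open>\<beta> * c1 * (a2 - a1) * (a2 - a1 + c2)\<close>; symmetrically for \<open>- a2\<close>.
    With both values inserted, the identity reduces to a nonzero multiple of
    \<open>(k + a1) * (k + a2)\<close>.\<close>
  have c2: "c2 = a1 - a2" using all[of "- a1"] ne by simp
  have c1: "c1 = a2 - a1" using all[of "- a2"] ne by simp
  have "(a2 - a1) * (\<beta> - 1) * ((k + a1) * (k + a2)) = 0" for k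
    using all[of k] unfolding c1 c2 by (simp add: algebra_simps)
  from this[of "\<bar>a1\<bar> + \<bar>a2\<bar> + 1"] show False using ne by (auto simp: add_eq_0_iff abs_if split: if_splits)
qed

context power_levels
begin

text \<open>For \<open>v\<close> the gradient, the solution is the Newton step up to sign, and its
  inner product with the gradient is the squared Newton decrement.\<close>

lemma hess_f_solve: "\<exists>X. hess f x X = v"
proof -
  have "inj (hess f x)"
    using pos_def_hess_f[of x] linear_injective_0[of "hess f x"] unfolding pos_def_def
    by (metis inner_zero_right less_irrefl)
  then have "surj (hess f x)"
    using pos_def_hess_f[of x] linear_injective_imp_surjective[of "hess f x"] by (simp add: pos_def_def)
  then show ?thesis by (metis surjD)
qed

lemma hess_f_solve_pos:
  assumes "hess f x X = grad f x"
  shows "0 \<le> grad f x \<bullet> X" "grad f x \<noteq> 0 \<Longrightarrow> 0 < grad f x \<bullet> X"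
proof -
  have e: "grad f x \<bullet> X = X \<bullet> hess f x X" using assms by (simp add: inner_commute)
  have X: "linear (hess f x)" "\<And>u. u \<noteq> 0 \<Longrightarrow> 0 < u \<bullet> hess f x u" using pos_def_hess_f[of x] by (auto simp: pos_def_def)
  show "0 \<le> grad f x \<bullet> X" unfolding e using X(2)[of X] by (cases "X = 0") auto
  show "0 < grad f x \<bullet> X" if "grad f x \<noteq> 0"
  proof -
    have "X \<noteq> 0" using assms that linear_0[OF X(1)] by auto
    then show ?thesis unfolding e by (rule X(2))
  qed
qed

text \<open>For \<open>\<alpha> < 0\<close>, positive definiteness of \<open>- P k x\<close> forces the dimension to be one, since \<open>P k x\<close>
  agrees with the Hessian of \<open>f\<close> on the orthogonal complement of the gradient.\<close>

lemma ell_vol_P: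
  assumes x: "x \<in> dom k" and gd: "good x" and pd: "pos_def (\<lambda>v. sg *\<^sub>R P k x v)"
    and X: "hess f x X = grad f x"
  defines "t \<equiv> sg * (1 + (1 / \<alpha> - 1) / (f x + k) * (grad f x \<bullet> X))"
  shows "0 < t" "sqrt t * ell_vol (\<lambda>v. sg *\<^sub>R P k x v) 2 = ell_vol (hess f x) 2"
proof -
  let ?r = "(1 / \<alpha> - 1) / (f x + k)" and ?G = "grad f x" and ?H = "hess f x"
  \<comment> \<open>The Newton direction is where the rank one correction acts by a scalar relative
    to the Hessian. Evaluating the positive definite form there gives the sign of
    \<open>t\<close>.\<close>
  have PX: "P k x X = (1 + ?r * (?G \<bullet> X)) *\<^sub>R ?G" unfolding P_def X by (simp add: algebra_simps)
  have lin: "linear ?H" and pos: "\<And>u. u \<noteq> 0 \<Longrightarrow> 0 < u \<bullet> ?H u" using pos_def_hess_f[of x] by (auto simp: pos_def_def)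
  have tb: "0 < t" if "?G \<noteq> 0"
  proof -
    have "X \<noteq> 0" using X that linear_0[OF lin] by auto
    then have "0 < X \<bullet> (sg *\<^sub>R P k x X)" using pd by (simp add: pos_def_def)
    also have "X \<bullet> (sg *\<^sub>R P k x X) = t * (?G \<bullet> X)" unfolding PX t_def by (simp add: inner_commute)
    finally show ?thesis using hess_f_solve_pos(2)[OF X that] by (simp add: zero_less_mult_iff)
  qed
  have "0 < t \<and> sqrt t * ell_vol (\<lambda>v. sg *\<^sub>R P k x v) 2 = ell_vol ?H 2"
  proof (cases rule: sg_cases)
    case 1
    have t: "t = 1 + ?r * (?G \<bullet> X)" unfolding t_def using 1 by simp
    have "0 < t" using tb by (cases "?G = 0") (auto simp: t)
    moreover have "sqrt (1 + ?r * (?G \<bullet> X)) * ell_vol (\<lambda>v. ?H v + (?r * (?G \<bullet> v)) *\<^sub>R ?G) 2 = ell_vol ?H 2"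
      by (rule ell_vol_rank_one(2)[OF pos_def_hess_f hess_f_symmetric X]) (use calculation t in simp)
    moreover have "(\<lambda>v. sg *\<^sub>R P k x v) = (\<lambda>v. ?H v + (?r * (?G \<bullet> v)) *\<^sub>R ?G)" using 1 by (simp add: P_def)
    ultimately show ?thesis unfolding t by simp
  next
    case 2
    have G: "?G \<noteq> 0" using gd 2 by (simp add: good_def)
    have orth: "y = 0" if "?G \<bullet> y = 0" for y
    proof (rule ccontr)
      assume y: "y \<noteq> 0"
      then have "0 < y \<bullet> (sg *\<^sub>R P k x y)" using pd by (simp add: pos_def_def)
      also have "y \<bullet> (sg *\<^sub>R P k x y) = - (y \<bullet> ?H y)" using 2 that by (simp add: P_def)
      finally show False using pos[OF y] by simp
    qed
    have n1: "CARD('n) = 1"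
    proof (rule ccontr)
      assume "CARD('n) \<noteq> 1"
      moreover have "0 < CARD('n)" by simp
      ultimately have "2 \<le> CARD('n)" by linarith
      then have "2 \<le> DIM(real^'n)" by simp
      then obtain y where "y \<noteq> 0" "orthogonal ?G y" using orthogonal_to_vector_exists by blast
      then show False using orth by (simp add: orthogonal_def)
    qed
    have b: "?G \<bullet> X > 0" by (rule hess_f_solve_pos(2)[OF X G])
    have "sg *\<^sub>R P k x v = t *\<^sub>R ?H v" for v
    proof -
      define c where "c = (?G \<bullet> v) / (?G \<bullet> X)"
      have "?G \<bullet> (v - c *\<^sub>R X) = 0" using b by (simp add: inner_diff_right c_def)
      then have "v = c *\<^sub>R X" using orth by fastforce
      then have "P k x v = c *\<^sub>R P k x X" unfolding P_def by (simp add: linear_scale[OF lin] algebra_simps)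
      then show ?thesis unfolding PX t_def \<open>v = c *\<^sub>R X\<close> linear_scale[OF lin] X by simp
    qed
    then have e: "(\<lambda>v. sg *\<^sub>R P k x v) = (\<lambda>v. t *\<^sub>R ?H v)" by auto
    show ?thesis using tb[OF G] ell_vol_scaleR[OF pos_def_hess_f tb[OF G], of x 2] unfolding e n1 by simp
  qed
  then show "0 < t" "sqrt t * ell_vol (\<lambda>v. sg *\<^sub>R P k x v) 2 = ell_vol ?H 2" by auto
qed

text \<open>In terms of the Gauss-Kronecker curvature \<open>K\<close> this says that \<open>K * norm (grad g) ^ (n + 2)\<close> is
  constant on each level.\<close>

lemma curvature_identity:
  assumes S: "is_S upper_half_space g S" and k: "k \<in> interior S" and \<eta>: "condition_with \<eta> S"
    and x1: "x1 \<in> dom k" "good x1" and x2: "x2 \<in> dom k" "good x2"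
    and X1: "hess f x1 X1 = grad f x1" and X2: "hess f x2 X2 = grad f x2"
  defines "\<gamma> \<equiv> 1 / \<alpha> - 1" and "\<beta> \<equiv> 1 - 2 / \<alpha>"
  shows "(ell_vol (hess f x1) 2)\<^sup>2 * ((f x2 + k + \<gamma> * (grad f x2 \<bullet> X2)) * (f x2 + k) powr \<beta>)
    = (ell_vol (hess f x2) 2)\<^sup>2 * ((f x1 + k + \<gamma> * (grad f x1 \<bullet> X1)) * (f x1 + k) powr \<beta>)"
proof -
  define E where "E x = ell_vol (\<lambda>v. sg *\<^sub>R P k x v) 2" for x
  define t where "t x X = sg * (1 + (1 / \<alpha> - 1) / (f x + k) * (grad f x \<bullet> X))" for x X
  define F where "F x X = (f x + k + \<gamma> * (grad f x \<bullet> X)) * (f x + k) powr \<beta>" for x X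
  define d where "d x = \<bar>\<alpha>\<bar> * (f x + k) powr (1 - 1 / \<alpha>)" for x
  have w: "f x1 + k > 0" "f x2 + k > 0" using x1 x2 by (auto simp: dom_def)
  have d: "d x1 > 0" "d x2 > 0" using w \<alpha> by (auto simp: d_def)
  \<comment> \<open>Both quotients are limits of the same function of \<open>e\<close>.\<close>
  have lim: "E x1 / d x1 = E x2 / d x2"
    using tendsto_unique[OF _ area_limit(2)[OF S k x1 \<eta>] area_limit(2)[OF S k x2 \<eta>]]
    by (simp add: E_def d_def trivial_limit_at_right_real)
  have v: "0 < t x X \<and> sqrt (t x X) * E x = ell_vol (hess f x) 2 \<and> sg * F x X * \<alpha>\<^sup>2 = t x X * (d x)\<^sup>2"
    if "x \<in> dom k" "good x" "hess f x X = grad f x" for x X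
  proof (intro conjI)
    note E = ell_vol_P[OF that(1,2) area_limit(1)[OF S k that(1,2) \<eta>] that(3)]
    show "0 < t x X" "sqrt (t x X) * E x = ell_vol (hess f x) 2" using E unfolding t_def E_def by auto
    have w: "f x + k > 0" using that by (simp add: dom_def)
    have "((f x + k) powr (1 - 1 / \<alpha>))\<^sup>2 = (f x + k) powr (\<beta> + 1)"
      using w by (simp add: \<beta>_def powr_power)
    also have "\<dots> = (f x + k) powr \<beta> * (f x + k)" using w by (simp add: powr_add)
    finally have p: "((f x + k) powr (1 - 1 / \<alpha>))\<^sup>2 = (f x + k) powr \<beta> * (f x + k)" .
    show "sg * F x X * \<alpha>\<^sup>2 = t x X * (d x)\<^sup>2"
      unfolding t_def F_def d_def power_mult_distrib p \<gamma>_def[symmetric] using w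
      by (simp add: divide_simps)
  qed
  note v1 = v[OF x1 X1] and v2 = v[OF x2 X2]
  have V: "(ell_vol (hess f x1) 2)\<^sup>2 = t x1 X1 * (E x1)\<^sup>2" "(ell_vol (hess f x2) 2)\<^sup>2 = t x2 X2 * (E x2)\<^sup>2"
    using v1 v2 by (metis less_imp_le power_mult_distrib real_sqrt_pow2)+
  have "E x1 * d x2 = E x2 * d x1" using lim d by (simp add: field_simps)
  then have Ed: "(E x1)\<^sup>2 * (d x2)\<^sup>2 = (E x2)\<^sup>2 * (d x1)\<^sup>2" by (metis power_mult_distrib)
  have "(ell_vol (hess f x1) 2)\<^sup>2 * (sg * F x2 X2 * \<alpha>\<^sup>2) = (t x1 X1 * t x2 X2) * ((E x1)\<^sup>2 * (d x2)\<^sup>2)"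
    unfolding V using v2 by (simp add: mult_ac)
  also have "\<dots> = (ell_vol (hess f x2) 2)\<^sup>2 * (sg * F x1 X1 * \<alpha>\<^sup>2)"
    unfolding V Ed using v1 by (simp add: mult_ac)
  finally have "(sg * \<alpha>\<^sup>2) * ((ell_vol (hess f x1) 2)\<^sup>2 * F x2 X2) = (sg * \<alpha>\<^sup>2) * ((ell_vol (hess f x2) 2)\<^sup>2 * F x1 X1)"
    by (simp add: mult_ac)
  then have "(ell_vol (hess f x1) 2)\<^sup>2 * F x2 X2 = (ell_vol (hess f x2) 2)\<^sup>2 * F x1 X1"
    using \<alpha> by (simp add: sgn_zero_iff)
  then show ?thesis unfolding F_def .
qed

text \<open>The curvature identity makes \<open>F (f x1) c1\<close> and \<open>F (f x2) c2\<close>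
  proportional as functions of \<open>k\<close>, with a factor independent of \<open>k\<close>. The
  two points only need different values of \<open>f\<close> and nonvanishing gradients; then
  \<open>c1\<close> and \<open>c2\<close> are nonzero because
  \<open>\<alpha> \<noteq> 1\<close>.\<close>

theorem not_condition_exponent_neq_2:
  assumes S: "is_S upper_half_space g S" and \<eta>: "condition_with \<eta> S" and \<alpha>1: "\<alpha> \<noteq> 1" and \<alpha>2: "\<alpha> \<noteq> 2"
  shows False
proof -
  define \<gamma> where "\<gamma> = 1 / \<alpha> - 1"
  define \<beta> where "\<beta> = 1 - 2 / \<alpha>"
  have \<gamma>: "\<gamma> \<noteq> 0" using \<alpha>1 by (simp add: \<gamma>_def)
  have \<beta>: "\<beta> \<noteq> 0" "\<beta> \<noteq> 1" using \<alpha>2 \<alpha> by (auto simp: \<beta>_def)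
  obtain k0 where k0: "k0 \<in> interior S" using is_S_D(2)[OF S] by blast
  then have sc: "strictly_convex_hypersurface (M k0)" using is_S_D(3)[OF S] interior_subset by blast
  then have "dom k0 \<noteq> {}" by (auto simp: strictly_convex_hypersurface_def graph_over_def)
  then obtain x1 where x1: "x1 \<in> dom k0" "grad f x1 \<noteq> 0" using exists_regular_point[OF open_dom] by blast
  have "open ({x. grad f x \<noteq> 0} \<inter> dom k0)"
    by (intro open_Int open_dom open_Collect_neq continuous_on_grad[OF smooth_f] continuous_on_const)
  then obtain r where r: "r > 0" "ball x1 r \<subseteq> {x. grad f x \<noteq> 0} \<inter> dom k0" 
  proof -
    assume o: "open ({x. grad f x \<noteq> 0} \<inter> dom k0)"
    have "x1 \<in> {x. grad f x \<noteq> 0} \<inter> dom k0" using x1 by simp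
    then show thesis using that open_contains_ball_eq[OF o] by blast
  qed
  obtain \<epsilon> where \<epsilon>: "\<epsilon> > 0" "ball x1 \<epsilon> \<subseteq> UNIV" "\<And>y. y \<noteq> 0 \<Longrightarrow> norm y < \<epsilon> \<Longrightarrow> f x1 + grad f x1 \<bullet> y < f (x1 + y)"
    by (rule pos_def_above_tangent[OF smooth_f UNIV_I pos_def_hess_f[of x1]]) (rule that)
  \<comment> \<open>A step along the gradient, short enough to keep the gradient nonzero and to stay
    where \<open>f\<close> lies strictly above its tangent. Hence \<open>f\<close> strictly
    increases.\<close>
  define y where "y = (min r \<epsilon> / 2 / norm (grad f x1)) *\<^sub>R grad f x1"
  have "norm y = min r \<epsilon> / 2" using x1(2) r(1) \<epsilon>(1) by (simp add: y_def)
  then have ny: "norm y < r" "norm y < \<epsilon>" "y \<noteq> 0" using r(1) \<epsilon>(1) by auto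
  define x2 where "x2 = x1 + y"
  have "dist x2 x1 < r" using ny(1) by (simp add: x2_def dist_norm)
  then have x2: "x2 \<in> dom k0" "grad f x2 \<noteq> 0" using r(2) by (auto simp: dist_commute subset_iff)
  have "0 \<le> grad f x1 \<bullet> y" using r(1) \<epsilon>(1) by (simp add: y_def)
  then have f12: "f x1 \<noteq> f x2" using \<epsilon>(3)[OF ny(3,2)] by (simp add: x2_def)
  obtain X1 X2 where X: "hess f x1 X1 = grad f x1" "hess f x2 X2 = grad f x2" using hess_f_solve by meson
  define c1 where "c1 = \<gamma> * (grad f x1 \<bullet> X1)"
  define c2 where "c2 = \<gamma> * (grad f x2 \<bullet> X2)"
  have c: "c1 \<noteq> 0" "c2 \<noteq> 0"
    using \<gamma> hess_f_solve_pos(2)[OF X(1) x1(2)] hess_f_solve_pos(2)[OF X(2) x2(2)] by (auto simp: c1_def c2_def)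
  define V1 where "V1 = (ell_vol (hess f x1) 2)\<^sup>2"
  define V2 where "V2 = (ell_vol (hess f x2) 2)\<^sup>2"
  have vp: "ell_vol (hess f x) 2 > 0" for x by (rule ell_vol_pos[OF pos_def_hess_f]) simp
  have V: "V1 > 0" "V2 > 0" unfolding V1_def V2_def by (rule zero_less_power[OF vp])+
  define F where "F a c k = (a + k + c) * (a + k) powr \<beta>" for a c k
  have id: "V1 * F (f x2) c2 k = V2 * F (f x1) c1 k" if "k \<in> interior S" "x1 \<in> dom k" "x2 \<in> dom k" for k
    using curvature_identity[OF S that(1) \<eta> that(2) _ that(3) _ X] x1 x2
    unfolding V1_def V2_def F_def c1_def c2_def \<gamma>_def \<beta>_def by (simp add: good_def)
  have der: "(F a c has_real_derivative (a + k) powr (\<beta> - 1) * ((a + k) + \<beta> * (a + k + c))) (at k)" if "a + k > 0" for a c k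
  proof -
    have pw: "(a + k) powr \<beta> = (a + k) powr (\<beta> - 1) * (a + k)"
      using that powr_add[of "a + k" "\<beta> - 1" 1] by simp
    have "((\<lambda>k. (a + k) powr \<beta>) has_real_derivative (\<beta> * (a + k) powr (\<beta> - 1)) * 1) (at k)"
      by (rule DERIV_chain2[OF has_real_derivative_powr]) (use that in \<open>auto intro!: derivative_eq_intros\<close>)
    moreover have "((\<lambda>k. a + k + c) has_real_derivative 1) (at k)" by (auto intro!: derivative_eq_intros)
    ultimately have "(F a c has_real_derivative 1 * (a + k) powr \<beta> + ((\<beta> * (a + k) powr (\<beta> - 1)) * 1) * (a + k + c)) (at k)"
      unfolding F_def by (intro DERIV_mult)
    then show ?thesis unfolding pw by (simp add: algebra_simps)
  qed
  define J where "J = interior S \<inter> {k. 0 < f x1 + k} \<inter> {k. 0 < f x2 + k}"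
  have "open J" unfolding J_def by (intro open_Int open_interior open_Collect_less continuous_intros)
  moreover have "k0 \<in> J" using k0 x1 x2 by (auto simp: J_def dom_def)
  ultimately obtain \<delta> where \<delta>: "\<delta> > 0" "ball k0 \<delta> \<subseteq> J" using open_contains_ball by blast
  show False
  proof (rule rational_identity_contradiction[OF f12 c \<beta>, of k0 "k0 + \<delta>"])
    fix k assume "k0 < k" "k < k0 + \<delta>"
    then have "k \<in> J" using \<delta>(2) by (auto simp: dist_real_def subset_iff)
    then have w: "f x1 + k > 0" "f x2 + k > 0" by (auto simp: J_def)
    have e: "V1 * F (f x2) c2 k = V2 * F (f x1) c1 k" if "k \<in> J" for k
      using id[of k] that by (auto simp: J_def dom_def)
    let ?p1 = "(f x1 + k) powr (\<beta> - 1)" and ?p2 = "(f x2 + k) powr (\<beta> - 1)"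
    let ?D1 = "?p1 * ((f x1 + k) + \<beta> * (f x1 + k + c1))"
    let ?D2 = "?p2 * ((f x2 + k) + \<beta> * (f x2 + k + c2))"
    have d1: "((\<lambda>k. V1 * F (f x2) c2 k) has_real_derivative V1 * ?D2) (at k)"
      by (rule DERIV_cmult[OF der[OF w(2)]])
    have d2: "((\<lambda>k. V2 * F (f x1) c1 k) has_real_derivative V2 * ?D1) (at k)"
      by (rule DERIV_cmult[OF der[OF w(1)]])
    have "((\<lambda>k. V1 * F (f x2) c2 k) has_real_derivative V2 * ?D1) (at k)"
      by (rule has_field_derivative_transform_within_open[OF d2 \<open>open J\<close> \<open>k \<in> J\<close>]) (simp add: e)
    then have D: "V1 * ?D2 = V2 * ?D1" using d1 DERIV_unique by blast
    \<comment> \<open>Multiplying the identity with its derivative eliminates the unknown constants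
      \<open>V1\<close> and \<open>V2\<close>.\<close>
    have "V1 * V2 * (F (f x1) c1 k * ?D2) = (V2 * F (f x1) c1 k) * (V1 * ?D2)" by simp
    also have "\<dots> = (V1 * F (f x2) c2 k) * (V2 * ?D1)" unfolding D e[OF \<open>k \<in> J\<close>] ..
    finally have "F (f x1) c1 k * ?D2 = F (f x2) c2 k * ?D1" using V by simp
    moreover have "(f x1 + k) powr \<beta> = ?p1 * (f x1 + k)" "(f x2 + k) powr \<beta> = ?p2 * (f x2 + k)"
      using w powr_add[of "f x1 + k" "\<beta> - 1" 1] powr_add[of "f x2 + k" "\<beta> - 1" 1] by simp_all
    ultimately have "(?p1 * ?p2) * ((k + f x1 + c1) * (k + f x1) * ((k + f x2) + \<beta> * (k + f x2 + c2)))
      = (?p1 * ?p2) * ((k + f x2 + c2) * (k + f x2) * ((k + f x1) + \<beta> * (k + f x1 + c1)))"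
      unfolding F_def by (simp add: algebra_simps)
    then show "(k + f x1 + c1) * (k + f x1) * ((k + f x2) + \<beta> * (k + f x2 + c2)) = (k + f x2 + c2) * (k + f x2) * ((k + f x1) + \<beta> * (k + f x1 + c1))"
      using w by simp
  qed (use \<delta> in simp)
qed

text \<open>For \<open>\<alpha> = 2\<close> the power disappears and the curvature identity is
  affine in \<open>k\<close>. Comparing two values of \<open>k\<close> equates the slopes
  \<open>V1\<close> and \<open>V2\<close>, and then the constant terms.\<close>

lemma exponent_2_identity:
  assumes S: "is_S upper_half_space g S" and \<eta>: "condition_with \<eta> S" and \<alpha>2: "\<alpha> = 2"
  obtains m where "\<And>x X. hess f x X = grad f x \<Longrightarrow> f x - (grad f x \<bullet> X) / 2 = m"
proof -
  obtain k where k: "k \<in> interior S" using is_S_D(2)[OF S] by blast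
  then obtain \<delta> where \<delta>: "\<delta> > 0" "ball k \<delta> \<subseteq> interior S" using open_contains_ball open_interior by blast
  define k' where "k' = k + \<delta> / 2"
  have k': "k' \<in> interior S" "k' \<noteq> k" using \<delta> by (auto simp: k'_def dist_real_def subset_iff)
  have D: "x \<in> dom \<kappa>" if "\<kappa> \<in> interior S" for x \<kappa>
    using dom_eq_UNIV[OF is_S_D(3)[OF S]] that interior_subset \<alpha>2 by (metis UNIV_I subsetD zero_less_numeral)
  have gd: "good x" for x unfolding good_def using \<alpha>2 by simp
  have id: "(ell_vol (hess f x1) 2)\<^sup>2 * (f x2 + \<kappa> - (grad f x2 \<bullet> X2) / 2) = (ell_vol (hess f x2) 2)\<^sup>2 * (f x1 + \<kappa> - (grad f x1 \<bullet> X1) / 2)"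
    if "\<kappa> \<in> interior S" "hess f x1 X1 = grad f x1" "hess f x2 X2 = grad f x2" for \<kappa> x1 X1 x2 X2
    using curvature_identity[OF S that(1) \<eta> D[OF that(1)] gd D[OF that(1)] gd that(2,3)] D[OF that(1), of x1] D[OF that(1), of x2]
    unfolding \<alpha>2 by (simp add: dom_def)
  have same: "f x1 - (grad f x1 \<bullet> X1) / 2 = f x2 - (grad f x2 \<bullet> X2) / 2"
    if "hess f x1 X1 = grad f x1" "hess f x2 X2 = grad f x2" for x1 X1 x2 X2
  proof -
    define V1 V2 where "V1 = (ell_vol (hess f x1) 2)\<^sup>2" and "V2 = (ell_vol (hess f x2) 2)\<^sup>2"
    define p1 p2 where "p1 = f x1 - (grad f x1 \<bullet> X1) / 2" and "p2 = f x2 - (grad f x2 \<bullet> X2) / 2"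
    have vp: "ell_vol (hess f x) 2 > 0" for x by (rule ell_vol_pos[OF pos_def_hess_f]) simp
    have V: "V1 > 0" unfolding V1_def by (rule zero_less_power[OF vp])
    have 1: "V1 * (p2 + k) = V2 * (p1 + k)" using id[OF k that] by (simp add: V1_def V2_def p1_def p2_def algebra_simps)
    have 2: "V1 * (p2 + k') = V2 * (p1 + k')" using id[OF k'(1) that] by (simp add: V1_def V2_def p1_def p2_def algebra_simps)
    have "(V1 - V2) * (k' - k) = 0" using 1 2 by (simp add: algebra_simps)
    then have "V1 = V2" using k'(2) by simp
    then have "p1 = p2" using 1 V by simp
    then show ?thesis by (simp add: p1_def p2_def)
  qed
  obtain X0 where X0: "hess f 0 X0 = grad f 0" using hess_f_solve by blast
  show thesis by (rule that) (rule same[OF _ X0])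
qed

end

section \<open>Third derivatives and uniform bounds on compact sets\<close>

lemma iter_partial_append: "iter_partial bs (iter_partial cs F) = iter_partial (bs @ cs) F"
  by (induction bs) auto

lemma smooth_on_iter_partial:
  "smooth_on W F \<Longrightarrow> set cs \<subseteq> Basis \<Longrightarrow> smooth_on W (iter_partial cs F)"
  unfolding smooth_on_def by (auto simp: iter_partial_append)

text \<open>The third derivative as a trilinear form. Built from the Hessians of the first partials,
  it inherits the symmetry in its first two arguments from them.\<close>

definition third :: "('a::euclidean_space \<Rightarrow> real) \<Rightarrow> 'a \<Rightarrow> 'a \<Rightarrow> 'a \<Rightarrow> 'a \<Rightarrow> real" where
  "third F x d u v = (\<Sum>b\<in>Basis. (v \<bullet> b) * (hess (iter_partial [b] F) x d \<bullet> u))"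

lemma hess_inner_eq:
  fixes F :: "'a::euclidean_space \<Rightarrow> real"
  assumes F: "smooth_on W F" and x: "x \<in> W"
  shows "hess F x u \<bullet> v = (\<Sum>b\<in>Basis. (v \<bullet> b) * (grad (iter_partial [b] F) x \<bullet> u))"
proof -
  have "((\<lambda>x. \<Sum>b\<in>Basis. iter_partial [b] F x *\<^sub>R b) has_derivative
      (\<lambda>u. \<Sum>b\<in>Basis. (grad (iter_partial [b] F) x \<bullet> u) *\<^sub>R b)) (at x)"
    by (intro has_derivative_sum has_derivative_scaleR_left has_derivative_grad
      smooth_on_iter_partial_differentiable[OF F _ x]) auto
  then have "hess F x = (\<lambda>u. \<Sum>b\<in>Basis. (grad (iter_partial [b] F) x \<bullet> u) *\<^sub>R b)"
    by (intro hess_unique) (simp add: grad_def[abs_def])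
  then show ?thesis by (simp add: inner_sum_left inner_commute[of v] mult.commute)
qed

lemma has_derivative_hess_inner:
  fixes F :: "'a::euclidean_space \<Rightarrow> real"
  assumes F: "smooth_on W F" and x: "x \<in> W"
  shows "((\<lambda>x. hess F x u \<bullet> v) has_derivative (\<lambda>d. third F x d u v)) (at x)"
proof -
  have W: "open W" using F by (simp add: smooth_on_def)
  have "((\<lambda>x. \<Sum>b\<in>Basis. (v \<bullet> b) * (grad (iter_partial [b] F) x \<bullet> u)) has_derivative (\<lambda>d. third F x d u v)) (at x)"
    unfolding third_def
    by (intro has_derivative_sum has_derivative_mult_right has_derivative_inner_left
      has_derivative_hess[OF smooth_on_iter_partial[OF F] x]) auto
  then show ?thesis
    by (rule has_derivative_transform_within_open[OF _ W x]) (simp add: hess_inner_eq[OF F])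
qed

text \<open>One transposition is the symmetry of the Hessians of the partials, the other arises by
  differentiating the symmetry of the Hessian of \<open>F\<close>.\<close>

lemma third_symmetric:
  fixes F :: "'a::euclidean_space \<Rightarrow> real"
  assumes F: "smooth_on W F" and x: "x \<in> W"
  shows "third F x d u v = third F x u d v" "third F x d u v = third F x d v u"
proof -
  show "third F x d u v = third F x u d v"
    unfolding third_def
    by (intro sum.cong refl arg_cong2[where f = "(*)"] hess_symmetric[OF smooth_on_iter_partial[OF F] x]) auto
  have W: "open W" using F by (simp add: smooth_on_def)
  have "((\<lambda>x. hess F x u \<bullet> v) has_derivative (\<lambda>d. third F x d v u)) (at x)"
    by (rule has_derivative_transform_within_open[OF has_derivative_hess_inner[OF F x] W x])
      (rule hess_symmetric[OF F])
  then have "(\<lambda>d. third F x d u v) = (\<lambda>d. third F x d v u)"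
    using has_derivative_hess_inner[OF F x] has_derivative_unique by blast
  then show "third F x d u v = third F x d v u" by (rule fun_cong)
qed

lemma third_linear:
  fixes F :: "'a::euclidean_space \<Rightarrow> real"
  assumes F: "smooth_on W F" and x: "x \<in> W"
  shows "linear (\<lambda>d. third F x d u v)" "linear (\<lambda>u. third F x d u v)" "linear (\<lambda>v. third F x d u v)"
proof -
  have 1: "linear (\<lambda>d. third F x d u v)" for u v using has_derivative_hess_inner[OF F x] has_derivative_linear by blast
  then show "linear (\<lambda>d. third F x d u v)" .
  have "(\<lambda>u. third F x d u v) = (\<lambda>u. third F x u d v)" by (rule ext) (rule third_symmetric(1)[OF F x])
  then show "linear (\<lambda>u. third F x d u v)" using 1 by simp
  show "linear (\<lambda>v. third F x d u v)"
    unfolding third_def by (rule linearI) (simp_all add: inner_add_left distrib_right sum.distrib sum_distrib_left mult.assoc)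
qed

lemma continuous_on_third:
  fixes F :: "'a::euclidean_space \<Rightarrow> real"
  assumes F: "smooth_on W F"
  shows "continuous_on W (\<lambda>x. third F x d u v)"
  unfolding third_def
  by (intro continuous_intros continuous_at_imp_continuous_on ballI continuous_sum continuous_mult continuous_const
      has_derivative_continuous[OF has_derivative_hess_inner[OF smooth_on_iter_partial[OF F]]]) auto

lemma third_bound:
  fixes F :: "'a::euclidean_space \<Rightarrow> real"
  assumes F: "smooth_on W F" and C: "compact C" "C \<subseteq> W"
  obtains K where "0 \<le> K" "\<And>x d u v. x \<in> C \<Longrightarrow> \<bar>third F x d u v\<bar> \<le> K * (norm d * norm u * norm v)"
proof -
  define K where "K x = (\<Sum>a\<in>Basis. \<Sum>b\<in>Basis. \<Sum>c\<in>Basis. \<bar>third F x a b c\<bar>)" for x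
  have cK: "continuous_on C K"
    unfolding K_def by (intro continuous_intros continuous_on_subset[OF continuous_on_third[OF F] C(2)])
  have "bounded (K ` C)" using compact_continuous_image[OF cK C(1)] compact_imp_bounded by blast
  then obtain B where B: "\<And>x. x \<in> C \<Longrightarrow> \<bar>K x\<bar> \<le> B" unfolding bounded_iff by auto
  have le: "\<bar>third F x d u v\<bar> \<le> K x * (norm d * norm u * norm v)" if "x \<in> C" for x d u v
  proof -
    have x: "x \<in> W" using that C by blast
    note L = third_linear[OF F x]
    have ex: "h z = (\<Sum>a\<in>Basis. (z \<bullet> a) * h a)" if "linear h" for h :: "'a \<Rightarrow> real" and z
    proof -
      have "h (\<Sum>a\<in>Basis. (z \<bullet> a) *\<^sub>R a) = (\<Sum>a\<in>Basis. (z \<bullet> a) * h a)"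
        by (simp add: linear_sum[OF that] linear_scale[OF that])
      then show ?thesis by (simp add: euclidean_representation)
    qed
    have "third F x d u v = (\<Sum>a\<in>Basis. \<Sum>b\<in>Basis. \<Sum>c\<in>Basis. (d \<bullet> a) * ((u \<bullet> b) * ((v \<bullet> c) * third F x a b c)))"
    proof -
      have e1: "third F x d u v = (\<Sum>a\<in>Basis. (d \<bullet> a) * third F x a u v)" by (rule ex[OF L(1)])
      have e2: "third F x a u v = (\<Sum>b\<in>Basis. (u \<bullet> b) * third F x a b v)" for a by (rule ex[OF L(2)])
      have e3: "third F x a b v = (\<Sum>c\<in>Basis. (v \<bullet> c) * third F x a b c)" for a b by (rule ex[OF L(3)])
      have "(\<Sum>a\<in>Basis. (d \<bullet> a) * (\<Sum>b\<in>Basis. (u \<bullet> b) * (\<Sum>c\<in>Basis. (v \<bullet> c) * third F x a b c))) = third F x d u v"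
        unfolding e3[symmetric] e2[symmetric] e1[symmetric] ..
      then show ?thesis by (simp only: sum_distrib_left)
    qed
    also have "\<bar>\<dots>\<bar> \<le> (\<Sum>a\<in>Basis. \<Sum>b\<in>Basis. \<Sum>c\<in>Basis. (norm d * norm u * norm v) * \<bar>third F x a b c\<bar>)"
    proof (intro order_trans[OF sum_abs] sum_mono)
      fix a b c :: 'a assume *: "a \<in> Basis" "b \<in> Basis" "c \<in> Basis"
      have "\<bar>d \<bullet> a\<bar> * (\<bar>u \<bullet> b\<bar> * \<bar>v \<bullet> c\<bar>) \<le> norm d * (norm u * norm v)"
        using * by (intro mult_mono Basis_le_norm) auto
      from mult_right_mono[OF this abs_ge_zero[of "third F x a b c"]] show "\<bar>(d \<bullet> a) * ((u \<bullet> b) * ((v \<bullet> c) * third F x a b c))\<bar> \<le> (norm d * norm u * norm v) * \<bar>third F x a b c\<bar>"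
        by (simp add: abs_mult mult_ac)
    qed
    also have "\<dots> = K x * (norm d * norm u * norm v)"
      by (simp add: K_def sum_distrib_left sum_distrib_right mult_ac)
    finally show ?thesis .
  qed
  show thesis
  proof (rule that[of "\<bar>B\<bar>"])
    fix x d u v :: 'a assume x: "x \<in> C"
    have "K x \<le> \<bar>B\<bar>" using B[OF x] by linarith
    then have "K x * (norm d * norm u * norm v) \<le> \<bar>B\<bar> * (norm d * norm u * norm v)"
      by (intro mult_right_mono mult_nonneg_nonneg) auto
    then show "\<bar>third F x d u v\<bar> \<le> \<bar>B\<bar> * (norm d * norm u * norm v)" using le[OF x, of d u v] by linarith
  qed simp
qed

text \<open>The minimum is taken over base point and unit direction together. Joint continuity is
  seen by expanding the form in the gradients of the first partials.\<close>

lemma hess_uniform_bound: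
  fixes F :: "'a::euclidean_space \<Rightarrow> real"
  assumes F: "smooth_on W F" and C: "compact C" "C \<subseteq> W" and pd: "\<And>x. x \<in> C \<Longrightarrow> pos_def (hess F x)"
  obtains c where "c > 0" "\<And>x u. x \<in> C \<Longrightarrow> c * (norm u)\<^sup>2 \<le> u \<bullet> hess F x u"
proof (cases "C = {}")
  case True then show thesis using that[of 1] by simp
next
  case False
  let ?S = "C \<times> sphere (0::'a) 1"
  obtain b :: 'a where "b \<in> Basis" using nonempty_Basis by blast
  then have "b \<in> sphere 0 1" by simp
  then have ne: "?S \<noteq> {}" using False by blast
  have eq: "u \<bullet> hess F x u = (\<Sum>b\<in>Basis. (u \<bullet> b) * (grad (iter_partial [b] F) x \<bullet> u))" if "x \<in> C" for x u
    using hess_inner_eq[OF F, of x u u] that C by (auto simp: inner_commute)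
  have cg: "continuous_on ?S (\<lambda>p. grad (iter_partial [b] F) (fst p))" if "b \<in> Basis" for b
    by (rule continuous_on_compose2[OF continuous_on_grad[OF smooth_on_iter_partial[OF F]]])
      (use that C in \<open>auto intro!: continuous_intros\<close>)
  have "continuous_on ?S (\<lambda>p. \<Sum>b\<in>Basis. (snd p \<bullet> b) * (grad (iter_partial [b] F) (fst p) \<bullet> snd p))"
    by (intro continuous_intros cg) auto
  then have "continuous_on ?S (\<lambda>p. snd p \<bullet> hess F (fst p) (snd p))"
    by (rule continuous_on_eq) (auto simp: eq)
  then obtain p where p: "p \<in> ?S" "\<And>q. q \<in> ?S \<Longrightarrow> snd p \<bullet> hess F (fst p) (snd p) \<le> snd q \<bullet> hess F (fst q) (snd q)"
    using continuous_attains_inf[OF compact_Times[OF C(1) compact_sphere] ne] by blast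
  define c where "c = snd p \<bullet> hess F (fst p) (snd p)"
  show thesis
  proof (rule that[of c])
    have "snd p \<noteq> 0" using p(1) by auto
    then show "c > 0" using pd[of "fst p"] p(1) unfolding c_def pos_def_def by (auto simp: mem_Times_iff)
    fix x u assume x: "x \<in> C"
    then have lin: "linear (hess F x)" using pd by (simp add: pos_def_def)
    show "c * (norm u)\<^sup>2 \<le> u \<bullet> hess F x u"
    proof (cases "u = 0")
      case False
      have "c \<le> (u /\<^sub>R norm u) \<bullet> hess F x (u /\<^sub>R norm u)"
        unfolding c_def using p(2)[of "(x, u /\<^sub>R norm u)"] x False by simp
      also have "\<dots> = (u \<bullet> hess F x u) / (norm u)\<^sup>2"
        using linear_scale[OF lin] by (simp add: power2_eq_square divide_simps)
      finally show ?thesis using False by (simp add: pos_le_divide_eq)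
    qed (simp add: linear_0[OF lin])
  qed
qed

lemma pos_def_Cauchy_Schwarz:
  fixes Q :: "'a::euclidean_space \<Rightarrow> 'a"
  assumes Q: "pos_def Q" and sym: "\<And>x y. Q x \<bullet> y = x \<bullet> Q y"
  shows "(u \<bullet> Q v)\<^sup>2 \<le> (u \<bullet> Q u) * (v \<bullet> Q v)"
proof (cases "v = 0")
  case True then show ?thesis using Q by (simp add: pos_def_def linear_0)
next
  case False
  have lin: "linear Q" using Q by (simp add: pos_def_def)
  have nn: "0 \<le> x \<bullet> Q x" for x using Q by (cases "x = 0") (auto simp: pos_def_def less_imp_le)
  have vp: "0 < v \<bullet> Q v" using Q False by (simp add: pos_def_def)
  define t where "t = (u \<bullet> Q v) / (v \<bullet> Q v)"
  have s: "v \<bullet> Q u = u \<bullet> Q v" using sym[of u v] by (simp add: inner_commute)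
  have "0 \<le> (u - t *\<^sub>R v) \<bullet> Q (u - t *\<^sub>R v)" by (rule nn)
  also have "\<dots> = u \<bullet> Q u - 2 * t * (u \<bullet> Q v) + t * (t * (v \<bullet> Q v))"
    by (simp add: linear_diff[OF lin] linear_scale[OF lin] inner_diff_left inner_diff_right s algebra_simps)
  also have "t * (v \<bullet> Q v) = u \<bullet> Q v" using vp by (simp add: t_def)
  finally have "t * (u \<bullet> Q v) \<le> u \<bullet> Q u" by simp
  then show ?thesis using vp by (simp add: t_def power2_eq_square field_simps)
qed

section \<open>The exponent two: quadratic functions\<close>

text \<open>The identity says that the square root of \<open>2 (f - m)\<close> has a degenerate Hessian in the direction of
  the Newton step \<open>X\<close>. Since the graph of this root is developable along Newton lines, the gradient of
  \<open>f\<close> is linear on them; they end in a critical point of \<open>f\<close>.\<close>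

locale newton_identity =
  fixes f :: "'a::euclidean_space \<Rightarrow> real" and m :: real
  assumes smooth: "smooth_on UNIV f" and pd: "\<And>x. pos_def (hess f x)"
    and newton: "\<And>x X. hess f x X = grad f x \<Longrightarrow> f x - (grad f x \<bullet> X) / 2 = m"
begin

lemma sym: "hess f x u \<bullet> v = u \<bullet> hess f x v"
  using hess_symmetric[OF smooth, of x u v] by (simp add: inner_commute)

lemma lin: "linear (hess f x)"
  using pd by (simp add: pos_def_def)

lemma solve: "\<exists>X. hess f x X = v"
proof -
  have "inj (hess f x)"
    using pd[of x] linear_injective_0[of "hess f x"] unfolding pos_def_def
    by (metis inner_zero_right less_irrefl)
  then have "surj (hess f x)" using lin linear_injective_imp_surjective by blast
  then show ?thesis by (metis surjD)
qed

text \<open>With \<open>X\<close> frozen, \<open>?\<Psi>\<close> is nonnegative everywhere by the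
  Cauchy-Schwarz inequality for the Hessian form, since \<open>2 * (f - m)\<close> is the squared
  Newton decrement. At \<open>x\<close> it vanishes, so its derivative is zero; the second-order
  terms cancel and the third derivative remains.\<close>

lemma third_vanishes:
  assumes X: "hess f x X = grad f x"
  shows "third f x X X w = 0"
proof (cases "X = 0")
  case True
  then show ?thesis using linear_0[OF third_linear(1)[OF smooth UNIV_I, of x X w]] by simp
next
  case False
  define b where "b = grad f x \<bullet> X"
  have XHX: "X \<bullet> hess f x X = b" unfolding X b_def by (simp add: inner_commute)
  have b: "b > 0" using pd[of x] False XHX by (auto simp: pos_def_def)
  have fm: "2 * (f x - m) = b" using newton[OF X] by (simp add: b_def field_simps)
  let ?\<Psi> = "\<lambda>x'. 2 * (f x' - m) * (hess f x' X \<bullet> X) - (grad f x' \<bullet> X) * (grad f x' \<bullet> X)"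
  have nonneg: "0 \<le> ?\<Psi> x'" for x'
  proof -
    obtain X' where X': "hess f x' X' = grad f x'" using solve by blast
    have "2 * (f x' - m) = X' \<bullet> hess f x' X'" using newton[OF X'] unfolding X' by (simp add: inner_commute field_simps)
    moreover have "grad f x' \<bullet> X = X \<bullet> hess f x' X'" unfolding X' by (rule inner_commute)
    ultimately show ?thesis
      using pos_def_Cauchy_Schwarz[OF pd sym, of X x' X'] by (simp add: power2_eq_square inner_commute mult.commute)
  qed
  have zero: "?\<Psi> x = 0" using fm XHX by (simp add: b_def inner_commute)
  have 1: "(f has_derivative (\<lambda>v. grad f x \<bullet> v)) (at x)"
    by (rule has_derivative_grad[OF smooth_on_differentiable[OF smooth]]) simp
  have 2: "((\<lambda>x'. 2 * (f x' - m)) has_derivative (\<lambda>v. 2 * (grad f x \<bullet> v - 0))) (at x)"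
    by (intro has_derivative_mult_right has_derivative_diff 1 has_derivative_const)
  have 3: "((\<lambda>x'. hess f x' X \<bullet> X) has_derivative (\<lambda>d. third f x d X X)) (at x)"
    by (rule has_derivative_hess_inner[OF smooth]) simp
  have 4: "((\<lambda>x'. grad f x' \<bullet> X) has_derivative (\<lambda>d. hess f x d \<bullet> X)) (at x)"
    by (intro has_derivative_inner_left has_derivative_hess[OF smooth]) simp
  have hd: "(?\<Psi> has_derivative (\<lambda>d. (2 * (f x - m) * third f x d X X + 2 * (grad f x \<bullet> d - 0) * (hess f x X \<bullet> X)) -
      ((grad f x \<bullet> X) * (hess f x d \<bullet> X) + (hess f x d \<bullet> X) * (grad f x \<bullet> X)))) (at x)" (is "(_ has_derivative ?\<Psi>') _")
    by (intro has_derivative_diff has_derivative_mult 2 3 4)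
  have "?\<Psi>' = (\<lambda>d. 0)"
    by (rule differential_zero_maxmin[OF UNIV_I open_UNIV hd]) (use nonneg zero in simp)
  then have "?\<Psi>' w = 0" by (rule fun_cong)
  moreover have "hess f x w \<bullet> X = grad f x \<bullet> w" unfolding sym X by (rule inner_commute)
  ultimately have "b * third f x w X X = 0"
    unfolding fm using XHX by (simp add: b_def inner_commute)
  then have "third f x w X X = 0" using b by simp
  then show ?thesis using third_symmetric[OF smooth UNIV_I] by metis
qed

text \<open>The defect \<open>e s\<close> vanishes exactly when \<open>s\<close> times
  \<open>X0\<close> solves the Newton equation at \<open>c s\<close>. By
  \<open>third_vanishes\<close> its derivative is bounded by a multiple of the defect itself, so
  starting from \<open>e 1 = 0\<close> a Gronwall argument keeps it zero back to every positive
  \<open>s\<close>.\<close>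

lemma grad_on_newton_line:
  assumes X0: "hess f x0 X0 = grad f x0" and s: "0 \<le> s" "s \<le> 1"
  shows "grad f (x0 + (s - 1) *\<^sub>R X0) = s *\<^sub>R grad f x0"
proof -
  define c where "c s = x0 + (s - 1) *\<^sub>R X0" for s
  define y where "y s = grad f (c s)" for s
  define q where "q s = hess f (c s) X0" for s
  define e where "e s = y s - s *\<^sub>R q s" for s
  have hc: "(c has_derivative (\<lambda>h. h *\<^sub>R X0)) (at s)" for s
    unfolding c_def by (auto intro!: derivative_eq_intros)
  have cc: "continuous_on A c" for A unfolding c_def by (intro continuous_intros)
  have dy: "((\<lambda>s. y s \<bullet> w) has_real_derivative q s \<bullet> w) (at s)" for s w
  proof -
    have "((\<lambda>s. y s \<bullet> w) has_derivative (\<lambda>h. hess f (c s) (h *\<^sub>R X0) \<bullet> w)) (at s)"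
      unfolding y_def by (intro has_derivative_inner_left has_derivative_compose[OF hc has_derivative_hess[OF smooth]]) simp
    then show ?thesis
      by (auto simp: has_field_derivative_def q_def linear_scale[OF lin] mult.commute elim!: has_derivative_eq_rhs)
  qed
  have dq: "((\<lambda>s. q s \<bullet> w) has_real_derivative third f (c s) X0 X0 w) (at s)" for s w
  proof -
    have "((\<lambda>s. q s \<bullet> w) has_derivative (\<lambda>h. third f (c s) (h *\<^sub>R X0) X0 w)) (at s)"
      unfolding q_def by (rule has_derivative_compose[OF hc has_derivative_hess_inner[OF smooth]]) simp
    then show ?thesis
      by (auto simp: has_field_derivative_def linear_scale[OF third_linear(1)[OF smooth UNIV_I]] mult.commute elim!: has_derivative_eq_rhs)
  qed
  have de: "((\<lambda>s. e s \<bullet> w) has_real_derivative - s * third f (c s) X0 X0 w) (at s)" for s w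
  proof -
    have "((\<lambda>s. y s \<bullet> w - s * (q s \<bullet> w)) has_real_derivative q s \<bullet> w - (1 * (q s \<bullet> w) + third f (c s) X0 X0 w * s)) (at s)"
      by (intro DERIV_diff DERIV_mult DERIV_ident dy dq)
    then show ?thesis by (simp add: e_def inner_diff_left mult.commute)
  qed
  define N where "N s = (\<Sum>b\<in>Basis. (e s \<bullet> b) * (e s \<bullet> b))" for s
  have N: "N s = e s \<bullet> e s" for s unfolding N_def by (rule euclidean_inner[symmetric])
  have dN: "(N has_real_derivative - 2 * s * third f (c s) X0 X0 (e s)) (at s)" for s
  proof -
    have "(N has_real_derivative (\<Sum>b\<in>Basis. (- s * third f (c s) X0 X0 b) * (e s \<bullet> b) + (- s * third f (c s) X0 X0 b) * (e s \<bullet> b))) (at s)"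
      unfolding N_def by (intro DERIV_sum DERIV_mult de)
    moreover have "third f (c s) X0 X0 (e s) = (\<Sum>b\<in>Basis. (e s \<bullet> b) * third f (c s) X0 X0 b)"
    proof -
      note L = third_linear(3)[OF smooth UNIV_I, of "c s" X0 X0]
      have "third f (c s) X0 X0 (e s) = third f (c s) X0 X0 (\<Sum>b\<in>Basis. (e s \<bullet> b) *\<^sub>R b)" by (simp add: euclidean_representation)
      also have "\<dots> = (\<Sum>b\<in>Basis. (e s \<bullet> b) * third f (c s) X0 X0 b)" by (simp add: linear_sum[OF L] linear_scale[OF L])
      finally show ?thesis .
    qed
    ultimately show ?thesis by (simp add: sum_distrib_left algebra_simps)
  qed
  let ?C = "c ` {0..1}"
  have C: "compact ?C" by (intro compact_continuous_image cc) simp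
  obtain K where K: "0 \<le> K" "\<And>x d u v. x \<in> ?C \<Longrightarrow> \<bar>third f x d u v\<bar> \<le> K * (norm d * norm u * norm v)"
    using third_bound[OF smooth C] by auto
  obtain \<nu> where \<nu>: "\<nu> > 0" "\<And>x u. x \<in> ?C \<Longrightarrow> \<nu> * (norm u)\<^sup>2 \<le> u \<bullet> hess f x u"
    using hess_uniform_bound[OF smooth C subset_UNIV pd] by blast
  have "continuous_on {0..1} N" by (intro continuous_at_imp_continuous_on ballI DERIV_isCont[OF dN])
  then have "bounded (N ` {0..1})" using compact_continuous_image compact_imp_bounded compact_Icc by blast
  then obtain E0 where "\<forall>y\<in>N ` {0..1}. norm y \<le> E0" unfolding bounded_iff by blast
  then have E0: "\<bar>N s\<bar> \<le> E0" if "s \<in> {0..1}" for s using that by auto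
  define E where "E = \<bar>E0\<bar> + 1"
  have eE: "norm (e s) \<le> E" if "s \<in> {0..1}" for s
  proof (rule power2_le_imp_le)
    have "(norm (e s))\<^sup>2 \<le> \<bar>E0\<bar>" using E0[OF that] by (simp add: N power2_norm_eq_inner)
    also have "\<dots> \<le> E\<^sup>2" by (simp add: E_def power2_eq_square algebra_simps)
    finally show "(norm (e s))\<^sup>2 \<le> E\<^sup>2" .
  qed (simp add: E_def)
  define B where "B = K / \<nu> * (2 * norm X0 + E / \<nu>)"
  have B: "B \<ge> 0" using K \<nu> by (simp add: B_def E_def)
  \<comment> \<open>The true Newton direction at \<open>c s\<close> is \<open>s\<close> times
    \<open>X0\<close> plus \<open>\<delta>\<close>, where \<open>\<delta>\<close> is controlled by
    the defect. Expanding the vanishing third derivative in this direction leaves only terms with a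
    factor \<open>\<delta>\<close>.\<close>
  have T: "s\<^sup>2 * \<bar>third f (c s) X0 X0 w\<bar> \<le> B * (norm (e s) * norm w)" if s: "0 < s" "s \<le> 1" for s w
  proof -
    have cs: "c s \<in> ?C" using s by auto
    obtain X where X: "hess f (c s) X = y s" using solve by blast
    define \<delta> where "\<delta> = X - s *\<^sub>R X0"
    have H\<delta>: "hess f (c s) \<delta> = e s"
      unfolding \<delta>_def linear_diff[OF lin] linear_scale[OF lin] X e_def q_def ..
    have "\<nu> * (norm \<delta>)\<^sup>2 \<le> norm \<delta> * norm (e s)"
      using \<nu>(2)[OF cs, of \<delta>] norm_cauchy_schwarz[of \<delta> "e s"] unfolding H\<delta> by linarith
    then have d1: "norm \<delta> \<le> norm (e s) / \<nu>"
      using \<nu>(1) by (cases "\<delta> = 0") (simp_all add: power2_eq_square pos_le_divide_eq mult.commute)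
    have d2: "norm \<delta> \<le> E / \<nu>" using d1 eE[of s] s \<nu>(1) by (meson atLeastAtMost_iff divide_right_mono less_imp_le order_trans)
    note L = third_linear[OF smooth UNIV_I]
    have "0 = third f (c s) (s *\<^sub>R X0 + \<delta>) (s *\<^sub>R X0 + \<delta>) w"
      using third_vanishes[of "c s" X w] X by (simp add: \<delta>_def y_def)
    also have "\<dots> = s\<^sup>2 * third f (c s) X0 X0 w + s * third f (c s) X0 \<delta> w + (s * third f (c s) \<delta> X0 w + third f (c s) \<delta> \<delta> w)"
      by (simp add: linear_add[OF L(1)] linear_add[OF L(2)] linear_scale[OF L(1)] linear_scale[OF L(2)] power2_eq_square algebra_simps)
    also have "third f (c s) X0 \<delta> w = third f (c s) \<delta> X0 w" by (rule third_symmetric[OF smooth UNIV_I])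
    finally have eq: "s\<^sup>2 * third f (c s) X0 X0 w = - (2 * s * third f (c s) \<delta> X0 w + third f (c s) \<delta> \<delta> w)" by simp
    have "s\<^sup>2 * \<bar>third f (c s) X0 X0 w\<bar> = \<bar>s\<^sup>2 * third f (c s) X0 X0 w\<bar>" by (simp add: abs_mult)
    also have "\<dots> \<le> 2 * s * \<bar>third f (c s) \<delta> X0 w\<bar> + \<bar>third f (c s) \<delta> \<delta> w\<bar>"
      unfolding eq abs_minus_cancel using abs_triangle_ineq[of "2 * s * third f (c s) \<delta> X0 w" "third f (c s) \<delta> \<delta> w"] s
      by (simp add: abs_mult)
    also have "\<dots> \<le> 2 * 1 * (K * (norm \<delta> * norm X0 * norm w)) + K * (norm \<delta> * norm \<delta> * norm w)"
      using s by (intro add_mono mult_mono K(2)[OF cs]) auto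
    also have "\<dots> = K * norm w * norm \<delta> * (2 * norm X0 + norm \<delta>)" by (simp add: algebra_simps)
    also have "\<dots> \<le> K * norm w * (norm (e s) / \<nu>) * (2 * norm X0 + E / \<nu>)"
      using K(1) \<nu>(1) by (intro mult_mono add_mono order_refl d1 d2 mult_nonneg_nonneg add_nonneg_nonneg) auto
    also have "\<dots> = B * (norm (e s) * norm w)" by (simp add: B_def mult_ac)
    finally show ?thesis .
  qed
  have e0: "e s = 0" if s0: "0 < s" "s \<le> 1" for s
  proof -
    \<comment> \<open>The Gronwall exponent on the interval from \<open>s\<close> to
      \<open>1\<close>. It blows up as \<open>s\<close> tends to \<open>0\<close>, so that the
      endpoint is reached only by continuity at the end.\<close>
    define A where "A = 2 * B / s"
    let ?g = "\<lambda>t. N t * exp (A * t)"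
    have "?g s \<le> ?g 1"
    proof (rule DERIV_nonneg_imp_nondecreasing[OF s0(2)])
      fix t assume t: "s \<le> t" "t \<le> 1"
      then have t0: "0 < t" using s0 by simp
      have d: "(?g has_real_derivative (- 2 * t * third f (c t) X0 X0 (e t)) * exp (A * t) + (exp (A * t) * (A * 1)) * N t) (at t)"
        by (intro DERIV_mult dN DERIV_fun_exp DERIV_cmult DERIV_ident)
      have "2 * t * third f (c t) X0 X0 (e t) \<le> A * N t"
      proof -
        have "t * (t * \<bar>third f (c t) X0 X0 (e t)\<bar>) \<le> B * N t"
          using T[OF t0 t(2), of "e t"] by (simp add: N power2_eq_square mult.assoc flip: power2_norm_eq_inner)
        then have "t * \<bar>third f (c t) X0 X0 (e t)\<bar> \<le> B * N t / t" using t0 by (simp add: pos_le_divide_eq mult.commute)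
        also have "\<dots> \<le> B * N t / s"
          using t s0 B by (intro divide_left_mono mult_nonneg_nonneg) (auto simp: N)
        finally have 1: "t * \<bar>third f (c t) X0 X0 (e t)\<bar> \<le> B * N t / s" .
        have "t * third f (c t) X0 X0 (e t) \<le> t * \<bar>third f (c t) X0 X0 (e t)\<bar>" using t0 by (intro mult_left_mono) auto
        then show ?thesis using 1 by (simp add: A_def)
      qed
      then have "0 \<le> exp (A * t) * (A * N t - 2 * t * third f (c t) X0 X0 (e t))" by simp
      then show "\<exists>y. (?g has_real_derivative y) (at t) \<and> 0 \<le> y"
        using d by (intro exI conjI) (auto simp: algebra_simps)
    qed
    moreover have "e 1 = 0" using X0 by (simp add: e_def y_def q_def c_def)
    ultimately have "N s * exp (A * s) \<le> 0" by (simp add: N)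
    then have "N s \<le> 0" by (simp add: mult_le_0_iff)
    then have "e s \<bullet> e s = 0" using inner_ge_zero[of "e s"] unfolding N by linarith
    then show ?thesis by simp
  qed
  have q1: "q s = grad f x0" if s0: "0 < s" "s \<le> 1" for s
  proof -
    have "q s \<bullet> w = q 1 \<bullet> w" for w
    proof (cases "s = 1")
      case False
      have "third f (c t) X0 X0 w = 0" if "s \<le> t" "t \<le> 1" for t
      proof -
        have "t\<^sup>2 * \<bar>third f (c t) X0 X0 w\<bar> \<le> 0" using T[of t w] e0[of t] that s0 by simp
        then show ?thesis using that s0 by (simp add: mult_le_0_iff)
      qed
      then have t0: "third f (c t) X0 X0 w = 0" if "s < t" "t < 1" for t using that by simp
      have "s < 1" using False s0 by simp
      from MVT2[OF this, of "\<lambda>s. q s \<bullet> w" "\<lambda>s. third f (c s) X0 X0 w", OF dq]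
      obtain z where z: "s < z" "z < 1" "q 1 \<bullet> w - q s \<bullet> w = (1 - s) * third f (c z) X0 X0 w" by blast
      show ?thesis using z(3) unfolding t0[OF z(1,2)] by simp
    qed simp
    then have "q s = q 1" by (metis inner_diff_left inner_eq_zero_iff right_minus_eq)
    then show ?thesis using X0 by (simp add: q_def c_def)
  qed
  have yes: "y s = s *\<^sub>R grad f x0" if "0 < s" "s \<le> 1" for s
    using e0[OF that] q1[OF that] by (simp add: e_def)
  have "y 0 = 0"
  proof -
    have cy: "continuous_on UNIV y"
      unfolding y_def by (rule continuous_on_compose2[OF continuous_on_grad[OF smooth] cc]) simp
    then have l: "(y \<longlongrightarrow> y 0) (at_right 0)"
      by (metis UNIV_I continuous_on_def tendsto_within_subset subset_UNIV)
    have "((\<lambda>s. s *\<^sub>R grad f x0) \<longlongrightarrow> 0 *\<^sub>R grad f x0) (at_right 0)" by (intro tendsto_intros)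
    moreover have "\<forall>\<^sub>F s in at_right 0. s *\<^sub>R grad f x0 = y s"
      using eventually_at_right_real[of 0 1] by (auto elim!: eventually_mono simp: yes)
    ultimately have "(y \<longlongrightarrow> 0) (at_right 0)" using tendsto_cong by fastforce
    then show ?thesis using l tendsto_unique[of "at_right (0::real)"] by (auto simp: trivial_limit_at_right_real)
  qed
  then have "y s = s *\<^sub>R grad f x0" using yes[of s] s by (cases "s = 0") auto
  then show ?thesis by (simp add: y_def c_def)
qed

text \<open>Newton lines end in critical points, and there is only one, because the gradient is
  strictly monotone. So every Newton line passes through \<open>x0\<close>, the gradient is
  homogeneous along rays from there, and its derivative at \<open>x0\<close> identifies it.\<close>

theorem quadratic:
  obtains x0 where "\<And>y. grad f (x0 + y) = hess f x0 y" "\<And>y. f (x0 + y) = m + (y \<bullet> hess f x0 y) / 2"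
proof -
  obtain X where X: "hess f 0 X = grad f 0" using solve by blast
  define x0 where "x0 = - X"
  have crit: "grad f (x - X) = 0" if "hess f x X = grad f x" for x X
    using grad_on_newton_line[OF that, of 0] by simp
  have z: "grad f x0 = 0" using crit[OF X] by (simp add: x0_def)
  have unique: "p = x0" if p: "grad f p = 0" for p
  proof (rule ccontr)
    assume ne: "p \<noteq> x0"
    let ?g = "\<lambda>t. grad f (x0 + t *\<^sub>R (p - x0)) \<bullet> (p - x0)"
    have "(?g has_real_derivative (p - x0) \<bullet> hess f (x0 + t *\<^sub>R (p - x0)) (p - x0)) (at t)" for t
    proof -
      have 1: "((\<lambda>t. x0 + t *\<^sub>R (p - x0)) has_derivative (\<lambda>h. h *\<^sub>R (p - x0))) (at t)"
        by (auto intro!: derivative_eq_intros)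
      have "(?g has_derivative (\<lambda>h. hess f (x0 + t *\<^sub>R (p - x0)) (h *\<^sub>R (p - x0)) \<bullet> (p - x0))) (at t)"
        by (intro has_derivative_inner_left has_derivative_compose[OF 1 has_derivative_hess[OF smooth]]) simp
      then show ?thesis
        by (auto simp: has_field_derivative_def linear_scale[OF lin] inner_commute mult.commute elim!: has_derivative_eq_rhs)
    qed
    then obtain t where "?g 1 - ?g 0 = (1 - 0) * ((p - x0) \<bullet> hess f (x0 + t *\<^sub>R (p - x0)) (p - x0))"
      using MVT2[of 0 1 ?g "\<lambda>t. (p - x0) \<bullet> hess f (x0 + t *\<^sub>R (p - x0)) (p - x0)"] by auto
    then have "(p - x0) \<bullet> hess f (x0 + t *\<^sub>R (p - x0)) (p - x0) = 0" using p z by simp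
    then show False using pd ne unfolding pos_def_def by (metis less_irrefl right_minus_eq)
  qed
  have step: "hess f (x0 + y) y = grad f (x0 + y)" for y
  proof -
    obtain X where X: "hess f (x0 + y) X = grad f (x0 + y)" using solve by blast
    have "x0 + y - X = x0" using unique[OF crit[OF X]] .
    then show ?thesis using X by (simp add: algebra_simps)
  qed
  have G: "grad f (x0 + y) = hess f x0 y" for y
  proof -
    have lin_y: "grad f (x0 + s *\<^sub>R y) = s *\<^sub>R grad f (x0 + y)" if "0 \<le> s" "s \<le> 1" for s
      using grad_on_newton_line[OF step that, of y] by (simp add: algebra_simps)
    have 1: "((\<lambda>s. x0 + s *\<^sub>R y) has_derivative (\<lambda>h. h *\<^sub>R y)) (at 0)"
      by (auto intro!: derivative_eq_intros)
    have "(grad f has_derivative hess f x0) (at (x0 + 0 *\<^sub>R y))"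
      using has_derivative_hess[OF smooth, of x0] by simp
    from has_derivative_compose[OF 1 this]
    have "((\<lambda>s. grad f (x0 + s *\<^sub>R y)) has_vector_derivative hess f x0 y) (at 0)"
      by (simp add: has_vector_derivative_def linear_scale[OF lin])
    then have "((\<lambda>s. grad f (x0 + s *\<^sub>R y)) has_vector_derivative hess f x0 y) (at 0 within {0..1})"
      by (rule has_vector_derivative_at_within)
    moreover have "((\<lambda>s. grad f (x0 + s *\<^sub>R y)) has_vector_derivative grad f (x0 + y)) (at 0 within {0..1})"
    proof (rule has_vector_derivative_transform[where f = "\<lambda>s. s *\<^sub>R grad f (x0 + y)"])
      show "((\<lambda>s. s *\<^sub>R grad f (x0 + y)) has_vector_derivative grad f (x0 + y)) (at 0 within {0..1})"
        by (auto intro!: derivative_eq_intros)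
    qed (use lin_y in auto)
    ultimately show ?thesis
      using vector_derivative_unique_within_closed_interval[of 0 1 0] by (metis atLeastAtMost_iff cbox_interval order_refl zero_le_one zero_less_one)
  qed
  have "f (x0 + y) = m + (y \<bullet> hess f x0 y) / 2" for y
    using newton[OF step[of y]] unfolding G by (simp add: inner_commute)
  then show thesis using that G by blast
qed

end

section \<open>The exponent two: hyperboloids\<close>

text \<open>A maximizer of the Rayleigh quotient is an eigenvector. The normalization gives
  \<open>a \<bullet> Q a = 2\<close>, so that half the form along \<open>a\<close> is the square of
  the coordinate and the levels over this line are hyperbolas with unit asymptotic slope.\<close>

lemma pos_def_eigenvector:
  fixes Q :: "'a::euclidean_space \<Rightarrow> 'a"
  assumes Q: "pos_def Q" and sym: "\<And>x y. Q x \<bullet> y = x \<bullet> Q y"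
  obtains a \<mu> where "\<mu> > 0" "Q a = \<mu> *\<^sub>R a" "a \<bullet> a = 2 / \<mu>"
proof -
  have lin: "linear Q" using Q by (simp add: pos_def_def)
  obtain b :: 'a where "b \<in> Basis" using nonempty_Basis by blast
  then have "b \<in> sphere 0 1" by simp
  then have ne: "sphere (0::'a) 1 \<noteq> {}" by blast
  obtain u where u: "u \<in> sphere (0::'a) 1" "\<And>y. y \<in> sphere 0 1 \<Longrightarrow> y \<bullet> Q y \<le> u \<bullet> Q u"
    using continuous_attains_sup[OF compact_sphere ne continuous_on_quadratic[OF lin]] by blast
  define \<mu> where "\<mu> = u \<bullet> Q u"
  have uu: "u \<bullet> u = 1" using u(1) by (simp add: norm_eq_1)
  then have "u \<noteq> 0" by auto
  then have \<mu>: "\<mu> > 0" using Q by (simp add: \<mu>_def pos_def_def)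
  let ?h = "\<lambda>y. y \<bullet> Q y - \<mu> * (y \<bullet> y)"
  have le: "?h y \<le> 0" for y
  proof (cases "y = 0")
    case False
    have "(y /\<^sub>R norm y) \<bullet> Q (y /\<^sub>R norm y) \<le> \<mu>" unfolding \<mu>_def by (rule u(2)) (use False in simp)
    moreover have "(y /\<^sub>R norm y) \<bullet> Q (y /\<^sub>R norm y) = (y \<bullet> Q y) / (y \<bullet> y)"
      using linear_scale[OF lin] by (simp add: power2_eq_square divide_simps flip: power2_norm_eq_inner)
    ultimately show ?thesis using False by (simp add: pos_divide_le_eq)
  qed (simp add: linear_0[OF lin])
  have bl: "bounded_linear Q" using lin by (simp add: linear_conv_bounded_linear)
  have hd: "(?h has_derivative (\<lambda>v. (u \<bullet> Q v + v \<bullet> Q u) - \<mu> * (u \<bullet> v + v \<bullet> u))) (at u)"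
    by (intro has_derivative_diff has_derivative_inner has_derivative_mult_right has_derivative_ident
      bounded_linear_imp_has_derivative[OF bl])
  have "(\<lambda>v. (u \<bullet> Q v + v \<bullet> Q u) - \<mu> * (u \<bullet> v + v \<bullet> u)) = (\<lambda>v. 0)"
    by (rule differential_zero_maxmin[OF UNIV_I open_UNIV hd]) (use le uu in \<open>simp add: \<mu>_def\<close>)
  then have "(u \<bullet> Q v + v \<bullet> Q u) - \<mu> * (u \<bullet> v + v \<bullet> u) = 0" for v by (rule fun_cong)
  then have "(Q u - \<mu> *\<^sub>R u) \<bullet> v = 0" for v
  proof -
    assume "\<And>v. (u \<bullet> Q v + v \<bullet> Q u) - \<mu> * (u \<bullet> v + v \<bullet> u) = 0"
    moreover have "u \<bullet> Q v = Q u \<bullet> v" "v \<bullet> Q u = Q u \<bullet> v" "v \<bullet> u = u \<bullet> v" using sym[of u v] by (simp_all add: inner_commute)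
    ultimately have "2 * (Q u \<bullet> v) - \<mu> * (2 * (u \<bullet> v)) = 0" by (metis mult_2)
    then show ?thesis by (simp add: inner_diff_left)
  qed
  then have "Q u - \<mu> *\<^sub>R u = 0" using inner_eq_zero_iff by blast
  then have Qu: "Q u = \<mu> *\<^sub>R u" by simp
  show thesis
  proof (rule that[of \<mu> "sqrt (2 / \<mu>) *\<^sub>R u"])
    show "Q (sqrt (2 / \<mu>) *\<^sub>R u) = \<mu> *\<^sub>R sqrt (2 / \<mu>) *\<^sub>R u" unfolding linear_scale[OF lin] Qu by simp
    show "sqrt (2 / \<mu>) *\<^sub>R u \<bullet> sqrt (2 / \<mu>) *\<^sub>R u = 2 / \<mu>" using \<mu> uu by simp
  qed (rule \<mu>)
qed

text \<open>Squaring leaves \<open>sqrt (A^2 - B^2)\<close>, which is at most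
  \<open>A - B^2 / (2 * A)\<close>.\<close>

lemma sqrt_sum_less:
  fixes A B C :: real
  assumes "A > 0" "B\<^sup>2 \<le> A\<^sup>2" "4 * A - B\<^sup>2 / A < C"
  shows "sqrt (A + B) + sqrt (A - B) < sqrt C"
proof -
  have AB: "\<bar>B\<bar> \<le> A" using assms(1,2) by (metis abs_le_square_iff abs_of_pos)
  have nn: "0 \<le> A + B" "0 \<le> A - B" using AB by linarith+
  have "(A + B) * (A - B) = A\<^sup>2 - B\<^sup>2" by (simp add: power2_eq_square algebra_simps)
  also have "\<dots> \<le> (A - B\<^sup>2 / (2 * A))\<^sup>2"
  proof -
    have "(A - B\<^sup>2 / (2 * A))\<^sup>2 = A\<^sup>2 - B\<^sup>2 + (B\<^sup>2 / (2 * A))\<^sup>2"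
      using assms(1) by (simp add: power2_diff)
    then show ?thesis by simp
  qed
  finally have "sqrt ((A + B) * (A - B)) \<le> \<bar>A - B\<^sup>2 / (2 * A)\<bar>"
    using real_sqrt_le_mono real_sqrt_abs by metis
  also have "\<bar>A - B\<^sup>2 / (2 * A)\<bar> = A - B\<^sup>2 / (2 * A)"
  proof -
    have "B\<^sup>2 \<le> A * (2 * A)" using assms(2) mult_pos_pos[OF assms(1) assms(1)] by (simp add: power2_eq_square)
    then show ?thesis using assms(1) by (simp add: pos_divide_le_eq)
  qed
  finally have s: "sqrt (A + B) * sqrt (A - B) \<le> A - B\<^sup>2 / (2 * A)" by (simp add: real_sqrt_mult)
  have "(sqrt (A + B) + sqrt (A - B))\<^sup>2 = 2 * A + 2 * (sqrt (A + B) * sqrt (A - B))"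
    using nn by (simp add: power2_sum)
  also have "\<dots> \<le> 4 * A - B\<^sup>2 / A" using s assms(1) by (simp add: field_simps)
  finally have "(sqrt (A + B) + sqrt (A - B))\<^sup>2 < C" using assms(3) by simp
  then show ?thesis by (rule real_less_rsqrt)
qed

text \<open>Adding the values for \<open>l\<close> and \<open>- l\<close> removes the odd part
  \<open>B\<close>. At \<open>l = b = 0\<close> both sides agree; for small nonzero data the right
  side gains, because \<open>D > 4\<close> for a proper boost.\<close>

lemma boost_inequality:
  fixes \<mu> \<kappa> c s :: real
  assumes pos: "\<mu> > 0" "\<kappa> > 0" "s > 0" and cs: "c\<^sup>2 = 1 + s\<^sup>2"
  shows "\<exists>t0>0. \<forall>l b z. 0 < l\<^sup>2 + b \<and> 0 \<le> b \<and> l\<^sup>2 + b < t0 \<and> \<kappa> \<le> z\<^sup>2 \<longrightarrow>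
    sqrt (2 * \<mu> * (c * l + s * z)\<^sup>2 + b + 4 * (c * z + s * l)\<^sup>2) + sqrt (2 * \<mu> * (c * (- l) + s * z)\<^sup>2 + b + 4 * (c * z + s * (- l))\<^sup>2)
      < sqrt ((2 * \<mu> * s\<^sup>2 + 4 * c\<^sup>2) * (2 * \<mu> * l\<^sup>2 + b + 4 * z\<^sup>2))"
proof -
  define D where "D = 2 * \<mu> * s\<^sup>2 + 4 * c\<^sup>2"
  define E where "E = 2 * \<mu> * c\<^sup>2 + 4 * s\<^sup>2"
  \<comment> \<open>The smaller of the coefficients of \<open>z^2 * l^2\<close> and
    \<open>z^2 * b\<close> in the gain of the right side.\<close>
  define \<delta> where "\<delta> = min (2 * \<mu> * (D\<^sup>2 - 16)) (D * (D - 4))"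
  define K where "K = max E 1"
  have D4: "D > 4" unfolding D_def cs using pos by (simp add: algebra_simps add_pos_pos)
  have D16: "D\<^sup>2 > 16" using power_strict_mono[of 4 D 2] D4 by simp
  have E0: "E > 0" unfolding E_def cs using pos by (simp add: add_pos_pos)
  have \<delta>: "\<delta> > 0" using D4 D16 pos by (simp add: \<delta>_def)
  have K: "K \<ge> 1" "K \<ge> E" by (auto simp: K_def)
  \<comment> \<open>The difference is \<open>8 * \<mu> * (c^2 - s^2)^2\<close>, and \<open>c\<close>
    and \<open>s\<close> lie on the unit hyperbola. This cancels the large mixed terms of
    \<open>D * E\<close> against those of \<open>B^2\<close>.\<close>
  have DE: "D * E - 4 * (\<mu> + 2)\<^sup>2 * (c\<^sup>2 * s\<^sup>2) = 8 * \<mu>"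
    unfolding D_def E_def cs by (simp add: power2_eq_square algebra_simps)
  \<comment> \<open>Chosen so that the quadratic error \<open>4 * q^2\<close>, with
    \<open>q \<le> K * (l^2 + b)\<close>, stays below the gain, which is linear in
    \<open>l^2 + b\<close>.\<close>
  define t0 where "t0 = \<kappa> * \<delta> / (4 * K\<^sup>2)"
  have t0: "t0 > 0" using pos \<delta> K by (simp add: t0_def)
  have "sqrt (2 * \<mu> * (c * l + s * z)\<^sup>2 + b + 4 * (c * z + s * l)\<^sup>2) + sqrt (2 * \<mu> * (c * (- l) + s * z)\<^sup>2 + b + 4 * (c * z + s * (- l))\<^sup>2)
      < sqrt (D * (2 * \<mu> * l\<^sup>2 + b + 4 * z\<^sup>2))"
    if t: "0 < l\<^sup>2 + b" "0 \<le> b" "l\<^sup>2 + b < t0" "\<kappa> \<le> z\<^sup>2" for l b z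
  proof -
    define A where "A = D * z\<^sup>2 + (E * l\<^sup>2 + b)"
    define B where "B = (4 * \<mu> + 8) * c * s * l * z"
    have pl: "2 * \<mu> * (c * l + s * z)\<^sup>2 + b + 4 * (c * z + s * l)\<^sup>2 = A + B"
      and mi: "2 * \<mu> * (c * (- l) + s * z)\<^sup>2 + b + 4 * (c * z + s * (- l))\<^sup>2 = A - B"
      by (simp_all add: A_def B_def D_def E_def power2_eq_square algebra_simps)
    have z: "z\<^sup>2 > 0" using t(4) pos by linarith
    have A: "A > 0" unfolding A_def using D4 z E0 t by (intro add_pos_nonneg mult_pos_pos) auto
    have "0 \<le> A + B" "0 \<le> A - B" unfolding pl[symmetric] mi[symmetric] using pos t by auto
    then have "\<bar>B\<bar> \<le> \<bar>A\<bar>" by linarith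
    then have BA: "B\<^sup>2 \<le> A\<^sup>2" by (simp add: abs_le_square_iff)
    have B2: "B\<^sup>2 = 4 * (4 * (\<mu> + 2)\<^sup>2 * (c\<^sup>2 * s\<^sup>2)) * (l\<^sup>2 * z\<^sup>2)"
      by (simp add: B_def power2_eq_square algebra_simps)
    have "4 * A - B\<^sup>2 / A < D * (2 * \<mu> * l\<^sup>2 + b + 4 * z\<^sup>2)"
    proof -
      define q where "q = E * l\<^sup>2 + b"
      define T where "T = l\<^sup>2 + b"
      have q0: "0 \<le> q" using E0 t by (simp add: q_def)
      have "q \<le> K * T" unfolding q_def T_def distrib_left
        using K t mult_right_mono[OF K(1) t(2)] by (intro add_mono mult_right_mono) auto
      then have "q\<^sup>2 \<le> (K * T)\<^sup>2" using q0 by (rule power_mono)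
      then have "4 * q\<^sup>2 \<le> 4 * K\<^sup>2 * T * T" by (simp add: power2_eq_square mult_ac)
      also have "\<dots> < \<kappa> * \<delta> * T"
      proof -
        have "T * (4 * K\<^sup>2) < \<kappa> * \<delta>" using t(3) K unfolding t0_def T_def by (simp add: pos_less_divide_eq)
        then show ?thesis using t(1) mult_strict_right_mono[of "T * (4 * K\<^sup>2)" "\<kappa> * \<delta>" T] by (simp add: T_def mult_ac)
      qed
      also have "\<dots> \<le> z\<^sup>2 * (2 * \<mu> * (D\<^sup>2 - 16) * l\<^sup>2 + D * (D - 4) * b)"
      proof -
        have "\<delta> * T \<le> 2 * \<mu> * (D\<^sup>2 - 16) * l\<^sup>2 + D * (D - 4) * b"
          unfolding T_def distrib_left using t by (intro add_mono mult_right_mono) (auto simp: \<delta>_def)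
        then have "\<kappa> * (\<delta> * T) \<le> z\<^sup>2 * (2 * \<mu> * (D\<^sup>2 - 16) * l\<^sup>2 + D * (D - 4) * b)"
          using t pos \<delta> by (intro mult_mono) (auto simp: T_def)
        then show ?thesis by (simp add: mult.assoc)
      qed
      finally have 1: "4 * q\<^sup>2 < z\<^sup>2 * (2 * \<mu> * (D\<^sup>2 - 16) * l\<^sup>2 + D * (D - 4) * b)" .
      have 2: "0 \<le> D * (2 * \<mu> * l\<^sup>2 + b) * q" using D4 pos t q0 by simp
      have "4 * A * A - B\<^sup>2 = 4 * D * z\<^sup>2 * A + 4 * q * A - B\<^sup>2" by (simp add: A_def q_def algebra_simps)
      also have "\<dots> = 4 * D * z\<^sup>2 * A + z\<^sup>2 * (4 * l\<^sup>2 * (D * E - 4 * (\<mu> + 2)\<^sup>2 * (c\<^sup>2 * s\<^sup>2)) + 4 * D * b) + 4 * q\<^sup>2"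
        unfolding B2 by (simp add: A_def q_def power2_eq_square algebra_simps)
      also have "\<dots> = 4 * D * z\<^sup>2 * A + z\<^sup>2 * (32 * \<mu> * l\<^sup>2 + 4 * D * b) + 4 * q\<^sup>2"
        unfolding DE by (simp add: algebra_simps)
      also have "\<dots> < 4 * D * z\<^sup>2 * A + z\<^sup>2 * (32 * \<mu> * l\<^sup>2 + 4 * D * b) + z\<^sup>2 * (2 * \<mu> * (D\<^sup>2 - 16) * l\<^sup>2 + D * (D - 4) * b) + D * (2 * \<mu> * l\<^sup>2 + b) * q"
        using 1 2 by linarith
      also have "\<dots> = D * (2 * \<mu> * l\<^sup>2 + b + 4 * z\<^sup>2) * A"
        by (simp add: A_def q_def power2_eq_square algebra_simps)
      finally have "(4 * A - B\<^sup>2 / A) * A < D * (2 * \<mu> * l\<^sup>2 + b + 4 * z\<^sup>2) * A"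
        using A by (simp add: left_diff_distrib)
      then show ?thesis using A by simp
    qed
    then show ?thesis unfolding pl mi by (rule sqrt_sum_less[OF A BA])
  qed
  then show ?thesis using t0 unfolding D_def by blast
qed

locale hyperboloid_levels = power_levels f \<alpha> g
  for f :: "real^'n \<Rightarrow> real" and \<alpha> :: real and g +
  fixes x0 a :: "real^'n" and m \<mu> k :: real
  assumes \<alpha>2: "\<alpha> = 2"
    and grad_quadratic: "\<And>y. grad f (x0 + y) = hess f x0 y"
    and quadratic: "\<And>y. f (x0 + y) = m + (y \<bullet> hess f x0 y) / 2"
    and \<mu>: "\<mu> > 0" and eigen: "hess f x0 a = \<mu> *\<^sub>R a" and aa: "a \<bullet> a = 2 / \<mu>"
    and sc: "strictly_convex_hypersurface (M k)"
begin

abbreviation "Q \<equiv> hess f x0"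

definition "\<kappa> = m + k"

text \<open>In coordinates centred at \<open>x0\<close>, \<open>z\<close> is the height of the
  level, \<open>l\<close> the coordinate along \<open>a\<close>, and \<open>b\<close> the squared
  length of the part of the gradient of \<open>f\<close> orthogonal to \<open>a\<close>.\<close>

definition z :: "real^'n \<Rightarrow> real" where "z y = sqrt ((y \<bullet> Q y) / 2 + \<kappa>)"

definition l :: "real^'n \<Rightarrow> real" where "l y = (a \<bullet> Q y) / 2"

definition b :: "real^'n \<Rightarrow> real" where "b y = (norm (Q (y - l y *\<^sub>R a)))\<^sup>2"

lemma linQ: "linear Q" and posQ: "u \<noteq> 0 \<Longrightarrow> 0 < u \<bullet> Q u" and symQ: "Q u \<bullet> v = u \<bullet> Q v"
  using pos_def_hess_f[of x0] hess_f_symmetric[of x0] by (auto simp: pos_def_def)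

lemma nonnegQ: "0 \<le> u \<bullet> Q u"
  using posQ[of u] by (cases "u = 0") auto

lemma dom_UNIV: "dom k = UNIV"
  by (rule dom_eq_UNIV[OF sc]) (simp add: \<alpha>2)

lemma \<kappa>_pos: "\<kappa> > 0"
proof -
  have "x0 + 0 \<in> dom k" using dom_UNIV by blast
  then show ?thesis unfolding dom_def using quadratic[of 0] by (simp add: \<kappa>_def)
qed

lemma z_sq: "(z y)\<^sup>2 = (y \<bullet> Q y) / 2 + \<kappa>" and z_pos: "z y > 0"
  using nonnegQ[of y] \<kappa>_pos by (auto simp: z_def add_nonneg_pos)

lemma exponents: "1 / \<alpha> = 1 / 2" "1 / \<alpha> - 1 = - (1 / 2)" "1 - 1 / \<alpha> = 1 / 2" "\<bar>\<alpha>\<bar> = 2"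
  using \<alpha>2 by simp_all

lemma height_sqrt: "0 \<le> f x + k' \<Longrightarrow> height k' x = sqrt (f x + k')"
  unfolding height_def exponents(1) by (rule powr_half_sqrt)

lemma f_k: "f (x0 + y) + k = (z y)\<^sup>2"
  unfolding z_sq quadratic \<kappa>_def by simp

lemma height_eq: "height k (x0 + y) = z y"
  using height_sqrt[of "x0 + y" k] z_pos[of y] unfolding f_k by simp

lemma grad_height_eq:
  assumes "f (x0 + y) + k' > 0"
  shows "grad (height k') (x0 + y) = (1 / (2 * sqrt (f (x0 + y) + k'))) *\<^sub>R Q y"
proof -
  have "(f (x0 + y) + k') powr - (1 / 2) = 1 / sqrt (f (x0 + y) + k')"
    unfolding powr_minus inverse_eq_divide using assms by (simp only: powr_half_sqrt less_imp_le)
  moreover have "x0 + y \<in> dom k'" using assms by (simp add: dom_def)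
  ultimately show ?thesis
    using grad_height[of "x0 + y" k'] unfolding exponents(2) exponents(1) grad_quadratic by simp
qed

lemma grad_height_k: "grad (height k) (x0 + y) = (1 / (2 * z y)) *\<^sub>R Q y"
  using grad_height_eq[of y k] z_pos[of y] unfolding f_k by simp

lemma l_linear: "l (u + v) = l u + l v" "l (c *\<^sub>R u) = c * l u" "l a = 1"
  using \<mu> by (simp_all add: l_def linear_add[OF linQ] linear_scale[OF linQ] inner_add_right add_divide_distrib eigen aa)

lemma Qa: "a \<bullet> Q y = 2 * l y" "y \<bullet> Q a = 2 * l y"
  using symQ[of a y] by (simp_all add: l_def inner_commute)

lemma add_a_quadratic: "(y + t *\<^sub>R a) \<bullet> Q (y + t *\<^sub>R a) = y \<bullet> Q y + 4 * t * l y + 2 * t\<^sup>2"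
proof -
  have "a \<bullet> Q a = 2" using Qa(1)[of a] l_linear(3) by simp
  then show ?thesis
    by (simp add: linear_add[OF linQ] linear_scale[OF linQ] inner_add_left inner_add_right Qa l_linear power2_eq_square algebra_simps)
qed

text \<open>Removing the component along \<open>a\<close> leaves a nonnegative value of the form.
  Geometrically, the level lies inside the light cone of its centre, which keeps boosted heights
  positive.\<close>

lemma l_less_z: "\<bar>l y\<bar> < z y"
proof -
  have "0 \<le> (y + (- l y) *\<^sub>R a) \<bullet> Q (y + (- l y) *\<^sub>R a)" by (rule nonnegQ)
  also have "\<dots> = y \<bullet> Q y - 2 * (l y)\<^sup>2" unfolding add_a_quadratic by (simp add: power2_eq_square)
  finally have "(l y)\<^sup>2 < (z y)\<^sup>2" using \<kappa>_pos unfolding z_sq by simp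
  then show ?thesis using z_pos[of y] power2_less_imp_less[of "\<bar>l y\<bar>" "z y"] by simp
qed

text \<open>The norm of the gradient of \<open>g\<close> at the boosted point: its square is
  \<open>norm (Q y)^2 + 4 * z^2\<close> with the boosted coordinates inserted.\<close>

definition N :: "real \<Rightarrow> real \<Rightarrow> real^'n \<Rightarrow> real" where
  "N c s y = sqrt (2 * \<mu> * (c * l y + s * z y)\<^sup>2 + b y + 4 * (c * z y + s * l y)\<^sup>2)"

lemma norm_Q_sq: "(norm (Q y))\<^sup>2 = 2 * \<mu> * (l y)\<^sup>2 + b y"
proof -
  define v where "v = y - l y *\<^sub>R a"
  have "l v = 0" using l_linear(1)[of v "l y *\<^sub>R a"] l_linear(2,3) by (simp add: v_def)
  then have av: "a \<bullet> Q v = 0" by (simp add: Qa)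
  have "Q y = (l y * \<mu>) *\<^sub>R a + Q v"
    unfolding v_def linear_diff[OF linQ] linear_scale[OF linQ] eigen by simp
  then have "Q y \<bullet> Q y = (l y * \<mu>)\<^sup>2 * (a \<bullet> a) + Q v \<bullet> Q v"
    using av by (simp add: inner_add_left inner_add_right inner_commute power2_eq_square)
  then show ?thesis using \<mu> unfolding b_def v_def[symmetric] power2_norm_eq_inner
    by (simp add: aa power2_eq_square)
qed

text \<open>The Lorentz boost in the direction \<open>a\<close>, in the coordinates of the graph. It maps the cap at the
  vertex to the cap at the point over \<open>p c s\<close>, and its Jacobian cancels the denominator of the area
  element.\<close>

definition boost :: "real \<Rightarrow> real \<Rightarrow> real^'n \<Rightarrow> real^'n" where
  "boost c s y = y + ((c - 1) * l y + s * z y) *\<^sub>R a"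

text \<open>Here \<open>c\<close> and \<open>s\<close> play the roles of hyperbolic cosine and sine:
  the pair \<open>(l, z)\<close> is rotated hyperbolically, \<open>z^2 - l^2\<close> is invariant,
  and the part of \<open>y\<close> transverse to \<open>a\<close> is fixed.\<close>

lemma boost:
  assumes cs: "c\<^sup>2 = 1 + s\<^sup>2" "c > 0"
  shows "l (boost c s y) = c * l y + s * z y" "z (boost c s y) = c * z y + s * l y"
    "0 < c * z y + s * l y" "boost c (- s) (boost c s y) = y" "b (boost c s y) = b y"
proof -
  show l: "l (boost c s y) = c * l y + s * z y" unfolding boost_def l_linear by (simp add: algebra_simps)
  have "s\<^sup>2 < c\<^sup>2" using cs by simp
  then have "\<bar>s\<bar> < c" using cs(2) power2_less_imp_less[of "\<bar>s\<bar>" c] by simp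
  then have "\<bar>s\<bar> * \<bar>l y\<bar> < c * z y" using l_less_z[of y] z_pos[of y] by (intro mult_strict_mono') auto
  then have "\<bar>s * l y\<bar> < c * z y" by (simp add: abs_mult)
  then show pos: "0 < c * z y + s * l y" by linarith
  have "(z (boost c s y))\<^sup>2 = (c * z y + s * l y)\<^sup>2"
  proof -
    define t where "t = (c - 1) * l y + s * z y"
    have "(z (boost c s y))\<^sup>2 = (z y)\<^sup>2 + 2 * t * l y + t\<^sup>2"
      unfolding z_sq boost_def t_def[symmetric] add_a_quadratic by (simp add: field_simps)
    also have "\<dots> = (z y)\<^sup>2 - (l y)\<^sup>2 + (c * l y + s * z y)\<^sup>2" by (simp add: t_def power2_eq_square algebra_simps)
    also have "\<dots> = (c * z y + s * l y)\<^sup>2 + (1 + s\<^sup>2 - c\<^sup>2) * ((z y)\<^sup>2 - (l y)\<^sup>2)" by (simp add: power2_eq_square algebra_simps)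
    finally show ?thesis using cs by simp
  qed
  then show z: "z (boost c s y) = c * z y + s * l y"
    using pos z_pos[of "boost c s y"] by (simp add: power2_eq_iff_nonneg less_imp_le)
  have "(c - 1) * l (boost c s y) + (- s) * z (boost c s y) = (c\<^sup>2 - c - s\<^sup>2) * l y - s * z y"
    unfolding l z by (simp add: power2_eq_square algebra_simps)
  also have "\<dots> = - ((c - 1) * l y + s * z y)" using cs by (simp add: algebra_simps)
  finally have e: "(c - 1) * l (boost c s y) + (- s) * z (boost c s y) = - ((c - 1) * l y + s * z y)" .
  show "boost c (- s) (boost c s y) = y"
    unfolding boost_def[of c "- s" "boost c s y"] e by (simp only: boost_def scaleR_minus_left) simp
  have "boost c s y - l (boost c s y) *\<^sub>R a = y - l y *\<^sub>R a"
    unfolding l by (simp add: boost_def algebra_simps)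
  then show "b (boost c s y) = b y" by (simp add: b_def)
qed

lemma has_derivative_boost:
  "(boost c s has_derivative (\<lambda>v. v + ((((c - 1) / 2) *\<^sub>R Q a + (s / (2 * z y)) *\<^sub>R Q y) \<bullet> v) *\<^sub>R a)) (at y)"
proof -
  have bl: "bounded_linear Q" using linQ by (simp add: linear_conv_bounded_linear)
  have hl: "(l has_derivative (\<lambda>v. (Q a \<bullet> v) / 2)) (at y)"
  proof -
    have "((\<lambda>y. (1 / 2) * (a \<bullet> Q y)) has_derivative (\<lambda>v. (1 / 2) * (a \<bullet> Q v))) (at y)"
      by (intro has_derivative_mult_right has_derivative_inner_right bounded_linear_imp_has_derivative[OF bl])
    then show ?thesis by (simp add: l_def[abs_def] symQ)
  qed
  have "((\<lambda>y. height k (x0 + y)) has_derivative (\<lambda>v. ((1 / (2 * z y)) *\<^sub>R Q y) \<bullet> v)) (at y)"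
  proof -
    have "x0 + y \<in> dom k" by (simp add: dom_UNIV)
    from has_derivative_grad[OF smooth_on_differentiable[OF smooth_height this]]
    have "(height k has_derivative (\<lambda>v. ((1 / (2 * z y)) *\<^sub>R Q y) \<bullet> v)) (at (x0 + y))" unfolding grad_height_k .
    moreover have "((\<lambda>y. x0 + y) has_derivative (\<lambda>v. v)) (at y)" by (auto intro!: derivative_eq_intros)
    ultimately show ?thesis by (rule has_derivative_compose[rotated])
  qed
  then have hz: "(z has_derivative (\<lambda>v. ((1 / (2 * z y)) *\<^sub>R Q y) \<bullet> v)) (at y)" unfolding height_eq by simp
  have "(boost c s has_derivative (\<lambda>v. v + ((c - 1) * ((Q a \<bullet> v) / 2) + s * (((1 / (2 * z y)) *\<^sub>R Q y) \<bullet> v)) *\<^sub>R a)) (at y)"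
    unfolding boost_def[abs_def]
    by (intro has_derivative_add has_derivative_ident has_derivative_scaleR_left has_derivative_mult_right hl hz)
  then show ?thesis by (rule has_derivative_eq_rhs) (simp add: fun_eq_iff inner_add_left)
qed

text \<open>The derivative is the identity plus a rank one term. The value says that Lebesgue
  measure divided by \<open>z\<close> is invariant under boosts.\<close>

lemma det_boost:
  assumes cs: "c\<^sup>2 = 1 + s\<^sup>2" "c > 0"
  shows "\<bar>det (matrix (\<lambda>v. v + ((((c - 1) / 2) *\<^sub>R Q a + (s / (2 * z y)) *\<^sub>R Q y) \<bullet> v) *\<^sub>R a))\<bar> = z (boost c s y) / z y"
proof -
  have "det (matrix (\<lambda>v. v + ((((c - 1) / 2) *\<^sub>R Q a + (s / (2 * z y)) *\<^sub>R Q y) \<bullet> v) *\<^sub>R a))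
    = 1 + a \<bullet> (((c - 1) / 2) *\<^sub>R Q a + (s / (2 * z y)) *\<^sub>R Q y)"
    by (rule det_matrix_rank_one)
  also have "\<dots> = (c * z y + s * l y) / z y"
    using z_pos[of y] by (simp add: inner_add_right Qa l_linear field_simps)
  finally show ?thesis using boost(2,3)[OF cs, of y] z_pos[of y] by simp
qed

text \<open>The image of the vertex, \<open>boost c s 0\<close>.\<close>

definition p :: "real \<Rightarrow> real^'n" where "p s = (sqrt \<kappa> * s) *\<^sub>R a"

lemma p_simps:
  assumes cs: "c\<^sup>2 = 1 + s\<^sup>2" "c > 0"
  shows "l (p s) = sqrt \<kappa> * s" "z (p s) = sqrt \<kappa> * c" "b (p s) = 0" "p s \<bullet> Q (p s) = 2 * \<kappa> * s\<^sup>2"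
proof -
  show l: "l (p s) = sqrt \<kappa> * s" by (simp add: p_def l_linear)
  show q: "p s \<bullet> Q (p s) = 2 * \<kappa> * s\<^sup>2"
    using add_a_quadratic[of 0 "sqrt \<kappa> * s"] \<kappa>_pos by (simp add: p_def linear_0[OF linQ] l_def power_mult_distrib)
  have "(z (p s))\<^sup>2 = (sqrt \<kappa> * c)\<^sup>2"
    unfolding z_sq q power_mult_distrib cs(1) using \<kappa>_pos by (simp add: algebra_simps)
  then show "z (p s) = sqrt \<kappa> * c" using z_pos[of "p s"] \<kappa>_pos cs(2) by (simp add: power2_eq_iff_nonneg less_imp_le)
  show "b (p s) = 0" unfolding b_def l by (simp add: p_def linear_0[OF linQ])
qed

text \<open>At the vertex, \<open>s = 0\<close> and \<open>c = 1\<close>, the value is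
  \<open>sqrt (\<kappa> * 4)\<close>. So half the square root of
  \<open>2 * \<mu> * s^2 + 4 * c^2\<close> is the ratio by which the condition makes cap areas
  differ.\<close>

lemma norm_grad_p:
  assumes cs: "c\<^sup>2 = 1 + s\<^sup>2" "c > 0"
  shows "norm (grad g (x0 + p s, height k (x0 + p s))) = sqrt (\<kappa> * (2 * \<mu> * s\<^sup>2 + 4 * c\<^sup>2))"
proof -
  have zp: "z (p s) > 0" by (rule z_pos)
  have "norm (grad g (x0 + p s, height k (x0 + p s))) = 2 * z (p s) * sqrt (1 + (norm (Q (p s)))\<^sup>2 / (4 * (z (p s))\<^sup>2))"
  proof -
    have "x0 + p s \<in> dom k" by (simp add: dom_UNIV)
    from norm_grad_g[OF this]
    have "norm (grad g (x0 + p s, height k (x0 + p s))) = 2 * ((z (p s))\<^sup>2) powr (1 / 2) * sqrt (1 + (norm ((1 / (2 * z (p s))) *\<^sub>R Q (p s)))\<^sup>2)"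
      unfolding exponents(3,4) f_k grad_height_k .
    moreover have "((z (p s))\<^sup>2) powr (1 / 2) = z (p s)" using zp by (subst powr_half_sqrt) auto
    moreover have "(norm ((1 / (2 * z (p s))) *\<^sub>R Q (p s)))\<^sup>2 = (norm (Q (p s)))\<^sup>2 / (4 * (z (p s))\<^sup>2)"
      by (simp add: power_divide power_mult_distrib)
    ultimately show ?thesis by simp
  qed
  also have "\<dots> = sqrt ((2 * z (p s))\<^sup>2 * (1 + (norm (Q (p s)))\<^sup>2 / (4 * (z (p s))\<^sup>2)))"
    using zp by (simp add: real_sqrt_mult)
  also have "(2 * z (p s))\<^sup>2 * (1 + (norm (Q (p s)))\<^sup>2 / (4 * (z (p s))\<^sup>2)) = (norm (Q (p s)))\<^sup>2 + 4 * (z (p s))\<^sup>2"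
    using zp by (simp add: field_simps power2_eq_square)
  also have "\<dots> = \<kappa> * (2 * \<mu> * s\<^sup>2 + 4 * c\<^sup>2)"
    unfolding norm_Q_sq p_simps[OF cs] power_mult_distrib using \<kappa>_pos by (simp add: algebra_simps)
  finally show ?thesis .
qed

text \<open>The cap at \<open>p s\<close> is given by
  \<open>c * z y - s * l y \<le> sqrt (\<kappa> + h)\<close>, whose left side is the height after
  the inverse boost. Hence it is the image of the cap at the vertex,
  \<open>z y \<le> sqrt (\<kappa> + h)\<close>, and that is an ellipsoid. The number
  \<open>\<tau>\<close> is the vertical distance of the tangent hyperplanes
  \<open>c * z - s * l = sqrt \<kappa>\<close> and
  \<open>c * z - s * l = sqrt (\<kappa> + h)\<close>.\<close>

lemma cap_boost:
  assumes cs: "c\<^sup>2 = 1 + s\<^sup>2" "c > 0" and h: "h > 0"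
  defines "\<tau> \<equiv> (sqrt ((\<kappa> + h) / \<kappa>) - 1) * \<kappa> / (sqrt \<kappa> * c)"
  shows "cap (dom k) (height k) (x0 + p s) \<tau> = (\<lambda>y. x0 + boost c s y) ` ellipsoid Q (2 * h)"
proof -
  define r where "r = sqrt ((\<kappa> + h) / \<kappa>)"
  have sk: "sqrt \<kappa> > 0" "sqrt \<kappa> * sqrt \<kappa> = \<kappa>" using \<kappa>_pos by auto
  have rk: "r * sqrt \<kappa> = sqrt (\<kappa> + h)" using \<kappa>_pos h by (simp add: r_def real_sqrt_divide)
  have Ty: "z (p s) + grad (height k) (x0 + p s) \<bullet> (y - p s) + \<tau> = (r * sqrt \<kappa> + s * l y) / c" for y
  proof -
    have "grad (height k) (x0 + p s) \<bullet> (y - p s) = (1 / (2 * (sqrt \<kappa> * c))) * (Q (p s) \<bullet> y - p s \<bullet> Q (p s))"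
      unfolding grad_height_k p_simps(2)[OF cs] by (simp add: inner_diff_right inner_diff_left inner_commute)
    also have "Q (p s) \<bullet> y = 2 * (sqrt \<kappa> * s * l y)"
      unfolding p_def linear_scale[OF linQ] by (simp add: symQ Qa)
    finally have 1: "grad (height k) (x0 + p s) \<bullet> (y - p s) = (1 / (2 * (sqrt \<kappa> * c))) * (2 * (sqrt \<kappa> * s * l y) - 2 * \<kappa> * s\<^sup>2)"
      unfolding p_simps(4)[OF cs] .
    have "(z (p s) + grad (height k) (x0 + p s) \<bullet> (y - p s) + \<tau>) * (sqrt \<kappa> * c) = 
        \<kappa> * c\<^sup>2 + (sqrt \<kappa> * s * l y - \<kappa> * s\<^sup>2) + (r - 1) * \<kappa>"
      unfolding 1 p_simps(2)[OF cs] \<tau>_def r_def[symmetric] using sk cs(2)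
      by (simp add: distrib_right power2_eq_square) (simp add: field_simps)
    also have "\<dots> = sqrt \<kappa> * (r * sqrt \<kappa> + s * l y)"
      unfolding cs(1) using sk(2) by (simp add: algebra_simps)
    finally have "sqrt \<kappa> * ((z (p s) + grad (height k) (x0 + p s) \<bullet> (y - p s) + \<tau>) * c) = sqrt \<kappa> * (r * sqrt \<kappa> + s * l y)"
      by (simp only: mult_ac)
    then have "(z (p s) + grad (height k) (x0 + p s) \<bullet> (y - p s) + \<tau>) * c = r * sqrt \<kappa> + s * l y"
      using sk(1) by (simp only: mult_left_cancel)
    then show ?thesis using cs(2) by (simp only: eq_divide_eq) simp
  qed
  have cap: "x0 + y \<in> cap (dom k) (height k) (x0 + p s) \<tau> \<longleftrightarrow> c * z y - s * l y \<le> sqrt (\<kappa> + h)" for y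
  proof -
    have "x0 + y \<in> cap (dom k) (height k) (x0 + p s) \<tau> \<longleftrightarrow> z y \<le> (r * sqrt \<kappa> + s * l y) / c"
      unfolding Ty[symmetric] by (simp add: cap_def dom_UNIV height_eq)
    then show ?thesis using cs(2) unfolding rk by (simp add: pos_le_divide_eq mult.commute algebra_simps)
  qed
  have ell: "y \<in> ellipsoid Q (2 * h) \<longleftrightarrow> z y \<le> sqrt (\<kappa> + h)" for y
    unfolding z_def ellipsoid_def by (auto simp: algebra_simps)
  have cs': "c\<^sup>2 = 1 + (- s)\<^sup>2" using cs by simp
  show ?thesis
  proof (intro equalityI subsetI)
    fix x assume x: "x \<in> cap (dom k) (height k) (x0 + p s) \<tau>"
    define y where "y = boost c (- s) (x - x0)"
    have "boost c s y = x - x0" using boost(4)[OF cs' cs(2), of "x - x0"] by (simp add: y_def)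
    then have "x = x0 + boost c s y" by simp
    moreover have "y \<in> ellipsoid Q (2 * h)"
      using cap[of "x - x0"] x unfolding ell y_def boost(2)[OF cs' cs(2)] by simp
    ultimately show "x \<in> (\<lambda>y. x0 + boost c s y) ` ellipsoid Q (2 * h)" by blast
  next
    fix x assume "x \<in> (\<lambda>y. x0 + boost c s y) ` ellipsoid Q (2 * h)"
    then obtain y where y: "x = x0 + boost c s y" "z y \<le> sqrt (\<kappa> + h)" using ell by auto
    have "c * z (boost c s y) + - s * l (boost c s y) = z y"
      using boost(2)[OF cs' cs(2), of "boost c s y"] boost(4)[OF cs, of y] by simp
    then show "x \<in> cap (dom k) (height k) (x0 + p s) \<tau>" unfolding y cap using y(2) by simp
  qed
qed

text \<open>The area density is the norm of the gradient of \<open>g\<close> divided by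
  \<open>2 * z\<close>. At the boosted point its denominator cancels against the Jacobian and leaves
  the unboosted \<open>z\<close>.\<close>

lemma cap_area:
  assumes cs: "c\<^sup>2 = 1 + s\<^sup>2" "c > 0" and h: "h > 0"
  defines "\<tau> \<equiv> (sqrt ((\<kappa> + h) / \<kappa>) - 1) * \<kappa> / (sqrt \<kappa> * c)"
  shows "compact (cap (dom k) (height k) (x0 + p s) \<tau>)"
    "integral (cap (dom k) (height k) (x0 + p s) \<tau>) (\<lambda>x. sqrt (1 + (norm (grad (height k) x))\<^sup>2))
      = integral (ellipsoid Q (2 * h)) (\<lambda>y. N c s y / (2 * z y))"
proof -
  let ?B = "ellipsoid Q (2 * h)" and ?F = "\<lambda>y. x0 + boost c s y" and ?w = "\<lambda>x. sqrt (1 + (norm (grad (height k) x))\<^sup>2)"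
  let ?F' = "\<lambda>y v. v + ((((c - 1) / 2) *\<^sub>R Q a + (s / (2 * z y)) *\<^sub>R Q y) \<bullet> v) *\<^sub>R a"
  note cap = cap_boost[OF cs h, folded \<tau>_def]
  have B: "compact ?B" by (rule compact_ellipsoid[OF pos_def_hess_f])
  have hd: "(?F has_derivative ?F' y) (at y)" for y
    using has_derivative_add[OF has_derivative_const has_derivative_boost] by simp
  have cF: "continuous_on ?B ?F"
    by (intro continuous_at_imp_continuous_on ballI has_derivative_continuous[OF hd])
  show comp: "compact (cap (dom k) (height k) (x0 + p s) \<tau>)"
    unfolding cap by (rule compact_continuous_image[OF cF B])
  have inj: "inj_on ?F ?B"
    by (rule inj_onI) (metis add_left_cancel boost(4)[OF cs])
  have ai: "?w absolutely_integrable_on ?F ` ?B"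
    unfolding cap[symmetric]
    by (intro absolutely_integrable_continuous_compact[OF comp] continuous_intros
      continuous_on_subset[OF continuous_on_grad[OF smooth_height]]) (auto simp: cap_def)
  have w: "?w (x0 + y) = sqrt ((norm (Q y))\<^sup>2 + 4 * (z y)\<^sup>2) / (2 * z y)" for y
  proof -
    have "?w (x0 + y) = sqrt (((norm (Q y))\<^sup>2 + 4 * (z y)\<^sup>2) / (2 * z y)\<^sup>2)"
      unfolding grad_height_k using z_pos[of y] by (simp add: power_divide power_mult_distrib add_divide_distrib)
    moreover have "0 < 2 * z y" using z_pos[of y] by simp
    then have "sqrt ((2 * z y)\<^sup>2) = 2 * z y" by (simp only: real_sqrt_abs abs_of_pos)
    ultimately show ?thesis by (simp only: real_sqrt_divide)
  qed
  have "integral (?F ` ?B) ?w = integral ?B (\<lambda>y. \<bar>det (matrix (?F' y))\<bar> * ?w (?F y))"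
    by (rule change_of_variables[symmetric, OF _ _ inj ai])
      (use B hd in \<open>auto simp: lmeasurable_compact fmeasurableD intro: has_derivative_at_withinI\<close>)
  also have "\<dots> = integral ?B (\<lambda>y. N c s y / (2 * z y))"
  proof (rule integral_cong)
    fix y
    have "z (boost c s y) > 0" by (rule z_pos)
    moreover have "(norm (Q (boost c s y)))\<^sup>2 + 4 * (z (boost c s y))\<^sup>2 =
        2 * \<mu> * (c * l y + s * z y)\<^sup>2 + b y + 4 * (c * z y + s * l y)\<^sup>2"
      unfolding norm_Q_sq boost[OF cs] ..
    ultimately show "\<bar>det (matrix (?F' y))\<bar> * ?w (?F y) = N c s y / (2 * z y)"
      unfolding det_boost[OF cs] w N_def using z_pos[of y] by simp
  qed
  finally show "integral (cap (dom k) (height k) (x0 + p s) \<tau>) ?w = integral ?B (\<lambda>y. N c s y / (2 * z y))"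
    unfolding cap .
qed

text \<open>Dilation about the centre by \<open>sqrt ((\<kappa> + h) / \<kappa>)\<close> carries the
  level of \<open>k\<close> to that of \<open>k + h\<close> and preserves tangent directions, so the
  dilate of \<open>p s\<close> is the point of contact.\<close>

lemma parallel_point:
  assumes cs: "c\<^sup>2 = 1 + s\<^sup>2" "c > 0" and h: "h > 0"
  defines "\<tau> \<equiv> (sqrt ((\<kappa> + h) / \<kappa>) - 1) * \<kappa> / (sqrt \<kappa> * c)"
    and "v \<equiv> x0 + sqrt ((\<kappa> + h) / \<kappa>) *\<^sub>R p s"
  shows "v \<in> dom (k + h)" "grad (height (k + h)) v = grad (height k) (x0 + p s)"
    "height (k + h) v = height k (x0 + p s) + grad (height k) (x0 + p s) \<bullet> (v - (x0 + p s)) + \<tau>" "0 \<le> \<tau>"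
proof -
  define r where "r = sqrt ((\<kappa> + h) / \<kappa>)"
  have r1: "r \<ge> 1" using \<kappa>_pos h by (simp add: r_def)
  have r2: "r\<^sup>2 = (\<kappa> + h) / \<kappa>" using \<kappa>_pos h by (simp add: r_def)
  have sk: "sqrt \<kappa> > 0" "sqrt \<kappa> * sqrt \<kappa> = \<kappa>" using \<kappa>_pos by auto
  have "f v + (k + h) = r\<^sup>2 * (p s \<bullet> Q (p s)) / 2 + (\<kappa> + h)"
    unfolding v_def r_def[symmetric] quadratic by (simp add: linear_scale[OF linQ] power2_eq_square \<kappa>_def)
  also have "\<dots> = r\<^sup>2 * (\<kappa> * c\<^sup>2)"
    unfolding p_simps(4)[OF cs] cs(1) r2 using \<kappa>_pos by (simp add: field_simps)
  also have "\<dots> = (r * (sqrt \<kappa> * c))\<^sup>2" using \<kappa>_pos by (simp add: power_mult_distrib)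
  finally have fv: "f v + (k + h) = (r * (sqrt \<kappa> * c))\<^sup>2" .
  have rp: "r * (sqrt \<kappa> * c) > 0" using r1 sk cs(2) by simp
  have fp: "f v + (k + h) > 0" unfolding fv by (rule zero_less_power[OF rp])
  then show "v \<in> dom (k + h)" by (simp add: dom_def)
  have sq: "sqrt (f v + (k + h)) = r * (sqrt \<kappa> * c)" unfolding fv by (simp only: real_sqrt_abs abs_of_pos[OF rp])
  have "grad (height (k + h)) v = (1 / (2 * (r * (sqrt \<kappa> * c)))) *\<^sub>R Q (r *\<^sub>R p s)"
    using grad_height_eq[of "r *\<^sub>R p s" "k + h"] fp sq unfolding v_def r_def[symmetric] by simp
  also have "\<dots> = grad (height k) (x0 + p s)"
    unfolding grad_height_k p_simps(2)[OF cs] linear_scale[OF linQ] using r1 by simp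
  finally show "grad (height (k + h)) v = grad (height k) (x0 + p s)" .
  have hv: "height (k + h) v = r * (sqrt \<kappa> * c)"
    using height_sqrt[of v "k + h"] fp unfolding sq by simp
  have "grad (height k) (x0 + p s) \<bullet> (v - (x0 + p s)) = ((r - 1) / (2 * (sqrt \<kappa> * c))) * (2 * \<kappa> * s\<^sup>2)"
  proof -
    have "v - (x0 + p s) = (r - 1) *\<^sub>R p s" by (simp add: v_def r_def algebra_simps)
    then show ?thesis unfolding grad_height_k p_simps(2)[OF cs] p_simps(4)[OF cs, symmetric] by (simp add: inner_commute)
  qed
  moreover have "(sqrt \<kappa> * c + ((r - 1) / (2 * (sqrt \<kappa> * c))) * (2 * \<kappa> * s\<^sup>2) + \<tau>) * (sqrt \<kappa> * c)
      = \<kappa> * c\<^sup>2 + (r - 1) * (\<kappa> * s\<^sup>2) + (r - 1) * \<kappa>"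
    unfolding \<tau>_def r_def[symmetric] using sk cs(2) by (simp add: distrib_right power2_eq_square)
  moreover have "\<dots> = (r * (sqrt \<kappa> * c)) * (sqrt \<kappa> * c)"
  proof -
    have "(r * (sqrt \<kappa> * c)) * (sqrt \<kappa> * c) = r * \<kappa> * c\<^sup>2" using sk(2) by (simp add: power2_eq_square mult_ac)
    then show ?thesis unfolding cs(1) by (simp add: algebra_simps)
  qed
  ultimately show "height (k + h) v = height k (x0 + p s) + grad (height k) (x0 + p s) \<bullet> (v - (x0 + p s)) + \<tau>"
    unfolding hv height_eq p_simps(2)[OF cs] using sk cs(2) by (metis less_irrefl mult_cancel_right zero_less_mult_iff)
  show "0 \<le> \<tau>" unfolding \<tau>_def r_def[symmetric] using r1 \<kappa>_pos cs(2) by simp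
qed

end

section \<open>Comparison of the cap at the vertex with a boosted cap\<close>

context hyperboloid_levels
begin

lemma uminus_simps: "l (- y) = - l y" "z (- y) = z y" "b (- y) = b y"
proof -
  have Qm: "Q (- y) = - Q y" for y using linear_neg[OF linQ] .
  show l: "l (- y) = - l y" by (simp add: l_def Qm)
  show "z (- y) = z y" by (simp add: z_def Qm)
  have "- y - l (- y) *\<^sub>R a = - (y - l y *\<^sub>R a)" by (simp add: l)
  then show "b (- y) = b y" unfolding b_def by (simp only: Qm norm_minus_cancel)
qed

lemma continuous_l_z_b: "continuous_on A l" "continuous_on A z" "continuous_on A b" "continuous_on A (N c s)"
proof -
  have bl: "bounded_linear Q" using linQ by (simp add: linear_conv_bounded_linear)
  have cQ: "continuous_on B Q" for B by (rule linear_continuous_on[OF bl])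
  show l: "continuous_on A l" unfolding l_def[abs_def] by (intro continuous_intros cQ) simp
  show z: "continuous_on A z" unfolding z_def[abs_def] by (intro continuous_intros cQ) simp
  show b: "continuous_on A b" unfolding b_def[abs_def]
    by (intro continuous_intros continuous_on_compose2[OF cQ[of UNIV]] l) auto
  show "continuous_on A (N c s)" unfolding N_def[abs_def] by (intro continuous_intros l z b)
qed

lemma eventually_cap_integral:
  assumes S: "is_S upper_half_space g S" and k: "k \<in> interior S" and \<eta>: "condition_with \<eta> S"
    and cs: "c\<^sup>2 = 1 + s\<^sup>2" "c > 0"
  shows "\<forall>\<^sub>F h in at_right 0. integral (ellipsoid Q (2 * h)) (\<lambda>y. N c s y / (2 * z y))
    = sqrt (\<kappa> * (2 * \<mu> * s\<^sup>2 + 4 * c\<^sup>2)) * \<eta> k h"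
proof -
  have sg1: "sg = 1" using \<alpha>2 by simp
  have "x0 + p s \<in> dom k" "good (x0 + p s)"
    using dom_UNIV \<alpha>2 unfolding good_def by auto
  from eventually_cap_area[OF S k this \<eta>, unfolded sg1 mult_1] eventually_at_right_less[of 0]
  show ?thesis
  proof eventually_elim
    case (elim h)
    show ?case
      using elim(1)[rule_format, OF parallel_point[OF cs elim(2)] cap_area(1)[OF cs elim(2)]]
      unfolding cap_area(2)[OF cs elim(2)] norm_grad_p[OF cs] .
  qed
qed

text \<open>At one small \<open>h\<close>, valid for both the vertex and the boosted point, the
  condition forces a fixed linear combination of the two integrands to have integral zero over the
  common ellipsoid, while its symmetrization is positive away from the origin.\<close>

theorem not_condition:
  assumes S: "is_S upper_half_space g S" and k: "k \<in> interior S" and \<eta>: "condition_with \<eta> S"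
  shows False
proof -
  \<comment> \<open>Any point of the hyperbola \<open>c^2 = 1 + s^2\<close> with positive
    coordinates would do; this one is rational.\<close>
  define c s :: real where "c = 5 / 4" and "s = 3 / 4"
  have cs: "c\<^sup>2 = 1 + s\<^sup>2" "c > 0" and s0: "s > 0" by (simp_all add: c_def s_def power2_eq_square)
  have cs0: "(1::real)\<^sup>2 = 1 + 0\<^sup>2" "(1::real) > 0" by simp_all
  define D where "D = 2 * \<mu> * s\<^sup>2 + 4 * c\<^sup>2"
  have D: "D > 0" using \<mu> s0 cs(2) by (simp add: D_def add_pos_pos)
  obtain t0 where t0: "t0 > 0" "\<And>l b z. 0 < l\<^sup>2 + b \<and> 0 \<le> b \<and> l\<^sup>2 + b < t0 \<and> \<kappa> \<le> z\<^sup>2 \<Longrightarrow>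
    sqrt (2 * \<mu> * (c * l + s * z)\<^sup>2 + b + 4 * (c * z + s * l)\<^sup>2) + sqrt (2 * \<mu> * (c * (- l) + s * z)\<^sup>2 + b + 4 * (c * z + s * (- l))\<^sup>2)
      < sqrt (D * (2 * \<mu> * l\<^sup>2 + b + 4 * z\<^sup>2))"
    using boost_inequality[OF \<mu> \<kappa>_pos s0 cs(1)] unfolding D_def by blast
  define t where "t y = (l y)\<^sup>2 + b y" for y
  have zero: "l 0 = 0" "b 0 = 0" "z 0 = sqrt \<kappa>"
    by (simp_all add: l_def b_def z_def linear_0[OF linQ])
  have bn: "0 \<le> b y" for y by (simp add: b_def)
  have tpos: "0 < t y" if "y \<noteq> 0" for y
  proof (rule ccontr)
    assume "\<not> ?thesis"
    then have ly: "(l y)\<^sup>2 = 0" and by0: "b y = 0"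
      using bn[of y] zero_le_power2[of "l y"] unfolding t_def by linarith+
    then have "Q y = 0" by (simp add: b_def)
    then show False using posQ[OF that] by simp
  qed
  have "continuous_on UNIV t" unfolding t_def[abs_def] by (intro continuous_intros continuous_l_z_b)
  then have "open (t -` {..<t0})" by (intro open_vimage) auto
  moreover have "0 \<in> t -` {..<t0}" using t0(1) by (simp add: t_def zero)
  ultimately obtain \<rho> where \<rho>: "\<rho> > 0" "ball 0 \<rho> \<subseteq> t -` {..<t0}" using open_contains_ball by blast
  obtain q where q: "q > 0" "\<And>u. q * (norm u)\<^sup>2 \<le> u \<bullet> Q u" using pos_def_coercive[OF pos_def_hess_f[of x0]] by blast
  have "\<forall>\<^sub>F h in at_right 0. h \<in> {0<..<q * \<rho>\<^sup>2 / 2}" by (rule eventually_at_right_real) (use q \<rho> in simp)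
  from eventually_happens[OF eventually_conj[OF this eventually_conj[OF
    eventually_cap_integral[OF S k \<eta> cs] eventually_cap_integral[OF S k \<eta> cs0]]]]
  obtain h where h: "0 < h" "h < q * \<rho>\<^sup>2 / 2"
    and Is: "integral (ellipsoid Q (2 * h)) (\<lambda>y. N c s y / (2 * z y)) = sqrt (\<kappa> * D) * \<eta> k h"
    and I0: "integral (ellipsoid Q (2 * h)) (\<lambda>y. N 1 0 y / (2 * z y)) = sqrt (\<kappa> * 4) * \<eta> k h"
    unfolding D_def by (auto simp: trivial_limit_at_right_real)
  let ?B = "ellipsoid Q (2 * h)"
  have B: "compact ?B" by (rule compact_ellipsoid[OF pos_def_hess_f])
  have zn: "z y \<noteq> 0" for y using z_pos[of y] by simp
  have int: "F absolutely_integrable_on ?B" "F integrable_on ?B" if "continuous_on UNIV F" for F :: "real^'n \<Rightarrow> real"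
    using absolutely_integrable_continuous_compact[OF B continuous_on_subset[OF that subset_UNIV]] set_lebesgue_integral_eq_integral(1) by blast+
  \<comment> \<open>The factors \<open>sqrt D\<close> and \<open>2\<close> come from the ratio
    \<open>sqrt (\<kappa> * D)\<close> to \<open>sqrt (\<kappa> * 4)\<close> of the
    gradients.\<close>
  define G where "G y = sqrt D * (N 1 0 y / (2 * z y)) - 2 * (N c s y / (2 * z y))" for y
  have cN: "continuous_on UNIV (\<lambda>y. N c s y / (2 * z y))" for c s
    by (intro continuous_intros continuous_l_z_b) (simp add: zn)
  have cG: "continuous_on UNIV G" unfolding G_def[abs_def] by (intro continuous_intros cN)
  have G0: "integral ?B G = 0"
  proof -
    have "integral ?B G = integral ?B (\<lambda>y. sqrt D * (N 1 0 y / (2 * z y))) - integral ?B (\<lambda>y. 2 * (N c s y / (2 * z y)))"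
      unfolding G_def[abs_def]
      by (rule integral_diff) (intro int(2) continuous_on_mult continuous_on_const cN)+
    also have "\<dots> = sqrt D * integral ?B (\<lambda>y. N 1 0 y / (2 * z y)) - 2 * integral ?B (\<lambda>y. N c s y / (2 * z y))"
      by (simp only: integral_mult_right)
    also have "\<dots> = 0" unfolding Is I0 using real_sqrt_mult[of \<kappa> D] real_sqrt_mult[of \<kappa> 4] by simp
    finally show ?thesis .
  qed
  have Gm: "integral ?B (\<lambda>y. G (- y)) = 0"
  proof -
    have inv: "uminus ` ?B = ?B"
    proof -
      have "uminus ` ?B \<subseteq> ?B" by (auto simp: ellipsoid_def linear_neg[OF linQ])
      then show ?thesis by (metis (no_types, lifting) image_mono minus_minus image_image image_ident subset_antisym image_cong)
    qed
    have "matrix (uminus :: real^'n \<Rightarrow> real^'n) = matrix ((*\<^sub>R) (- 1))" by (rule arg_cong[where f = matrix]) auto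
    then have det: "\<bar>det (matrix (uminus :: real^'n \<Rightarrow> real^'n))\<bar> = 1" by (simp add: power_abs)
    have "integral ?B (\<lambda>y. \<bar>det (matrix (uminus :: real^'n \<Rightarrow> real^'n))\<bar> * G (- y)) = integral (uminus ` ?B) G"
      by (rule change_of_variables[where g' = "\<lambda>_. uminus"])
        (use B int(1)[OF cG] inv in \<open>auto simp: lmeasurable_compact fmeasurableD intro!: derivative_eq_intros\<close>)
    then show ?thesis unfolding det inv using G0 by simp
  qed
  \<comment> \<open>\<open>G\<close> itself has a term odd in \<open>l\<close> and no definite sign
    near the origin. The domain is symmetric, so averaging over \<open>y\<close> and
    \<open>- y\<close> keeps the integral and makes the pointwise inequality applicable.\<close>
  define R where "R y = G y + G (- y)" for y
  have cR: "continuous_on UNIV R"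
    unfolding R_def[abs_def] by (intro continuous_intros cG continuous_on_compose2[OF cG]) auto
  have R0: "integral ?B R = 0"
    unfolding R_def[abs_def] using G0 Gm
    by (subst integral_add) (auto intro!: int(2) cG continuous_on_compose2[OF cG] continuous_intros)
  have Rform: "R y = (sqrt (D * (2 * \<mu> * (l y)\<^sup>2 + b y + 4 * (z y)\<^sup>2)) -
     (sqrt (2 * \<mu> * (c * l y + s * z y)\<^sup>2 + b y + 4 * (c * z y + s * l y)\<^sup>2) + sqrt (2 * \<mu> * (c * (- l y) + s * z y)\<^sup>2 + b y + 4 * (c * z y + s * (- l y))\<^sup>2))) / z y" for y
  proof -
    have "N 1 0 (- y) = N 1 0 y" by (simp add: N_def uminus_simps)
    then have "R y = (sqrt D * N 1 0 y - (N c s y + N c s (- y))) / z y"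
      unfolding R_def G_def uminus_simps using zn[of y] by (simp add: field_simps)
    then show ?thesis by (simp add: N_def uminus_simps real_sqrt_mult)
  qed
  have Rpos: "R y > 0" if y: "y \<in> ?B" "y \<noteq> 0" for y
  proof -
    have "norm y < \<rho>" by (rule ellipsoid_bound[OF q y(1) _ \<rho>(1)]) (use h in simp)
    then have "t y < t0" using \<rho>(2) by (auto simp: subset_iff)
    moreover have "\<kappa> \<le> (z y)\<^sup>2" unfolding z_sq using nonnegQ[of y] by simp
    ultimately show ?thesis
      unfolding Rform using t0(2)[of "l y" "b y" "z y"] tpos[OF y(2)] bn[of y] z_pos[of y]
      by (simp add: t_def)
  qed
  have Rz: "R 0 = 0"
  proof -
    have e: "2 * \<mu> * (s * sqrt \<kappa>)\<^sup>2 + 4 * (c * sqrt \<kappa>)\<^sup>2 = \<kappa> * D"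
      using \<kappa>_pos by (simp add: D_def power_mult_distrib algebra_simps)
    have "sqrt (D * (4 * \<kappa>)) = 2 * sqrt (\<kappa> * D)" by (simp add: real_sqrt_mult)
    then show ?thesis unfolding Rform zero using e \<kappa>_pos by simp
  qed
  have Rnn: "0 \<le> R y" if "y \<in> ?B" for y using Rpos[OF that] Rz by (cases "y = 0") auto
  \<comment> \<open>A continuous nonnegative function with integral zero vanishes on a box around
    the origin, whereas \<open>R\<close> is positive at every nonzero point of the
    ellipsoid.\<close>
  have "open {y. y \<bullet> Q y < 2 * h}"
    by (intro open_Collect_less continuous_on_quadratic[OF linQ] continuous_on_const)
  moreover have "0 \<in> {y. y \<bullet> Q y < 2 * h}" using h(1) by simp
  ultimately obtain a' b' where ab: "cbox a' b' \<subseteq> {y. y \<bullet> Q y < 2 * h}" "0 \<in> box a' b'"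
    by (rule open_contains_cbox)
  have cB: "cbox a' b' \<subseteq> ?B" using ab(1) by (auto simp: ellipsoid_def)
  have cbR: "continuous_on (cbox a' b') R" by (rule continuous_on_subset[OF cR subset_UNIV])
  have "integral (cbox a' b') R \<le> integral ?B R"
    by (rule integral_subset_le[OF cB integrable_continuous[OF cbR] int(2)[OF cR]]) (use Rnn in blast)
  moreover have "0 \<le> integral (cbox a' b') R"
    by (rule integral_nonneg[OF integrable_continuous[OF cbR]]) (use Rnn cB in blast)
  ultimately have "integral (cbox a' b') R = 0" using R0 by simp
  then have Rzero: "\<forall>y\<in>cbox a' b'. R y = 0"
    using integral_cbox_eq_0_iff[OF cbR] ab(2) Rnn cB by blast
  have "box a' b' \<subseteq> {0}"
  proof
    fix y assume y: "y \<in> box a' b'"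
    then have "y \<in> cbox a' b'" using box_subset_cbox by blast
    then have "R y = 0" "y \<in> ?B" using Rzero cB by auto
    then show "y \<in> {0}" using Rpos[of y] by auto
  qed
  then have "box a' b' = {0}" using ab(2) by auto
  then show False using open_box[of a' b'] not_open_singleton[of "0 :: real^'n"] by simp
qed

end

theorem theorem5:
  fixes f :: "real^'n \<Rightarrow> real" and \<alpha> :: real
    and g :: "(real^'n) \<times> real \<Rightarrow> real" and S :: "real set"
  assumes "\<And>x. 0 \<le> f x" and "strictly_convex_function f"
    and "\<alpha> \<noteq> 0" and "\<alpha> \<noteq> 1"
    and "\<And>x z. g (x, z) = z powr \<alpha> - f x"
    and "is_S upper_half_space g S"
  shows "\<not> condition_S_star upper_half_space g S"
proof
  assume "condition_S_star upper_half_space g S"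
  interpret power_levels f \<alpha> g by unfold_locales (use assms in auto)
  note S = assms(6)
  obtain \<eta> where \<eta>: "condition_with \<eta> S"
    using \<open>condition_S_star upper_half_space g S\<close> unfolding condition_S_star_def condition_with_def by blast
  show False
  proof (cases "\<alpha> = 2")
    case False
    then show ?thesis using not_condition_exponent_neq_2[OF S \<eta> assms(4)] by blast
  next
    case True
    obtain m where m: "\<And>x X. hess f x X = grad f x \<Longrightarrow> f x - (grad f x \<bullet> X) / 2 = m"
      using exponent_2_identity[OF S \<eta> True] by blast
    interpret newton_identity f m
      by unfold_locales (use smooth_f pos_def_hess_f m in auto)
    obtain x0 where x0: "\<And>y. grad f (x0 + y) = hess f x0 y" "\<And>y. f (x0 + y) = m + (y \<bullet> hess f x0 y) / 2"
      using quadratic by blast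
    obtain a \<mu> where a: "\<mu> > 0" "hess f x0 a = \<mu> *\<^sub>R a" "a \<bullet> a = 2 / \<mu>"
      using pos_def_eigenvector[OF pos_def_hess_f hess_f_symmetric] by blast
    obtain k where k: "k \<in> interior S" using is_S_D(2)[OF S] by blast
    have sc: "strictly_convex_hypersurface (M k)" using is_S_D(3)[OF S] k interior_subset by blast
    interpret hyperboloid_levels f \<alpha> g x0 a m \<mu> k
      by unfold_locales (use True x0 a sc in auto)
    show ?thesis by (rule not_condition[OF S k \<eta>])
  qed
qed

end
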